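(* Let $\Delta:\Theta\to\mathbb R^+$ satisfy $\sum_{\theta\in\Theta}e^{-\Delta(\theta)}\le1$, and let $$D_n(\delta,\theta)=818.1\,\overline V\left[5.82+\log\left(\frac{(K+1)^2}{\delta(\theta)}\right)+\log_+\left(\frac n{\overline V}\right)\right],\qquad \mathrm{pen}(q)=\kappa\inf_{\theta\in\Theta:\,Q\in\mathscr Q(\theta)}\left[\frac{D_n(\delta,\theta)}{4.7}+\Delta(\theta)\right]$$ for $q\in\mathcal Q_\delta$, $Q=q\cdot\mu$, where for $\theta=(K,\lambda_1,\dots,\lambda_K)$, $\overline V=V(\theta)=V_{1,\lambda_1}+\dots+V_{K,\lambda_K}$. For all $\xi>0$, any $\rho$-estimator $\hat P$ on $\mathscr Q_\delta$ with penalty $\mathrm{pen}$ satisfies, with probability at least $1-e^{-\xi}$, $$\mathbf h^2\left(\mathbf P^*,\hat P^{\otimes n}\right)\le\inf_{\theta\in\Theta}\left[c_0\left(\mathbf h^2(\mathbf P^*,\mathscr Q(\theta))+n(K-1)\delta(\theta)\right)+c_2\left(174.1\,\overline V\left[5.82+\log\left(\frac{(K+1)^2}{\delta(\theta)}\right)+\log_+\left(\frac n{\overline V}\right)\right]+\Delta(\theta)\right)\right]+c_2(1.49+\xi),$$ with $c_0=300$ and $c_2=5014$ (in the infimum, $K$ and $\overline V$ are those associated with $\theta$).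
   Context: Data. $X_1,\dots,X_n$ are independent with values in $(\mathscr X,\mathcal X)$, $\mathbf X=(X_1,\dots,X_n)$ has distribution $\mathbf P^*=P_1^*\otimes\dots\otimes P_n^*$; $\mathscr P$ is the set of probabilities on $(\mathscr X,\mathcal X)$. $h^2(Q,Q')=\frac12\int(\sqrt{dQ/d\nu}-\sqrt{dQ'/d\nu})^2d\nu$, $\mathbf h^2(\bigotimes_iQ_i,\bigotimes_iQ_i')=\sum_{i=1}^nh^2(Q_i,Q_i')$, $\mathbf h^2(\mathbf P,\mathscr A)=\inf_{Q\in\mathscr A}\mathbf h^2(\mathbf P,Q^{\otimes n})$. $\log_+(x)=\max(\log x,0)$. The VC-index of a class of functions is the smallest integer $m\ge1$ such that no $m$-point set is shattered by the subgraphs $\{(x,t):t<f(x)\}$; the class is VC-subgraph if this is finite. Models. For $k\ge1$, $\Lambda_k$ is at most countable; for $\lambda\in\Lambda_k$, $\overline{\mathscr F}_{k,\lambda}\subset\mathscr P$ contains an at most countable Hellinger-dense subset $\mathscr F_{k,\lambda}$; $\mu$ is a $\sigma$-finite measure dominating all of them and $\overline{\mathscr F}_{k,\lambda}=\{f\cdot\mu:f\in\overline{\mathcal F}_{k,\lambda}\}$, where $\overline{\mathcal F}_{k,\lambda}$ is VC-subgraph with VC-index $V_{k,\lambda}\ge1$. $\Theta\subset\bigcup_{K\ge1}\{K\}\times\prod_{k=1}^K\Lambda_k$, and $\delta:\Theta\to(0,1]$ satisfies $\delta(\theta)\in(0,1/K]$ for $\theta=(K,\lambda_1,\dots,\lambda_K)$.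 With $\mathcal W_K=\{w\in[0,1]^K:\sum_kw_k=1\}$, $\mathscr Q(\theta)=\{\sum_{k=1}^Kw_kF_k:w\in\mathcal W_K,F_k\in\overline{\mathscr F}_{k,\lambda_k}\}$, $\mathscr Q_\delta(\theta)=\{\sum_{k=1}^Kw_kF_k:w\in\mathcal W_K,w_k\in[\delta(\theta),1]\cap\mathbb Q,F_k\in\mathscr F_{k,\lambda_k}\}$, $\mathscr Q_\delta=\bigcup_{\theta\in\Theta}\mathscr Q_\delta(\theta)$, with corresponding family of $\mu$-densities $\mathcal Q_\delta$. Penalized $\rho$-estimator. Let $\psi(x)=\frac{x-1}{x+1}$ on $[0,+\infty]$ ($\psi(+\infty)=1$), $\mathbf T(\mathbf X,q,q')=\sum_{i=1}^n\psi\big(\sqrt{q'(X_i)/q(X_i)}\big)$ (with $0/0=1$, $a/0=+\infty$ for $a>0$) and $\mathbf\Upsilon(\mathbf X,q)=\sup_{q'\in\mathcal Q_\delta}[\mathbf T(\mathbf X,q,q')-\mathrm{pen}(q')]+\mathrm{pen}(q)$. A $\rho$-estimator on $\mathscr Q_\delta$ with penalty $\mathrm{pen}$ is any measurable element of the Hellinger closure of $\{q\cdot\mu:q\in\mathcal Q_\delta,\ \mathbf\Upsilon(\mathbf X,q)<\inf_{q'\in\mathcal Q_\delta}\mathbf\Upsilon(\mathbf X,q')+8.24\}$. The numerical constant $\kappa$ is $\kappa=\frac{35a_2^2}{a_1}+74=280\sqrt2+74$ with $a_1=3/8$, $a_2^2=3\sqrt2$. *)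

theory Defs
  imports "HOL-Probability.Probability"
begin

section \<open>Hellinger distance\<close>

definition sum_measure :: "'a measure \<Rightarrow> 'a measure \<Rightarrow> 'a measure" where
  "sum_measure P Q = measure_of (space P) (sets P) (\<lambda>A. emeasure P A + emeasure Q A)"

text \<open>The squared Hellinger distance does not depend on the dominating measure; the definition takes
  it to be \<open>P + Q\<close>, and \<open>hellinger_sq_density\<close> below covers every other \<open>\<sigma>\<close>-finite choice.\<close>

definition hellinger_sq :: "'a measure \<Rightarrow> 'a measure \<Rightarrow> real" where
  "hellinger_sq P Q =
     (1/2) * (\<integral>x. (sqrt (enn2real (RN_deriv (sum_measure P Q) P x))
                  - sqrt (enn2real (RN_deriv (sum_measure P Q) Q x)))\<^sup>2 \<partial>sum_measure P Q)"

lemma sets_sum_measure [simp]: "sets (sum_measure P Q) = sets P"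
  and space_sum_measure [simp]: "space (sum_measure P Q) = space P"
  by (simp_all add: sum_measure_def)

lemma emeasure_sum_measure:
  assumes "sets Q = sets P" "A \<in> sets P"
  shows "emeasure (sum_measure P Q) A = emeasure P A + emeasure Q A"
  unfolding sum_measure_def
proof (rule emeasure_measure_of_sigma)
  show "countably_additive (sets P) (\<lambda>A. emeasure P A + emeasure Q A)"
    using assms(1) by (auto simp: countably_additive_def suminf_add[symmetric] suminf_emeasure)
qed (use assms sets.sigma_algebra_axioms in \<open>auto simp: positive_def\<close>)

lemma hellinger_sq_density:
  fixes f g :: "'a \<Rightarrow> real"
  assumes nu: "sigma_finite_measure \<nu>"
    and f [measurable]: "f \<in> borel_measurable \<nu>" and f0: "\<And>x. x \<in> space \<nu> \<Longrightarrow> 0 \<le> f x"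
    and g [measurable]: "g \<in> borel_measurable \<nu>" and g0: "\<And>x. x \<in> space \<nu> \<Longrightarrow> 0 \<le> g x"
    and Pf: "prob_space (density \<nu> f)" and Pg: "prob_space (density \<nu> g)"
  shows "hellinger_sq (density \<nu> f) (density \<nu> g)
           = (1/2) * (\<integral>x. (sqrt (f x) - sqrt (g x))\<^sup>2 \<partial>\<nu>)"
proof -
  define s where "s = (\<lambda>x. f x + g x)"
  have s_meas [measurable]: "s \<in> borel_measurable \<nu>" unfolding s_def by measurable
  have s0: "0 \<le> s x" if "x \<in> space \<nu>" for x using f0 g0 that by (simp add: s_def)
  let ?S = "sum_measure (density \<nu> f) (density \<nu> g)"
  have S: "?S = density \<nu> s"
  proof (rule measure_eqI)
    fix A assume "A \<in> sets ?S"
    then have A [measurable]: "A \<in> sets \<nu>" by simp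
    have "emeasure ?S A = (\<integral>\<^sup>+x. ennreal (f x) * indicator A x + ennreal (g x) * indicator A x \<partial>\<nu>)"
      by (simp add: emeasure_sum_measure emeasure_density nn_integral_add)
    also have "\<dots> = (\<integral>\<^sup>+x. ennreal (s x) * indicator A x \<partial>\<nu>)"
      by (intro nn_integral_cong) (auto simp: s_def f0 g0 ennreal_plus split: split_indicator)
    finally show "emeasure ?S A = emeasure (density \<nu> s) A" by (simp add: emeasure_density)
  qed simp
  have "emeasure ?S (space ?S) \<noteq> \<infinity>"
  proof -
    have "emeasure ?S (space \<nu>) = emeasure (density \<nu> f) (space \<nu>) + emeasure (density \<nu> g) (space \<nu>)"
      by (simp add: emeasure_sum_measure)
    then show ?thesis
      using prob_space.emeasure_space_1[OF Pf] prob_space.emeasure_space_1[OF Pg] by simp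
  qed
  then have "finite_measure ?S" by (rule finite_measureI)
  then have fin: "sigma_finite_measure ?S" by (simp add: finite_measure_def)
  have RN: "AE x in ?S. RN_deriv ?S (density \<nu> h) x = ennreal (h x / s x)"
    if h [measurable]: "h \<in> borel_measurable \<nu>" and h0: "\<And>x. x \<in> space \<nu> \<Longrightarrow> 0 \<le> h x"
      and hs: "\<And>x. x \<in> space \<nu> \<Longrightarrow> h x \<le> s x" for h :: "'a \<Rightarrow> real"
  proof -
    have "density ?S (\<lambda>x. ennreal (h x / s x)) = density \<nu> (\<lambda>x. ennreal (s x) * ennreal (h x / s x))"
      unfolding S by (rule density_density_eq) auto
    also have "\<dots> = density \<nu> h"
    proof (rule density_cong)
      show "AE x in \<nu>. ennreal (s x) * ennreal (h x / s x) = ennreal (h x)"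
      proof (rule AE_I2)
        fix x assume x: "x \<in> space \<nu>"
        show "ennreal (s x) * ennreal (h x / s x) = ennreal (h x)"
          using h0[OF x] hs[OF x] s0[OF x]
          by (cases "s x = 0") (auto simp: ennreal_mult[symmetric])
      qed
    qed auto
    finally have eq: "density ?S (\<lambda>x. ennreal (h x / s x)) = density \<nu> h" .
    have m: "(\<lambda>x. ennreal (h x / s x)) \<in> borel_measurable ?S"
      unfolding S by simp
    have "AE x in ?S. ennreal (h x / s x) = RN_deriv ?S (density \<nu> h) x"
      by (rule sigma_finite_measure.RN_deriv_unique[OF fin m eq])
    then show ?thesis by eventually_elim simp
  qed
  have RNf: "AE x in ?S. RN_deriv ?S (density \<nu> f) x = ennreal (f x / s x)"
    by (rule RN) (auto simp: f0 g0 s_def)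
  have RNg: "AE x in ?S. RN_deriv ?S (density \<nu> g) x = ennreal (g x / s x)"
    by (rule RN) (auto simp: f0 g0 s_def)
  have "(\<integral>x. (sqrt (enn2real (RN_deriv ?S (density \<nu> f) x))
            - sqrt (enn2real (RN_deriv ?S (density \<nu> g) x)))\<^sup>2 \<partial>?S)
      = (\<integral>x. (sqrt (f x / s x) - sqrt (g x / s x))\<^sup>2 \<partial>?S)"
  proof (rule integral_cong_AE)
    show "(\<lambda>x. (sqrt (f x / s x) - sqrt (g x / s x))\<^sup>2) \<in> borel_measurable ?S"
      unfolding S by measurable
    have "AE x in ?S. x \<in> space \<nu>" by (rule AE_I2) simp
    with RNf RNg show "AE x in ?S. (sqrt (enn2real (RN_deriv ?S (density \<nu> f) x))
            - sqrt (enn2real (RN_deriv ?S (density \<nu> g) x)))\<^sup>2 = (sqrt (f x / s x) - sqrt (g x / s x))\<^sup>2"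
      by eventually_elim (simp add: f0 g0 s0)
  qed measurable
  also have "\<dots> = (\<integral>x. s x * (sqrt (f x / s x) - sqrt (g x / s x))\<^sup>2 \<partial>\<nu>)"
    unfolding S by (subst integral_density) (auto intro!: AE_I2 s0)
  also have "\<dots> = (\<integral>x. (sqrt (f x) - sqrt (g x))\<^sup>2 \<partial>\<nu>)"
  proof (rule Bochner_Integration.integral_cong)
    fix x assume x: "x \<in> space \<nu>"
    show "s x * (sqrt (f x / s x) - sqrt (g x / s x))\<^sup>2 = (sqrt (f x) - sqrt (g x))\<^sup>2"
    proof (cases "s x = 0")
      case True
      then have "f x = 0" "g x = 0" using f0[OF x] g0[OF x] by (auto simp: s_def)
      then show ?thesis by simp
    next
      case False
      then have "s x > 0" using s0[OF x] by simp
      then have "(sqrt (f x / s x) - sqrt (g x / s x))\<^sup>2 = (sqrt (f x) - sqrt (g x))\<^sup>2 / s x"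
        by (simp add: real_sqrt_divide diff_divide_distrib[symmetric] power_divide)
      then show ?thesis using False by simp
    qed
  qed simp
  finally show ?thesis by (simp add: hellinger_sq_def)
qed

text \<open>The families \<open>P\<close>, \<open>Q\<close> stand for the product measures \<open>P 1 \<otimes> \<dots> \<otimes> P n\<close>, \<open>Q 1 \<otimes> \<dots> \<otimes> Q n\<close>.\<close>

definition hellinger_sq_prod :: "nat \<Rightarrow> (nat \<Rightarrow> 'a measure) \<Rightarrow> (nat \<Rightarrow> 'a measure) \<Rightarrow> real" where
  "hellinger_sq_prod n P Q = (\<Sum>i=1..n. hellinger_sq (P i) (Q i))"

text \<open>Extended real, so that the infimum over an empty model is \<open>\<infinity>\<close>.\<close>

definition hellinger_sq_model :: "nat \<Rightarrow> (nat \<Rightarrow> 'a measure) \<Rightarrow> 'a measure set \<Rightarrow> ereal" where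
  "hellinger_sq_model n P A = (INF Q\<in>A. ereal (hellinger_sq_prod n P (\<lambda>_. Q)))"

text \<open>Closure, density, and Borel sets refer to the metric \<open>sqrt \<circ> hellinger_sq\<close> on the set
  \<open>space (prob_algebra M)\<close> of all probability measures on \<open>(space M, sets M)\<close>.\<close>

definition hellinger_closure :: "'a measure \<Rightarrow> 'a measure set \<Rightarrow> 'a measure set" where
  "hellinger_closure M A =
     {P \<in> space (prob_algebra M). \<forall>\<epsilon>>0. \<exists>Q\<in>A. sqrt (hellinger_sq P Q) < \<epsilon>}"

definition hellinger_open :: "'a measure \<Rightarrow> 'a measure set \<Rightarrow> bool" where
  "hellinger_open M U \<longleftrightarrow> U \<subseteq> space (prob_algebra M) \<and>
     (\<forall>P\<in>U. \<exists>\<epsilon>>0. \<forall>Q\<in>space (prob_algebra M). sqrt (hellinger_sq P Q) < \<epsilon> \<longrightarrow> Q \<in> U)"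

definition hellinger_borel :: "'a measure \<Rightarrow> 'a measure measure" where
  "hellinger_borel M = sigma (space (prob_algebra M)) {U. hellinger_open M U}"


section \<open>VC-subgraph classes\<close>

definition shatters :: "'b set set \<Rightarrow> 'b set \<Rightarrow> bool" where
  "shatters \<C> S \<longleftrightarrow> (\<forall>T\<subseteq>S. \<exists>C\<in>\<C>. C \<inter> S = T)"

definition subgraph :: "'a measure \<Rightarrow> ('a \<Rightarrow> real) \<Rightarrow> ('a \<times> real) set" where
  "subgraph M f = {(x, t). x \<in> space M \<and> t < f x}"

definition no_shattered :: "'a measure \<Rightarrow> ('a \<Rightarrow> real) set \<Rightarrow> nat \<Rightarrow> bool" where
  "no_shattered M \<F> m \<longleftrightarrow>
     (\<forall>S \<subseteq> space M \<times> UNIV. finite S \<and> card S = m \<longrightarrow> \<not> shatters (subgraph M ` \<F>) S)"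

definition VC_subgraph :: "'a measure \<Rightarrow> ('a \<Rightarrow> real) set \<Rightarrow> bool" where
  "VC_subgraph M \<F> \<longleftrightarrow> (\<exists>m\<ge>1. no_shattered M \<F> m)"

definition VC_index :: "'a measure \<Rightarrow> ('a \<Rightarrow> real) set \<Rightarrow> nat" where
  "VC_index M \<F> = (LEAST m. m \<ge> 1 \<and> no_shattered M \<F> m)"


section \<open>Mixture models\<close>

text \<open>
  \<open>\<mu>\<close> carries the measurable space of the observations. An index \<open>\<theta> = (K, \<lambda>\<^sub>1, \<dots>, \<lambda>\<^sub>K)\<close> is a pair
  \<open>(K, l)\<close> with \<open>l \<in> (\<Pi>\<^sub>E k\<in>{1..K}. \<Lambda> k)\<close>. The models are given by families of densities:
  \<open>Fbar k \<lambda>\<close> for the full model and the countable \<open>F k \<lambda>\<close> for its dense subset; the corresponding sets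
  of probabilities are the images under \<open>dens_measure \<mu>\<close>.
\<close>

type_synonym 'l mix_index = "nat \<times> (nat \<Rightarrow> 'l)"

definition mix_indices :: "(nat \<Rightarrow> 'l set) \<Rightarrow> 'l mix_index set" where
  "mix_indices \<Lambda> = (SIGMA K:{1..}. (\<Pi>\<^sub>E k\<in>{1..K}. \<Lambda> k))"

definition dens_measure :: "'a measure \<Rightarrow> ('a \<Rightarrow> real) \<Rightarrow> 'a measure" where
  "dens_measure \<mu> f = density \<mu> (\<lambda>x. ennreal (f x))"

definition prob_density :: "'a measure \<Rightarrow> ('a \<Rightarrow> real) \<Rightarrow> bool" where
  "prob_density \<mu> f \<longleftrightarrow> f \<in> borel_measurable \<mu> \<and> (\<forall>x\<in>space \<mu>. 0 \<le> f x) \<and> prob_space (dens_measure \<mu> f)"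

definition weights :: "nat \<Rightarrow> (nat \<Rightarrow> real) set" where
  "weights K = {w. (\<forall>k\<in>{1..K}. w k \<in> {0..1}) \<and> (\<Sum>k=1..K. w k) = 1}"

definition mixture :: "'a measure \<Rightarrow> nat \<Rightarrow> (nat \<Rightarrow> real) \<Rightarrow> (nat \<Rightarrow> 'a measure) \<Rightarrow> 'a measure" where
  "mixture M K w P = measure_of (space M) (sets M) (\<lambda>A. \<Sum>k=1..K. ennreal (w k) * emeasure (P k) A)"

lemma mixture_dens_measure:
  assumes w: "\<And>k. k \<in> {1..K} \<Longrightarrow> 0 \<le> w k"
    and f [measurable]: "\<And>k. k \<in> {1..K} \<Longrightarrow> f k \<in> borel_measurable \<mu>"
    and f0: "\<And>k x. k \<in> {1..K} \<Longrightarrow> x \<in> space \<mu> \<Longrightarrow> 0 \<le> f k x"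
  shows "mixture \<mu> K w (\<lambda>k. dens_measure \<mu> (f k)) = dens_measure \<mu> (\<lambda>x. \<Sum>k=1..K. w k * f k x)"
proof -
  let ?D = "dens_measure \<mu> (\<lambda>x. \<Sum>k=1..K. w k * f k x)"
  have eq: "(\<Sum>k=1..K. ennreal (w k) * emeasure (dens_measure \<mu> (f k)) A) = emeasure ?D A"
    if A [measurable]: "A \<in> sets \<mu>" for A
  proof -
    have "emeasure ?D A = (\<integral>\<^sup>+x. ennreal (\<Sum>k=1..K. w k * f k x) * indicator A x \<partial>\<mu>)"
      unfolding dens_measure_def by (intro emeasure_density) measurable
    also have "\<dots> = (\<integral>\<^sup>+x. (\<Sum>k=1..K. ennreal (w k) * (ennreal (f k x) * indicator A x)) \<partial>\<mu>)"
    proof (rule nn_integral_cong)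
      fix x assume x: "x \<in> space \<mu>"
      have "ennreal (\<Sum>k=1..K. w k * f k x) = (\<Sum>k=1..K. ennreal (w k * f k x))"
        using w f0 x by (intro sum_ennreal[symmetric]) simp
      also have "\<dots> = (\<Sum>k=1..K. ennreal (w k) * ennreal (f k x))"
        using w f0 x by (intro sum.cong) (auto simp: ennreal_mult)
      finally show "ennreal (\<Sum>k=1..K. w k * f k x) * indicator A x
          = (\<Sum>k=1..K. ennreal (w k) * (ennreal (f k x) * indicator A x))"
        by (simp add: sum_distrib_right mult.assoc)
    qed
    also have "\<dots> = (\<Sum>k=1..K. (\<integral>\<^sup>+x. ennreal (w k) * (ennreal (f k x) * indicator A x) \<partial>\<mu>))"
      by (intro nn_integral_sum) measurable
    also have "\<dots> = (\<Sum>k=1..K. ennreal (w k) * (\<integral>\<^sup>+x. ennreal (f k x) * indicator A x \<partial>\<mu>))"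
      by (intro sum.cong refl nn_integral_cmult) measurable
    also have "\<dots> = (\<Sum>k=1..K. ennreal (w k) * emeasure (dens_measure \<mu> (f k)) A)"
      unfolding dens_measure_def by (intro sum.cong refl) (simp add: emeasure_density)
    finally show ?thesis by simp
  qed
  have sp: "space ?D = space \<mu>" "sets ?D = sets \<mu>" by (simp_all add: dens_measure_def)
  have "mixture \<mu> K w (\<lambda>k. dens_measure \<mu> (f k)) = measure_of (space \<mu>) (sets \<mu>) (emeasure ?D)"
    unfolding mixture_def
    by (rule measure_of_eq) (use eq in \<open>simp_all add: sets.space_closed sets.sigma_sets_eq\<close>)
  also have "\<dots> = ?D" using measure_of_of_measure[of ?D] unfolding sp .
  finally show ?thesis .
qed

definition mix_model ::
  "'a measure \<Rightarrow> (nat \<Rightarrow> 'l \<Rightarrow> ('a \<Rightarrow> real) set) \<Rightarrow> 'l mix_index \<Rightarrow> 'a measure set" where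
  "mix_model \<mu> Fbar = (\<lambda>(K, l). {mixture \<mu> K w P | w P.
     w \<in> weights K \<and> (\<forall>k\<in>{1..K}. P k \<in> dens_measure \<mu> ` Fbar k (l k))})"

definition mix_densities ::
  "(nat \<Rightarrow> 'l \<Rightarrow> ('a \<Rightarrow> real) set) \<Rightarrow> ('l mix_index \<Rightarrow> real) \<Rightarrow> 'l mix_index \<Rightarrow> ('a \<Rightarrow> real) set" where
  "mix_densities F \<delta> = (\<lambda>(K, l). {(\<lambda>x. \<Sum>k=1..K. w k * f k x) | w f.
     w \<in> weights K \<and> (\<forall>k\<in>{1..K}. w k \<in> {\<delta> (K, l)..1} \<inter> \<rat> \<and> f k \<in> F k (l k))})"

definition VC_total :: "'a measure \<Rightarrow> (nat \<Rightarrow> 'l \<Rightarrow> ('a \<Rightarrow> real) set) \<Rightarrow> 'l mix_index \<Rightarrow> nat" where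
  "VC_total \<mu> Fbar = (\<lambda>(K, l). \<Sum>k=1..K. VC_index \<mu> (Fbar k (l k)))"

definition log_plus :: "real \<Rightarrow> real" where
  "log_plus x = max (ln x) 0"

definition complexity ::
  "nat \<Rightarrow> 'a measure \<Rightarrow> (nat \<Rightarrow> 'l \<Rightarrow> ('a \<Rightarrow> real) set) \<Rightarrow> ('l mix_index \<Rightarrow> real) \<Rightarrow> 'l mix_index \<Rightarrow> real" where
  "complexity n \<mu> Fbar \<delta> \<theta> =
     (let V = real (VC_total \<mu> Fbar \<theta>); K = real (fst \<theta>)
      in V * (5.82 + ln ((K + 1)\<^sup>2 / \<delta> \<theta>) + log_plus (real n / V)))"


section \<open>Penalized \<open>\<rho>\<close>-estimators\<close>

definition psi :: "ereal \<Rightarrow> real" where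
  "psi x = (if x = \<infinity> then 1 else (real_of_ereal x - 1) / (real_of_ereal x + 1))"

text \<open>\<open>sqrt (a / b)\<close> for \<open>a, b \<ge> 0\<close>, with the conventions \<open>0 / 0 = 1\<close> and \<open>a / 0 = \<infinity>\<close> for \<open>a > 0\<close>.\<close>

definition sqrt_ratio :: "real \<Rightarrow> real \<Rightarrow> ereal" where
  "sqrt_ratio a b = (if b = 0 then (if a = 0 then 1 else \<infinity>) else ereal (sqrt (a / b)))"

definition T_stat :: "nat \<Rightarrow> (nat \<Rightarrow> 'a) \<Rightarrow> ('a \<Rightarrow> real) \<Rightarrow> ('a \<Rightarrow> real) \<Rightarrow> real" where
  "T_stat n x q q' = (\<Sum>i=1..n. psi (sqrt_ratio (q' (x i)) (q (x i))))"

text \<open>The real-valued supremum and infima below are over nonempty sets bounded on the relevant side: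
  \<open>\<bar>T_stat n x q q'\<bar> \<le> n\<close>, the penalty is nonnegative, and \<open>Upsilon n \<Q> pen x q \<ge> 0\<close> for \<open>q \<in> \<Q>\<close>
  (take \<open>q' = q\<close>). For empty \<open>\<Q>\<close> there is no \<open>\<rho>\<close>-estimator.\<close>

definition Upsilon ::
  "nat \<Rightarrow> ('a \<Rightarrow> real) set \<Rightarrow> (('a \<Rightarrow> real) \<Rightarrow> real) \<Rightarrow> (nat \<Rightarrow> 'a) \<Rightarrow> ('a \<Rightarrow> real) \<Rightarrow> real" where
  "Upsilon n \<Q> pen x q = (SUP q'\<in>\<Q>. T_stat n x q q' - pen q') + pen q"

definition rho_estimator ::
  "nat \<Rightarrow> 'a measure \<Rightarrow> ('a \<Rightarrow> real) set \<Rightarrow> (('a \<Rightarrow> real) \<Rightarrow> real) \<Rightarrow> ((nat \<Rightarrow> 'a) \<Rightarrow> 'a measure) \<Rightarrow> bool" where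
  "rho_estimator n \<mu> \<Q> pen Phat \<longleftrightarrow>
     Phat \<in> measurable (\<Pi>\<^sub>M i\<in>{1..n}. \<mu>) (hellinger_borel \<mu>) \<and>
     (\<forall>x\<in>space (\<Pi>\<^sub>M i\<in>{1..n}. \<mu>). Phat x \<in> hellinger_closure \<mu>
        (dens_measure \<mu> ` {q\<in>\<Q>. Upsilon n \<Q> pen x q < (INF q'\<in>\<Q>. Upsilon n \<Q> pen x q') + 8.24}))"

definition kappa :: real where
  "kappa = 35 * (3 * sqrt 2) / (3/8) + 74"

definition mix_pen ::
  "nat \<Rightarrow> 'a measure \<Rightarrow> (nat \<Rightarrow> 'l \<Rightarrow> ('a \<Rightarrow> real) set) \<Rightarrow> 'l mix_index set \<Rightarrow> ('l mix_index \<Rightarrow> real)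
     \<Rightarrow> ('l mix_index \<Rightarrow> real) \<Rightarrow> ('a \<Rightarrow> real) \<Rightarrow> real" where
  "mix_pen n \<mu> Fbar \<Theta> \<delta> \<Delta> q =
     kappa * (INF \<theta>\<in>{\<theta>\<in>\<Theta>. dens_measure \<mu> q \<in> mix_model \<mu> Fbar \<theta>}.
                818.1 * complexity n \<mu> Fbar \<delta> \<theta> / 4.7 + \<Delta> \<theta>)"

end

theory Submission
  imports Defs
begin

text \<open>
  Write \<open>T q q'\<close> for the test statistic, \<open>H q\<close> for the squared Hellinger distance between the
  true product distribution and the \<open>n\<close>-fold product of \<open>q \<cdot> \<mu>\<close>, and fix a reference density \<open>q0\<close>
  of the family. The test is antisymmetric, \<open>T q q0 = - T q0 q\<close>, and the expectation of \<open>T q0 q\<close> is at most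
  \<open>4 H q0 - 3/8 H q\<close>. If the fluctuations of \<open>T q0 q\<close> are dominated, uniformly in \<open>q\<close>, by a
  small multiple of \<open>H q0 + H q\<close> plus the penalty of \<open>q\<close>, say
  \<^item> \<open>T q0 q \<le> 4.16 H q0 - 0.195 H q + pen q + 250 \<xi>\<close> for all \<open>q\<close>,

  then a density \<open>qh\<close> that nearly minimizes \<open>Upsilon\<close> satisfies
  \<open>0.195 H qh \<le> 8.32 H q0 + 500 \<xi> + 2 pen q0 + 8.24\<close>: the bound on \<open>T q0 q\<close> serves once for the
  supremum in \<open>Upsilon q0\<close> and once, by antisymmetry, for the term of index \<open>q0\<close> in \<open>Upsilon qh\<close>
  (\<open>near_minimizer_bound\<close>). Since \<open>2 \<kappa> / 0.195 \<le> 5014\<close>, and since \<open>H q0\<close> is comparable with the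
  distance to the model (\<open>mix_densities_approx\<close>), this is the oracle inequality.

  The uniform bound (\<open>uniform_deviation\<close>) comes from a one-sided symmetrization with an offset.
  Let \<open>t\<close> be the test function of \<open>q\<close> against \<open>q0\<close>, so that \<open>\<bar>t\<bar> \<le> 1\<close>. The sum of \<open>t\<close> over the
  sample is centred at the expectation of \<open>t + t\<^sup>2 / 25\<close> rather than of \<open>t\<close>. The additional term
  costs only a small multiple of \<open>H q0 + H q\<close> (\<open>expected_test_le\<close>), and it makes every symmetrized
  summand contribute a factor at most \<open>1\<close> to the exponential moment of order \<open>1/250\<close>
  (\<open>exp_swap_le\<close>). Hence the exponential moment of the supremum over a class is at most its covering
  number on \<open>2 n\<close> points, at a scale of order \<open>V / n\<close>, times the exponential of a multiple of
  \<open>V\<close> (\<open>nn_integral_exp_sup_le\<close>). Markov's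
  inequality and a sum over \<open>\<Theta>\<close>, where \<open>\<Sum> exp (- \<Delta> \<theta>) \<le> 1\<close>, finish the argument; a covering at
  this single scale is affordable because the complexity contains the term \<open>V log (n / V)\<close>.

  The covering numbers are obtained from the Sauer--Shelah lemma applied to the subgraphs of the
  components, compared with \<open>\<lceil>K n / V\<rceil>\<close> levels at each point (\<open>mixture_cover\<close>). Two features of the
  penalty matter here. It refers to any representation of \<open>q \<cdot> \<mu>\<close> in the full models, so that
  the weights may be arbitrarily small; as only an upper bound on \<open>T q0 q\<close> is needed and the test is
  increasing in \<open>q\<close>, the weights may be rounded up to a grid of mesh \<open>V / (n K)\<close>. Moreover, the
  representation determines \<open>q\<close> only up to a \<open>\<mu>\<close>-null set, which the true distribution may charge;
  on that set the test is replaced by its upper bound \<open>1\<close>, and the expectation bound still holds,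
  since mass that is singular to \<open>\<mu>\<close> contributes in full to the Hellinger distance from
  every \<open>q0\<close>.
\<close>

section \<open>Traces of classes without large shattered sets\<close>

lemma shatters_subset: "shatters \<C> S \<Longrightarrow> T \<subseteq> S \<Longrightarrow> shatters \<C> T"
  unfolding shatters_def
proof (intro allI impI)
  fix U assume sh: "\<forall>T\<subseteq>S. \<exists>C\<in>\<C>. C \<inter> S = T" and T: "T \<subseteq> S" and U: "U \<subseteq> T"
  then obtain C where C: "C \<in> \<C>" "C \<inter> S = U" by blast
  then have "C \<inter> T = U" using T U by blast
  then show "\<exists>C\<in>\<C>. C \<inter> T = U" using C by blast
qed

text \<open>Pajor's form of the Sauer--Shelah lemma. Splitting off a point \<open>x\<close>, a family decomposes into
  the members that avoid \<open>x\<close> and those that contain it; a set shattered by both halves stays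
  shattered when \<open>x\<close> is added, so that the two counts of shattered sets add up without loss.\<close>

lemma card_le_card_shattered:
  assumes "finite P" "\<A> \<subseteq> Pow P"
  shows "card \<A> \<le> card {S. S \<subseteq> P \<and> shatters \<A> S}"
  using assms
proof (induction P arbitrary: \<A> rule: finite_induct)
  case empty
  then have "\<A> = {} \<or> \<A> = {{}}" by (simp add: subset_singleton_iff)
  moreover have "{S. S \<subseteq> {} \<and> shatters {{}} S} = {{} :: 'a set}"
    by (auto simp: shatters_def)
  ultimately show ?case by (elim disjE) simp_all
next
  case (insert x P)
  define A0 where "A0 = {A\<in>\<A>. x \<notin> A}"
  define A1 where "A1 = (\<lambda>A. A - {x}) ` {A\<in>\<A>. x \<in> A}"
  define sh where "sh = (\<lambda>\<B>. {S. S \<subseteq> P \<and> shatters \<B> S})"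
  have fin: "finite \<A>" using insert by (meson finite_Pow_iff finite_insert finite_subset)
  have fsh: "finite (sh \<B>)" for \<B>
    using insert.hyps by (auto simp: sh_def intro: finite_subset[of _ "Pow P"])
  have sub: "A0 \<subseteq> Pow P" "A1 \<subseteq> Pow P" using insert.prems by (auto simp: A0_def A1_def)
  have "inj_on (\<lambda>A. A - {x}) {A\<in>\<A>. x \<in> A}" by (auto simp: inj_on_def)
  then have cA1: "card A1 = card {A\<in>\<A>. x \<in> A}" unfolding A1_def by (rule card_image)
  have "\<A> = A0 \<union> {A\<in>\<A>. x \<in> A}" "A0 \<inter> {A\<in>\<A>. x \<in> A} = {}" by (auto simp: A0_def)
  then have "card \<A> = card A0 + card {A\<in>\<A>. x \<in> A}"
    using fin by (metis card_Un_disjoint finite_Un)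
  also have "\<dots> \<le> card (sh A0) + card (sh A1)"
    using insert.IH[OF sub(1)] insert.IH[OF sub(2)] cA1 by (simp add: sh_def)
  also have "\<dots> = card (sh A0 \<union> sh A1) + card (sh A0 \<inter> sh A1)"
    by (intro card_Un_Int fsh)
  also have "card (sh A0 \<inter> sh A1) = card (insert x ` (sh A0 \<inter> sh A1))"
  proof (rule card_image[symmetric], rule inj_onI)
    fix S T assume "S \<in> sh A0 \<inter> sh A1" "T \<in> sh A0 \<inter> sh A1" "insert x S = insert x T"
    moreover have "x \<notin> S" "x \<notin> T" using calculation insert.hyps by (auto simp: sh_def)
    ultimately show "S = T" by (metis insert_ident)
  qed
  also have "card (sh A0 \<union> sh A1) + card (insert x ` (sh A0 \<inter> sh A1))
     = card ((sh A0 \<union> sh A1) \<union> insert x ` (sh A0 \<inter> sh A1))"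
    using fsh insert.hyps by (intro card_Un_disjoint[symmetric]) (auto simp: sh_def)
  also have "\<dots> \<le> card {S. S \<subseteq> insert x P \<and> shatters \<A> S}"
  proof (rule card_mono)
    show "finite {S. S \<subseteq> insert x P \<and> shatters \<A> S}"
      using insert.hyps by (auto intro: finite_subset[of _ "Pow (insert x P)"])
    have 0: "shatters \<A> S" if "S \<in> sh A0" for S
      using that unfolding sh_def A0_def shatters_def by blast
    have 1: "shatters \<A> S" if S: "S \<in> sh A1" for S
      unfolding shatters_def
    proof (intro allI impI)
      fix T assume "T \<subseteq> S"
      then obtain A where A: "A \<in> \<A>" "x \<in> A" "(A - {x}) \<inter> S = T"
        using S unfolding sh_def A1_def shatters_def by blast
      have "x \<notin> S" using S insert.hyps by (auto simp: sh_def)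
      then have "A \<inter> S = T" using A by blast
      then show "\<exists>C\<in>\<A>. C \<inter> S = T" using A by blast
    qed
    have 2: "shatters \<A> (insert x S)" if S0: "S \<in> sh A0" and S1: "S \<in> sh A1" for S
      unfolding shatters_def
    proof (intro allI impI)
      fix T assume T: "T \<subseteq> insert x S"
      have xS: "x \<notin> S" using S0 insert.hyps by (auto simp: sh_def)
      show "\<exists>C\<in>\<A>. C \<inter> insert x S = T"
      proof (cases "x \<in> T")
        case True
        have "T - {x} \<subseteq> S" using T by blast
        then obtain A where A: "A \<in> \<A>" "x \<in> A" "(A - {x}) \<inter> S = T - {x}"
          using S1 unfolding sh_def A1_def shatters_def by blast
        then have "A \<inter> insert x S = T" using True xS by blast
        then show ?thesis using A by blast
      next
        case False
        then have "T \<subseteq> S" using T by blast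
        then obtain A where A: "A \<in> \<A>" "x \<notin> A" "A \<inter> S = T"
          using S0 unfolding sh_def A0_def shatters_def by blast
        then have "A \<inter> insert x S = T" by blast
        then show ?thesis using A by blast
      qed
    qed
    have "S \<subseteq> insert x P" if "S \<in> sh \<B>" for S \<B> using that by (auto simp: sh_def)
    then show "(sh A0 \<union> sh A1) \<union> insert x ` (sh A0 \<inter> sh A1) \<subseteq> {S. S \<subseteq> insert x P \<and> shatters \<A> S}"
      using 0 1 2 by blast
  qed
  finally show ?case .
qed

text \<open>The number of sets of size below \<open>V\<close> is bounded through the generating function
  \<open>\<Sum>\<^sub>S x^|S| = (1 + x)^|P|\<close>; leaving \<open>x\<close> free lets several classes with different indices share one
  choice of \<open>x\<close>, so that only the sum of their indices matters.\<close>

lemma card_traces_le: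
  fixes x :: real
  assumes ns: "no_shattered M \<F> V" and P: "finite P" "P \<subseteq> space M \<times> UNIV"
    and x: "0 < x" "x \<le> 1"
  shows "real (card ((\<lambda>f. subgraph M f \<inter> P) ` \<F>)) \<le> (1 / x) ^ V * exp (x * real (card P))"
proof -
  let ?\<A> = "(\<lambda>f. subgraph M f \<inter> P) ` \<F>"
  have small: "card S \<le> V" if S: "S \<subseteq> P" "shatters ?\<A> S" for S
  proof (rule ccontr)
    assume "\<not> card S \<le> V"
    then obtain T where T: "T \<subseteq> S" "card T = V" "finite T"
      using obtain_subset_with_card_n[of V S] by (metis linorder_le_cases)
    have "shatters ?\<A> T" using shatters_subset S(2) T(1) by blast
    moreover have "(subgraph M f \<inter> P) \<inter> T = subgraph M f \<inter> T" for f using T S by blast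
    ultimately have "shatters (subgraph M ` \<F>) T" unfolding shatters_def by fastforce
    moreover have "T \<subseteq> space M \<times> UNIV" using T S P by blast
    ultimately show False using ns T unfolding no_shattered_def by blast
  qed
  have "real (card ?\<A>) \<le> real (card {S. S \<subseteq> P \<and> shatters ?\<A> S})"
    using card_le_card_shattered[of P ?\<A>] P(1) by auto
  also have "\<dots> = (\<Sum>S\<in>{S. S \<subseteq> P \<and> shatters ?\<A> S}. 1)" by simp
  also have "\<dots> \<le> (\<Sum>S\<in>{S. S \<subseteq> P \<and> shatters ?\<A> S}. (1 / x) ^ V * x ^ card S)"
  proof (rule sum_mono)
    fix S assume "S \<in> {S. S \<subseteq> P \<and> shatters ?\<A> S}"
    then have "card S \<le> V" using small by blast
    then have "x ^ V \<le> x ^ card S" using x by (simp add: power_decreasing)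
    then show "1 \<le> (1 / x) ^ V * x ^ card S" using x by (simp add: field_simps)
  qed
  also have "\<dots> \<le> (\<Sum>S\<in>Pow P. (1 / x) ^ V * x ^ card S)"
    using P x by (intro sum_mono2) auto
  also have "\<dots> = (1 / x) ^ V * (\<Sum>S\<in>Pow P. (\<Prod>i\<in>S. x) * (\<Prod>i\<in>P - S. 1))"
    by (simp add: sum_distrib_left)
  also have "\<dots> = (1 / x) ^ V * (x + 1) ^ card P"
    using prod_add[OF P(1), of "\<lambda>_. x" "\<lambda>_. 1"] by simp
  also have "\<dots> \<le> (1 / x) ^ V * exp x ^ card P"
    using x exp_ge_add_one_self[of x] by (intro mult_left_mono power_mono) (auto simp: add.commute)
  also have "\<dots> = (1 / x) ^ V * exp (x * real (card P))"
    by (simp add: exp_of_nat_mult[symmetric] mult.commute)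
  finally show ?thesis .
qed

section \<open>The bounded likelihood comparison\<close>

text \<open>\<open>rho a b\<close> is \<open>\<psi> (sqrt (b / a))\<close>; since \<open>0 / 0 = 0\<close>, this one formula also covers the
  conventions for vanishing densities.\<close>

definition rho :: "real \<Rightarrow> real \<Rightarrow> real" where
  "rho a b = (sqrt b - sqrt a) / (sqrt b + sqrt a)"

lemma psi_sqrt_ratio: "0 \<le> a \<Longrightarrow> 0 \<le> b \<Longrightarrow> psi (sqrt_ratio b a) = rho a b"
proof (cases "a = 0")
  case False
  assume "0 \<le> a" "0 \<le> b"
  with False have "sqrt a > 0" "sqrt b + sqrt a > 0" by (auto intro: add_nonneg_pos)
  with False show ?thesis by (simp add: psi_def sqrt_ratio_def rho_def real_sqrt_divide divide_simps)
qed (auto simp: psi_def sqrt_ratio_def rho_def one_ereal_def)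

lemma rho_swap: "rho b a = - rho a b"
proof -
  have "sqrt a - sqrt b = - (sqrt b - sqrt a)" by simp
  then show ?thesis unfolding rho_def by (simp only: add.commute minus_divide_left)
qed

lemma rho_bounds: "0 \<le> a \<Longrightarrow> 0 \<le> b \<Longrightarrow> \<bar>rho a b\<bar> \<le> 1"
  by (auto simp: rho_def abs_le_iff divide_le_eq le_divide_eq add_nonneg_eq_0_iff)

lemma rho_measurable [measurable]:
  "f \<in> borel_measurable M \<Longrightarrow> g \<in> borel_measurable M \<Longrightarrow> (\<lambda>x. rho (f x) (g x)) \<in> borel_measurable M"
  unfolding rho_def by (intro borel_measurable_divide borel_measurable_diff borel_measurable_add
      borel_measurable_continuous_on[OF continuous_on_real_sqrt[OF continuous_on_id]])

lemma rho_diff: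
  assumes "0 < a" "0 \<le> b" "0 \<le> b'"
  shows "rho a b - rho a b' = 2 * sqrt a * (b - b') / ((sqrt b + sqrt a) * (sqrt b' + sqrt a) * (sqrt b + sqrt b'))"
proof (cases "b = b'")
  case False
  have p: "sqrt b + sqrt a > 0" "sqrt b' + sqrt a > 0" using assms by (auto intro: add_nonneg_pos)
  have "b > 0 \<or> b' > 0" using False assms by linarith
  then have "sqrt b + sqrt b' > 0"
    using assms by (auto intro: add_nonneg_pos add_pos_nonneg)
  then have "(b - b') / (sqrt b + sqrt b') = sqrt b - sqrt b'"
    using assms by (simp add: field_simps)
  moreover have "rho a b - rho a b' = 2 * sqrt a * (sqrt b - sqrt b') / ((sqrt b + sqrt a) * (sqrt b' + sqrt a))"
    using p by (simp add: rho_def field_simps)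
  ultimately show ?thesis by (metis (no_types, lifting) divide_divide_eq_left mult.commute times_divide_eq_right)
qed simp

lemma rho_mono:
  assumes "0 \<le> a" "0 \<le> b'" "b' \<le> b"
  shows "rho a b' \<le> rho a b"
proof (cases "a = 0")
  case True
  then show ?thesis using assms by (auto simp: rho_def)
next
  case False
  then have "rho a b - rho a b' \<ge> 0" using assms by (subst rho_diff) auto
  then show ?thesis by simp
qed

text \<open>In the formula for the increment of \<open>rho a\<close> the numerator depends only on the difference of the
  arguments, while the denominator grows with each of them.\<close>

lemma rho_shift_le:
  assumes "0 \<le> a" "0 \<le> b'" "b' \<le> b" "0 \<le> c"
  shows "rho a (b + c) - rho a (b' + c) \<le> rho a b - rho a b'"
proof (cases "a = 0 \<or> b = b'")
  case True
  then show ?thesis using assms by (auto simp: rho_def)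
next
  case False
  then have pos: "0 < a" "0 < b" using assms by auto
  have le: "sqrt b \<le> sqrt (b + c)" "sqrt b' \<le> sqrt (b' + c)" "0 \<le> sqrt b'" "0 < sqrt a" "0 < sqrt b"
    using assms pos by auto
  have "2 * sqrt a * (b - b') / ((sqrt (b + c) + sqrt a) * (sqrt (b' + c) + sqrt a) * (sqrt (b + c) + sqrt (b' + c)))
     \<le> 2 * sqrt a * (b - b') / ((sqrt b + sqrt a) * (sqrt b' + sqrt a) * (sqrt b + sqrt b'))"
  proof (intro divide_left_mono mult_mono mult_pos_pos)
    have "0 < sqrt (b + c)" "0 \<le> sqrt (b' + c)" using assms pos by auto
    then show "0 < sqrt (b + c) + sqrt a" "0 < sqrt (b' + c) + sqrt a" "0 < sqrt (b + c) + sqrt (b' + c)"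
      using le by linarith+
  qed (use le assms in \<open>auto intro: add_mono add_pos_nonneg add_nonneg_pos\<close>)
  then show ?thesis using rho_diff[of a "b + c" "b' + c"] rho_diff[of a b b'] pos assms by simp
qed

lemma rho_add_dist:
  assumes "0 \<le> a" "0 \<le> b" "0 \<le> b'" "0 \<le> c" "0 \<le> c'"
  shows "\<bar>rho a (b + c) - rho a (b' + c')\<bar> \<le> \<bar>rho a b - rho a b'\<bar> + \<bar>rho a c - rho a c'\<bar>"
proof -
  have step: "\<bar>rho a (x + z) - rho a (y + z)\<bar> \<le> \<bar>rho a x - rho a y\<bar>" if "0 \<le> x" "0 \<le> y" "0 \<le> z" for x y z
  proof (cases "y \<le> x")
    case True
    then show ?thesis using rho_shift_le[of a y x z] rho_mono[of a "y + z" "x + z"] that assms(1) by auto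
  next
    case False
    then show ?thesis using rho_shift_le[of a x y z] rho_mono[of a "x + z" "y + z"] that assms(1) by auto
  qed
  show ?thesis using step[of b b' c] step[of c c' b'] assms by (simp add: add.commute)
qed

text \<open>The errors of the weighted components simply add up, whatever their sizes; this reduces the
  covering of a mixture class to the covering of its components.\<close>

lemma rho_sum_dist:
  assumes "finite S" "0 \<le> a" "\<And>k. k \<in> S \<Longrightarrow> 0 \<le> b k" "\<And>k. k \<in> S \<Longrightarrow> 0 \<le> b' k"
  shows "\<bar>rho a (\<Sum>k\<in>S. b k) - rho a (\<Sum>k\<in>S. b' k)\<bar> \<le> (\<Sum>k\<in>S. \<bar>rho a (b k) - rho a (b' k)\<bar>)"
  using assms
proof (induction S rule: finite_induct)
  case (insert k S)
  have "\<bar>rho a (b k + sum b S) - rho a (b' k + sum b' S)\<bar>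
     \<le> \<bar>rho a (b k) - rho a (b' k)\<bar> + \<bar>rho a (sum b S) - rho a (sum b' S)\<bar>"
    using insert by (intro rho_add_dist) (auto intro!: sum_nonneg)
  then show ?case using insert by auto
qed simp

text \<open>Comparing \<open>b\<close> with the \<open>m\<close> levels \<open>a (j / (m - j))\<^sup>2\<close>, at which \<open>rho a\<close> takes the equally
  spaced values \<open>2 j / m - 1\<close>, locates \<open>rho a b\<close> up to \<open>2 / m\<close>.\<close>

lemma rho_close_of_same_levels:
  fixes m :: nat
  assumes a: "0 \<le> a" and b: "0 \<le> b" and b': "0 \<le> b'" and m: "m \<ge> 1"
    and same: "\<And>j. j < m \<Longrightarrow> a * (real j / real (m - j))\<^sup>2 < b \<longleftrightarrow> a * (real j / real (m - j))\<^sup>2 < b'"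
  shows "\<bar>rho a b - rho a b'\<bar> \<le> 2 / m"
proof (cases "a = 0")
  case True
  then have "0 < b \<longleftrightarrow> 0 < b'" using same[of 0] m by simp
  then have "rho a b = rho a b'" using True b b' by (auto simp: rho_def)
  then show ?thesis by simp
next
  case False
  then have a0: "a > 0" using a by simp
  have level: "a * (real j / real (m - j))\<^sup>2 < y \<longleftrightarrow> 2 * j / m - 1 < rho a y"
    if "j < m" "0 \<le> y" for j y
  proof -
    have "a * (real j / real (m - j))\<^sup>2 < y \<longleftrightarrow> sqrt (a * (real j / real (m - j))\<^sup>2) < sqrt y" by simp
    also have "sqrt (a * (real j / real (m - j))\<^sup>2) = sqrt a * (real j / real (m - j))"
      by (simp add: real_sqrt_mult)
    also have "sqrt a * (real j / real (m - j)) < sqrt y \<longleftrightarrow> sqrt a * j < sqrt y * (m - j)"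
      using that by (simp add: field_simps)
    also have "\<dots> \<longleftrightarrow> (2 * real j - real m) * (sqrt y + sqrt a) < (sqrt y - sqrt a) * m"
    proof -
      have e: "sqrt y * real (m - j) = real m * sqrt y - real j * sqrt y" using that by (simp add: of_nat_diff algebra_simps)
      have "(2 * real j - real m) * (sqrt y + sqrt a) - (sqrt y - sqrt a) * real m
         = 2 * (sqrt a * real j - (real m * sqrt y - real j * sqrt y))" by (simp add: algebra_simps)
      moreover have "C < D \<longleftrightarrow> A < B" if "A - B = 2 * (C - D)" for A B C D :: real using that by auto
      ultimately show ?thesis unfolding e by blast
    qed
    also have "\<dots> \<longleftrightarrow> 2 * j / m - 1 < rho a y"
    proof -
      have "sqrt y + sqrt a > 0" using a0 that by (auto intro: add_nonneg_pos)
      then show ?thesis using that by (simp add: rho_def field_simps)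
    qed
    finally show ?thesis by simp
  qed
  have aux: "rho a y' - rho a y \<le> 2 / m"
    if y: "0 \<le> y" "0 \<le> y'"
      and sm: "\<And>j. j < m \<Longrightarrow> a * (real j / real (m - j))\<^sup>2 < y \<longleftrightarrow> a * (real j / real (m - j))\<^sup>2 < y'" for y y'
  proof (rule ccontr)
    assume "\<not> ?thesis"
    then have gt: "rho a y' > rho a y + 2 / m" by simp
    define j where "j = nat \<lceil>m * (rho a y + 1) / 2\<rceil>"
    have "rho a y + 1 \<ge> 0" using rho_bounds[of a y] a y by auto
    then have "0 \<le> m * (rho a y + 1) / 2" by simp
    then have "0 \<le> \<lceil>m * (rho a y + 1) / 2\<rceil>" by linarith
    then have "real j = of_int \<lceil>m * (rho a y + 1) / 2\<rceil>" unfolding j_def by (rule of_nat_nat)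
    then have j1: "m * (rho a y + 1) / 2 \<le> j" and j2: "real j < m * (rho a y + 1) / 2 + 1"
      by linarith+
    have mp: "real m > 0" using m by simp
    have ge: "2 * j / m - 1 \<ge> rho a y" using j1 mp by (simp add: field_simps)
    have lt: "2 * j / m - 1 < rho a y'"
    proof -
      have "real j / m < (m * (rho a y + 1) / 2 + 1) / m" using j2 mp by (rule divide_strict_right_mono)
      also have "\<dots> = (rho a y + 1) / 2 + 1 / m" using mp by (simp add: add_divide_distrib)
      finally have "real j / m < (rho a y + 1) / 2 + 1 / m" .
      moreover have "2 * j / m = 2 * (real j / m)" "2 / real m = 2 * (1 / real m)" by simp_all
      ultimately have "2 * j / m - 1 < rho a y + 2 / m" by argo
      then show ?thesis using gt by simp
    qed
    have "rho a y' \<le> 1" using rho_bounds[of a y'] a y by auto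
    then have "2 * j / m < 2" using lt by simp
    then have "j < m" using mp by (simp add: field_simps)
    then show False using sm[of j] level[of j y] level[of j y'] y ge lt by auto
  qed
  show ?thesis using aux[of b b'] aux[of b' b] b b' same by (auto simp: abs_le_iff)
qed

section \<open>A one-sided symmetrization inequality\<close>

lemma exp_le_quadratic:
  fixes x :: real
  assumes "x \<le> 1"
  shows "exp x \<le> 1 + x + x\<^sup>2"
proof (cases "0 \<le> x")
  case True
  then show ?thesis using assms exp_bound by blast
next
  case False
  define y where "y = - x"
  have y: "y > 0" using False by (simp add: y_def)
  have q: "1 + y + y\<^sup>2 / 2 \<le> exp y" using exp_lower_Taylor_quadratic[of y] y by simp
  have pos: "1 + y + y\<^sup>2 / 2 > 0" using y by (intro add_pos_nonneg) auto
  have "1 - y + y\<^sup>2 = (1 - y / 2)\<^sup>2 + 3/4 * y\<^sup>2" by (simp add: power2_eq_square algebra_simps)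
  moreover have "0 < 3/4 * y\<^sup>2" using y by simp
  ultimately have m: "0 < 1 - y + y\<^sup>2" using zero_le_power2[of "1 - y / 2"] by linarith
  have "(1 - y + y\<^sup>2) * (1 + y + y\<^sup>2 / 2) = 1 + (y\<^sup>2 + y ^ 3 + y ^ 4) / 2"
    by (simp add: field_simps power2_eq_square power3_eq_cube power4_eq_xxxx)
  moreover have "y\<^sup>2 + y ^ 3 + y ^ 4 \<ge> 0" using y by auto
  ultimately have "1 \<le> (1 - y + y\<^sup>2) * (1 + y + y\<^sup>2 / 2)" by simp
  also have "\<dots> \<le> (1 - y + y\<^sup>2) * exp y" using q m by (intro mult_left_mono) auto
  finally have "exp (- y) \<le> 1 - y + y\<^sup>2" by (simp add: exp_minus field_simps)
  then show ?thesis by (simp add: y_def)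
qed

text \<open>Subtracting a multiple of \<open>v\<^sup>2\<close>, a function of the second point alone, is enough to make
  the average over the two orderings of \<open>(u, v)\<close> a contraction: the first-order gain
  \<open>lam * c * (u\<^sup>2 + v\<^sup>2)\<close> dominates the second-order term of the exponential.\<close>

lemma exp_swap_le:
  fixes u v lam c :: real
  assumes c: "0 \<le> c" "c \<le> 1" and lam: "0 \<le> lam" "lam * (8 + 2 * c\<^sup>2) \<le> c"
    and u: "\<bar>u\<bar> \<le> 1" and v: "\<bar>v\<bar> \<le> 1"
  shows "exp (lam * (u - v - c * v\<^sup>2)) + exp (lam * (v - u - c * u\<^sup>2)) \<le> 2"
proof -
  define x where "x = lam * (u - v - c * v\<^sup>2)"
  define y where "y = lam * (v - u - c * u\<^sup>2)"
  have "lam * 8 \<le> lam * (8 + 2 * c\<^sup>2)" using lam by (intro mult_left_mono) auto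
  then have lam8: "lam * 8 \<le> 1" using c lam by linarith
  have sq1: "z\<^sup>2 \<le> 1" "z ^ 4 \<le> z\<^sup>2" if "\<bar>z\<bar> \<le> 1" for z :: real
  proof -
    show 1: "z\<^sup>2 \<le> 1" using that by (simp add: abs_square_le_1)
    have "z ^ 4 = z\<^sup>2 * z\<^sup>2" by (simp add: power2_eq_square power4_eq_xxxx)
    then show "z ^ 4 \<le> z\<^sup>2" using mult_left_mono[OF 1, of "z\<^sup>2"] by simp
  qed
  have le1: "lam * (a - b - c * b\<^sup>2) \<le> 1" if "\<bar>a\<bar> \<le> 1" "\<bar>b\<bar> \<le> 1" for a b
  proof -
    have "a - b - c * b\<^sup>2 \<le> 2 - 0" using that c by (intro diff_mono) auto
    then have "lam * (a - b - c * b\<^sup>2) \<le> lam * 2" using lam by (intro mult_left_mono) auto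
    then show ?thesis using lam8 by linarith
  qed
  have sqx: "(lam * (a - b - c * b\<^sup>2))\<^sup>2 \<le> lam\<^sup>2 * (2 * (a - b)\<^sup>2 + 2 * c\<^sup>2 * b\<^sup>2)" if "\<bar>b\<bar> \<le> 1" for a b
  proof -
    have "((a - b) - c * b\<^sup>2)\<^sup>2 + ((a - b) + c * b\<^sup>2)\<^sup>2 = 2 * (a - b)\<^sup>2 + 2 * c\<^sup>2 * b ^ 4"
      by (simp add: power2_eq_square power4_eq_xxxx algebra_simps)
    then have "(a - b - c * b\<^sup>2)\<^sup>2 \<le> 2 * (a - b)\<^sup>2 + 2 * c\<^sup>2 * b ^ 4"
      using zero_le_power2[of "(a - b) + c * b\<^sup>2"] by linarith
    also have "\<dots> \<le> 2 * (a - b)\<^sup>2 + 2 * c\<^sup>2 * b\<^sup>2"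
      using sq1(2)[OF that] by (intro add_mono mult_left_mono) auto
    finally show ?thesis by (simp add: power_mult_distrib mult_left_mono)
  qed
  have "x\<^sup>2 + y\<^sup>2 \<le> lam\<^sup>2 * (4 * (u - v)\<^sup>2 + 2 * c\<^sup>2 * (u\<^sup>2 + v\<^sup>2))"
    using sqx[OF v, of u] sqx[OF u, of v] unfolding x_def y_def
    by (simp add: algebra_simps power2_commute[of v u])
  also have "\<dots> \<le> lam\<^sup>2 * ((8 + 2 * c\<^sup>2) * (u\<^sup>2 + v\<^sup>2))"
  proof (intro mult_left_mono)
    have "(u - v)\<^sup>2 + (u + v)\<^sup>2 = 2 * (u\<^sup>2 + v\<^sup>2)" by (simp add: power2_eq_square algebra_simps)
    then have "(u - v)\<^sup>2 \<le> 2 * (u\<^sup>2 + v\<^sup>2)"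
      using zero_le_power2[of "u + v"] by linarith
    then show "4 * (u - v)\<^sup>2 + 2 * c\<^sup>2 * (u\<^sup>2 + v\<^sup>2) \<le> (8 + 2 * c\<^sup>2) * (u\<^sup>2 + v\<^sup>2)"
      by (simp add: distrib_right)
  qed simp
  also have "\<dots> = lam * (u\<^sup>2 + v\<^sup>2) * (lam * (8 + 2 * c\<^sup>2))" by (simp add: power2_eq_square)
  also have "\<dots> \<le> lam * (u\<^sup>2 + v\<^sup>2) * c" using lam by (intro mult_left_mono) auto
  also have "\<dots> = - (x + y)" by (simp add: x_def y_def algebra_simps)
  finally have "x + x\<^sup>2 + (y + y\<^sup>2) \<le> 0" by simp
  moreover have "exp x \<le> 1 + x + x\<^sup>2" "exp y \<le> 1 + y + y\<^sup>2"
    using le1[OF u v] le1[OF v u] by (auto intro!: exp_le_quadratic simp: x_def y_def)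
  ultimately show ?thesis unfolding x_def y_def by linarith
qed

text \<open>A pair of independent samples is a point \<open>w\<close> of the product over \<open>I \<times> bool\<close>. Exchanging the
  two copies of the coordinates in a subset \<open>\<sigma>\<close> of \<open>I\<close> permutes identically distributed factors and
  preserves the measure, so an integral may be averaged over all \<open>\<sigma>\<close> before it is bounded.\<close>

lemma nn_integral_le_of_swap_average:
  fixes I :: "'i set" and P :: "'i \<Rightarrow> 'a measure"
  assumes I: "finite I" and P: "\<And>i. i \<in> I \<Longrightarrow> prob_space (P i)"
    and G: "G \<in> borel_measurable (\<Pi>\<^sub>M j\<in>I \<times> (UNIV :: bool set). P (fst j))"
    and avg: "\<And>w. w \<in> space (\<Pi>\<^sub>M j\<in>I \<times> (UNIV :: bool set). P (fst j)) \<Longrightarrow>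
       (\<Sum>\<sigma>\<in>Pow I. G (\<lambda>j\<in>I \<times> UNIV. w (fst j, snd j \<noteq> (fst j \<in> \<sigma>)))) \<le> 2 ^ card I * B"
  shows "(\<integral>\<^sup>+w. G w \<partial>(\<Pi>\<^sub>M j\<in>I \<times> UNIV. P (fst j))) \<le> B"
proof -
  let ?J = "I \<times> (UNIV :: bool set)"
  let ?W = "\<Pi>\<^sub>M j\<in>?J. P (fst j)"
  have inv: "(\<integral>\<^sup>+w. G w \<partial>?W) = (\<integral>\<^sup>+w. G (\<lambda>j\<in>?J. w (fst j, snd j \<noteq> (fst j \<in> \<sigma>))) \<partial>?W)"
    and meas: "(\<lambda>w. G (\<lambda>j\<in>?J. w (fst j, snd j \<noteq> (fst j \<in> \<sigma>)))) \<in> borel_measurable ?W" for \<sigma>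
  proof -
    let ?f = "\<lambda>j. (fst j, snd j \<noteq> (fst j \<in> \<sigma>))"
    have "distr ?W (\<Pi>\<^sub>M j\<in>?J. P (fst (?f j))) (\<lambda>w. \<lambda>j\<in>?J. w (?f j)) = (\<Pi>\<^sub>M j\<in>?J. P (fst (?f j)))"
      by (rule distr_PiM_reindex[of ?J "\<lambda>j. P (fst j)" ?f ?J]) (use P in \<open>auto simp: inj_on_def\<close>)
    then have eq: "distr ?W ?W (\<lambda>w. \<lambda>j\<in>?J. w (?f j)) = ?W" by simp
    have m: "(\<lambda>w. \<lambda>j\<in>?J. w (?f j)) \<in> measurable ?W ?W"
    proof (rule measurable_restrict)
      fix j assume "j \<in> ?J"
      then show "(\<lambda>w. w (?f j)) \<in> measurable ?W (P (fst j))"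
        using measurable_component_singleton[of "?f j" ?J "\<lambda>j. P (fst j)"] by auto
    qed
    have "(\<integral>\<^sup>+w. G w \<partial>?W) = (\<integral>\<^sup>+w. G w \<partial>distr ?W ?W (\<lambda>w. \<lambda>j\<in>?J. w (?f j)))" by (simp only: eq)
    also have "\<dots> = (\<integral>\<^sup>+w. G (\<lambda>j\<in>?J. w (?f j)) \<partial>?W)"
      by (rule nn_integral_distr[OF m]) (simp add: G)
    finally show "(\<integral>\<^sup>+w. G w \<partial>?W) = (\<integral>\<^sup>+w. G (\<lambda>j\<in>?J. w (?f j)) \<partial>?W)" .
    show "(\<lambda>w. G (\<lambda>j\<in>?J. w (?f j))) \<in> borel_measurable ?W" using m G by measurable
  qed
  interpret W: prob_space ?W by (rule prob_space_PiM) (auto intro: P)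
  have "2 ^ card I * (\<integral>\<^sup>+w. G w \<partial>?W) = (\<Sum>\<sigma>\<in>Pow I. (\<integral>\<^sup>+w. G w \<partial>?W))"
    using I by (simp add: card_Pow)
  also have "\<dots> = (\<Sum>\<sigma>\<in>Pow I. (\<integral>\<^sup>+w. G (\<lambda>j\<in>?J. w (fst j, snd j \<noteq> (fst j \<in> \<sigma>))) \<partial>?W))"
    using inv by (intro sum.cong) auto
  also have "\<dots> = (\<integral>\<^sup>+w. (\<Sum>\<sigma>\<in>Pow I. G (\<lambda>j\<in>?J. w (fst j, snd j \<noteq> (fst j \<in> \<sigma>)))) \<partial>?W)"
    by (intro nn_integral_sum[symmetric] meas)
  also have "\<dots> \<le> (\<integral>\<^sup>+w. 2 ^ card I * B \<partial>?W)" by (intro nn_integral_mono avg) simp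
  also have "\<dots> = 2 ^ card I * B" by (simp add: W.emeasure_space_1)
  finally show ?thesis
    by (subst (asm) ennreal_mult_le_mult_iff) (auto simp: power_eq_top_ennreal)
qed

lemma exp_integral_le:
  fixes h :: "'a \<Rightarrow> real"
  assumes "prob_space N" and h: "integrable N h"
    and bd: "\<And>x. x \<in> space N \<Longrightarrow> \<bar>h x\<bar> \<le> b"
  shows "ennreal (exp (\<integral>x. h x \<partial>N)) \<le> (\<integral>\<^sup>+x. ennreal (exp (h x)) \<partial>N)"
proof -
  interpret prob_space N by fact
  have [measurable]: "h \<in> borel_measurable N" using h by simp
  let ?m = "\<integral>x. h x \<partial>N"
  have int: "integrable N (\<lambda>x. exp (h x))"
    using bd by (intro integrable_const_bound[where B="exp b"]) (auto intro!: AE_I2 simp: abs_le_iff)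
  have "exp ?m = (\<integral>x. exp ?m * (1 + (h x - ?m)) \<partial>N)"
    using h by (simp add: prob_space)
  also have "\<dots> \<le> (\<integral>x. exp (h x) \<partial>N)"
  proof (intro integral_mono int)
    show "integrable N (\<lambda>x. exp ?m * (1 + (h x - ?m)))" using h by simp
    fix x
    have "exp ?m * (1 + (h x - ?m)) \<le> exp ?m * exp (h x - ?m)"
      using exp_ge_add_one_self[of "h x - ?m"] by (intro mult_left_mono) auto
    then show "exp ?m * (1 + (h x - ?m)) \<le> exp (h x)" by (simp add: exp_add[symmetric])
  qed
  finally have "ennreal (exp ?m) \<le> ennreal (\<integral>x. exp (h x) \<partial>N)" by (simp add: ennreal_leI)
  also have "\<dots> = (\<integral>\<^sup>+x. ennreal (exp (h x)) \<partial>N)"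
    by (intro nn_integral_eq_integral[symmetric] int) auto
  finally show ?thesis .
qed

text \<open>Symmetrization with an offset. The centring term is the expectation over an independent ghost
  sample, which Jensen's inequality moves out of the exponential. Averaging over all exchanges of a
  point with its ghost is then done for a fixed pair of samples, where a finite set of
  representatives replaces the class; each representative contributes at most \<open>1\<close> by
  \<open>exp_swap_le\<close>. The bound is on an exponential moment, so that deviation
  inequalities follow from it by Markov's inequality.\<close>

lemma nn_integral_exp_sup_le:
  fixes I :: "'i set" and P :: "'i \<Rightarrow> 'a measure" and f :: "'q \<Rightarrow> 'a \<Rightarrow> real"
    and lam c \<epsilon> :: real and N :: real
  assumes I: "finite I" and P: "\<And>i. i \<in> I \<Longrightarrow> prob_space (P i)"
    and sets: "\<And>i. i \<in> I \<Longrightarrow> sets (P i) = sets M"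
    and c: "0 \<le> c" "c \<le> 1/2" and lam: "0 \<le> lam" "lam * (8 + 2 * c\<^sup>2) \<le> c" and eps: "0 \<le> \<epsilon>"
    and A: "countable A" and f: "\<And>q. q \<in> A \<Longrightarrow> f q \<in> borel_measurable M"
    and bd: "\<And>q x. q \<in> A \<Longrightarrow> x \<in> space M \<Longrightarrow> \<bar>f q x\<bar> \<le> 1"
    and cover: "\<And>X. finite X \<Longrightarrow> X \<subseteq> space M \<Longrightarrow> card X \<le> 2 * card I \<Longrightarrow>
       \<exists>C\<subseteq>A. finite C \<and> real (card C) \<le> N \<and> (\<forall>q\<in>A. \<exists>q'\<in>C. \<forall>x\<in>X. \<bar>f q x - f q' x\<bar> \<le> \<epsilon>)"
  shows "(\<integral>\<^sup>+x. (SUP q\<in>A. ennreal (exp (lam * ((\<Sum>i\<in>I. f q (x i))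
             - (\<Sum>i\<in>I. \<integral>y. f q y + c * (f q y)\<^sup>2 \<partial>P i))))) \<partial>(\<Pi>\<^sub>M i\<in>I. P i))
         \<le> ennreal (N * exp (lam * (3 * \<epsilon> * card I)))"
proof -
  let ?J = "I \<times> (UNIV :: bool set)"
  define p where "p = (\<lambda>j :: 'i \<times> bool. P (fst j))"
  let ?W = "PiM ?J p"
  define \<phi> where "\<phi> = (\<lambda>u v :: real. u - v - c * v\<^sup>2)"
  define E where "E = (\<lambda>q. \<Sum>i\<in>I. \<integral>y. f q y + c * (f q y)\<^sup>2 \<partial>P i)"
  define G where "G = (\<lambda>w. SUP q\<in>A. ennreal (exp (lam * (\<Sum>i\<in>I. \<phi> (f q (w (i, True))) (f q (w (i, False)))))))"
  have p: "prob_space (p j)" "sets (p j) = sets M" "space (p j) = space M" if "j \<in> ?J" for j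
    using P[of "fst j"] sets[of "fst j"] that sets_eq_imp_space_eq[of "p j" M] by (auto simp: p_def)
  have comp: "(\<lambda>w. f q (w j)) \<in> borel_measurable (PiM K p)" if "q \<in> A" "j \<in> K" "K \<subseteq> ?J" for q j K
  proof -
    have 1: "(\<lambda>w. w j) \<in> measurable (PiM K p) (p j)"
      using that by (intro measurable_component_singleton)
    have "f q \<in> borel_measurable (p j)" using f[OF that(1)] p(2)[of j] that
      by (metis measurable_cong_sets subset_iff)
    then show ?thesis using 1 by (rule measurable_compose[rotated])
  qed
  have Gm: "G \<in> borel_measurable ?W"
    unfolding G_def \<phi>_def using A
    by (intro borel_measurable_SUP measurable_compose[OF _ measurable_ennreal] measurable_compose[OF _ borel_measurable_exp]
        borel_measurable_times borel_measurable_sum borel_measurable_diff borel_measurable_power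
        borel_measurable_const comp) auto
  \<comment> \<open>\<open>I1\<close> carries the sample, \<open>I2\<close> the ghost sample.\<close>
  define I1 where "I1 = I \<times> {True}"
  define I2 where "I2 = I \<times> {False}"
  have J12: "?J = I1 \<union> I2" "I1 \<inter> I2 = {}" "finite I1" "finite I2" "I1 \<subseteq> ?J" "I2 \<subseteq> ?J"
    using I by (auto simp: I1_def I2_def)
  have "(\<integral>\<^sup>+x. (SUP q\<in>A. ennreal (exp (lam * ((\<Sum>i\<in>I. f q (x i)) - E q)))) \<partial>PiM I P)
     = (\<integral>\<^sup>+y. (SUP q\<in>A. ennreal (exp (lam * ((\<Sum>i\<in>I. f q (y (i, True))) - E q)))) \<partial>PiM I1 p)"
  proof -
    have "distr (PiM I1 p) (\<Pi>\<^sub>M i\<in>I. p (i, True)) (\<lambda>y. \<lambda>i\<in>I. y (i, True)) = (\<Pi>\<^sub>M i\<in>I. p (i, True))"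
      by (rule distr_PiM_reindex[of I1 p "\<lambda>i. (i, True)" I]) (use P in \<open>auto simp: inj_on_def I1_def p_def\<close>)
    then have eq: "distr (PiM I1 p) (PiM I P) (\<lambda>y. \<lambda>i\<in>I. y (i, True)) = PiM I P"
      by (simp add: p_def)
    have m: "(\<lambda>y. \<lambda>i\<in>I. y (i, True)) \<in> measurable (PiM I1 p) (PiM I P)"
    proof (rule measurable_restrict)
      fix i assume "i \<in> I"
      then have "(\<lambda>y. y (i, True)) \<in> measurable (PiM I1 p) (p (i, True))"
        by (intro measurable_component_singleton) (auto simp: I1_def)
      then show "(\<lambda>y. y (i, True)) \<in> measurable (PiM I1 p) (P i)" by (simp add: p_def)
    qed
    have fm: "(\<lambda>x. f q (x i)) \<in> borel_measurable (PiM I P)" if "q \<in> A" "i \<in> I" for q i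
    proof -
      have "f q \<in> borel_measurable (P i)" using f[OF that(1)] sets[OF that(2)]
        by (metis measurable_cong_sets)
      then show ?thesis using measurable_component_singleton[OF that(2)]
        by (rule measurable_compose[rotated])
    qed
    have "(\<integral>\<^sup>+x. (SUP q\<in>A. ennreal (exp (lam * ((\<Sum>i\<in>I. f q (x i)) - E q)))) \<partial>PiM I P)
      = (\<integral>\<^sup>+x. (SUP q\<in>A. ennreal (exp (lam * ((\<Sum>i\<in>I. f q (x i)) - E q)))) \<partial>distr (PiM I1 p) (PiM I P) (\<lambda>y. \<lambda>i\<in>I. y (i, True)))"
      by (simp only: eq)
    also have "\<dots> = (\<integral>\<^sup>+y. (SUP q\<in>A. ennreal (exp (lam * ((\<Sum>i\<in>I. f q ((\<lambda>i\<in>I. y (i, True)) i)) - E q)))) \<partial>PiM I1 p)"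
      using A by (intro nn_integral_distr m, unfold measurable_distr_eq1)
       (intro borel_measurable_SUP measurable_compose[OF _ measurable_ennreal] measurable_compose[OF _ borel_measurable_exp]
        borel_measurable_times borel_measurable_sum borel_measurable_diff
        borel_measurable_const fm)
    finally show ?thesis by simp
  qed
  also have "\<dots> \<le> (\<integral>\<^sup>+y. (\<integral>\<^sup>+y'. G (merge I1 I2 (y, y')) \<partial>PiM I2 p) \<partial>PiM I1 p)"
  proof (intro nn_integral_mono SUP_least)
    fix y q assume y: "y \<in> space (PiM I1 p)" and q: "q \<in> A"
    interpret N: prob_space "PiM I2 p"
      by (rule prob_space_PiM) (use p J12 in auto)
    define s where "s = (\<Sum>i\<in>I. f q (y (i, True)))"
    define h where "h = (\<lambda>y'. lam * (s - (\<Sum>i\<in>I. f q (y' (i, False)) + c * (f q (y' (i, False)))\<^sup>2)))"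
    have cm: "(\<lambda>y'. f q (y' (i, False))) \<in> borel_measurable (PiM I2 p)" if "i \<in> I" for i
      using that q J12 by (intro comp) (auto simp: I2_def)
    have sp: "y' (i, False) \<in> space M" if "i \<in> I" "y' \<in> space (PiM I2 p)" for i y'
      using that p(3)[of "(i, False)"] by (auto simp: space_PiM I2_def)
    have bd2: "\<bar>f q (y' (i, False)) + c * (f q (y' (i, False)))\<^sup>2\<bar> \<le> 2"
      if "i \<in> I" "y' \<in> space (PiM I2 p)" for i y'
    proof -
      have b: "\<bar>f q (y' (i, False))\<bar> \<le> 1" using bd[OF q sp[OF that]] .
      then have "(f q (y' (i, False)))\<^sup>2 \<le> 1" by (simp add: abs_square_le_1)
      then have "c * (f q (y' (i, False)))\<^sup>2 \<le> 1 * 1" using c by (intro mult_mono) auto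
      then show ?thesis using b mult_nonneg_nonneg[OF c(1) zero_le_power2[of "f q (y' (i, False))"]] by linarith
    qed
    have int: "integrable (PiM I2 p) (\<lambda>y'. f q (y' (i, False)) + c * (f q (y' (i, False)))\<^sup>2)" if "i \<in> I" for i
      using that cm[OF that] bd2 by (intro N.integrable_const_bound[where B=2]) (auto intro!: AE_I2)
    have comp_int: "(\<integral>y'. f q (y' (i, False)) + c * (f q (y' (i, False)))\<^sup>2 \<partial>PiM I2 p)
       = (\<integral>z. f q z + c * (f q z)\<^sup>2 \<partial>P i)" if i: "i \<in> I" for i
    proof -
      have iF: "(i, False) \<in> I2" using i by (simp add: I2_def)
      have fq: "f q \<in> borel_measurable (P i)" using f[OF q] sets[OF i] by (metis measurable_cong_sets)
      have d: "distr (PiM I2 p) (P i) (\<lambda>y'. y' (i, False)) = P i"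
        using distr_PiM_component[of I2 p "(i, False)"] p J12 iF by (auto simp: p_def)
      have mm: "(\<lambda>y'. y' (i, False)) \<in> measurable (PiM I2 p) (P i)"
        using measurable_component_singleton[OF iF, of p] by (simp add: p_def)
      have "(\<integral>z. f q z + c * (f q z)\<^sup>2 \<partial>P i) = (\<integral>z. f q z + c * (f q z)\<^sup>2 \<partial>distr (PiM I2 p) (P i) (\<lambda>y'. y' (i, False)))"
        by (simp only: d)
      also have "\<dots> = (\<integral>y'. f q (y' (i, False)) + c * (f q (y' (i, False)))\<^sup>2 \<partial>PiM I2 p)"
        using fq by (intro integral_distr mm) (auto intro!: borel_measurable_add borel_measurable_times borel_measurable_power)
      finally show ?thesis by simp
    qed
    have hint: "integrable (PiM I2 p) h" unfolding h_def
      by (intro integrable_mult_right Bochner_Integration.integrable_diff Bochner_Integration.integrable_sum int) auto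
    have "(\<integral>y'. h y' \<partial>PiM I2 p) = lam * (s - E q)"
      unfolding h_def using int comp_int
      by (simp add: Bochner_Integration.integral_sum N.prob_space E_def del: Bochner_Integration.integral_add)
    then have "ennreal (exp (lam * (s - E q))) = ennreal (exp (\<integral>y'. h y' \<partial>PiM I2 p))" by simp
    also have "\<dots> \<le> (\<integral>\<^sup>+y'. ennreal (exp (h y')) \<partial>PiM I2 p)"
    proof (rule exp_integral_le[where b="lam * (\<bar>s\<bar> + 2 * card I)"])
      show "\<bar>h y'\<bar> \<le> lam * (\<bar>s\<bar> + 2 * card I)" if "y' \<in> space (PiM I2 p)" for y'
      proof -
        have "\<bar>\<Sum>i\<in>I. f q (y' (i, False)) + c * (f q (y' (i, False)))\<^sup>2\<bar>
           \<le> (\<Sum>i\<in>I. \<bar>f q (y' (i, False)) + c * (f q (y' (i, False)))\<^sup>2\<bar>)" by (rule sum_abs)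
        also have "\<dots> \<le> (\<Sum>i\<in>I. 2)" using bd2 that by (intro sum_mono) auto
        finally have "\<bar>s - (\<Sum>i\<in>I. f q (y' (i, False)) + c * (f q (y' (i, False)))\<^sup>2)\<bar> \<le> \<bar>s\<bar> + 2 * card I"
          by simp
        then show ?thesis using lam unfolding h_def abs_mult by (intro mult_mono) auto
      qed
    qed (use N.prob_space_axioms hint in auto)
    also have "\<dots> \<le> (\<integral>\<^sup>+y'. G (merge I1 I2 (y, y')) \<partial>PiM I2 p)"
    proof (intro nn_integral_mono)
      fix y'
      have "(\<Sum>i\<in>I. \<phi> (f q (merge I1 I2 (y, y') (i, True))) (f q (merge I1 I2 (y, y') (i, False))))
         = (\<Sum>i\<in>I. f q (y (i, True)) - (f q (y' (i, False)) + c * (f q (y' (i, False)))\<^sup>2))"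
        by (intro sum.cong) (auto simp: \<phi>_def merge_def I1_def I2_def)
      then have "h y' = lam * (\<Sum>i\<in>I. \<phi> (f q (merge I1 I2 (y, y') (i, True))) (f q (merge I1 I2 (y, y') (i, False))))"
        by (simp add: h_def s_def sum_subtractf)
      then show "ennreal (exp (h y')) \<le> G (merge I1 I2 (y, y'))"
        unfolding G_def using q by (intro SUP_upper2[of q]) auto
    qed
    finally show "ennreal (exp (lam * ((\<Sum>i\<in>I. f q (y (i, True))) - E q))) \<le> (\<integral>\<^sup>+y'. G (merge I1 I2 (y, y')) \<partial>PiM I2 p)"
      by (simp add: s_def)
  qed
  also have "\<dots> = (\<integral>\<^sup>+w. G w \<partial>?W)"
  proof -
    \<comment> \<open>Outside the index set the product needs some \<open>\<sigma>\<close>-finite measure; a point mass serves.\<close>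
    define p' where "p' = (\<lambda>j. if j \<in> ?J then p j else count_space {undefined})"
    have e: "PiM ?J p' = ?W" "PiM I1 p' = PiM I1 p" "PiM I2 p' = PiM I2 p"
      using J12 by (auto simp: p'_def intro!: PiM_cong)
    have "sigma_finite_measure (p' j)" for j
      using p(1)[of j] by (auto simp: p'_def intro: prob_space_imp_sigma_finite sigma_finite_measure_count_space_finite)
    then interpret product_sigma_finite p' by (rule product_sigma_finite.intro)
    have "integral\<^sup>N (PiM (I1 \<union> I2) p') G = (\<integral>\<^sup>+x. (\<integral>\<^sup>+y. G (merge I1 I2 (x, y)) \<partial>(PiM I2 p')) \<partial>(PiM I1 p'))"
      by (rule product_nn_integral_fold) (use J12 Gm e in auto)
    then show ?thesis using J12 e by simp
  qed
  also have "\<dots> \<le> ennreal (N * exp (lam * (3 * \<epsilon> * card I)))"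
    unfolding p_def
  proof (rule nn_integral_le_of_swap_average[OF I P])
    show "G \<in> borel_measurable (\<Pi>\<^sub>M j\<in>?J. P (fst j))" using Gm by (simp add: p_def)
    fix w assume w: "w \<in> space (\<Pi>\<^sub>M j\<in>?J. P (fst j))"
    have wsp: "w j \<in> space M" if "j \<in> ?J" for j
      using w that p(3)[OF that] by (auto simp: space_PiM p_def PiE_def Pi_def)
    have "finite (w ` ?J)" "w ` ?J \<subseteq> space M" using I wsp by auto
    moreover have "card (w ` ?J) \<le> 2 * card I"
      using card_image_le[of ?J w] I by (simp add: card_cartesian_product)
    ultimately obtain C where C: "C \<subseteq> A" "finite C" "real (card C) \<le> N"
      and cl: "\<And>q. q \<in> A \<Longrightarrow> \<exists>q'\<in>C. \<forall>x\<in>w ` ?J. \<bar>f q x - f q' x\<bar> \<le> \<epsilon>"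
      using cover[of "w ` ?J"] by blast
    define sg where "sg = (\<lambda>\<sigma> q i. if i \<in> \<sigma> then \<phi> (f q (w (i, False))) (f q (w (i, True)))
                                     else \<phi> (f q (w (i, True))) (f q (w (i, False))))"
    have Gsw: "G (\<lambda>j\<in>?J. w (fst j, snd j \<noteq> (fst j \<in> \<sigma>))) = (SUP q\<in>A. ennreal (exp (lam * (\<Sum>i\<in>I. sg \<sigma> q i))))" for \<sigma>
      unfolding G_def
      by (intro SUP_cong refl arg_cong[where f=ennreal] arg_cong[where f=exp] arg_cong2[where f="(*)"] sum.cong)
         (auto simp: sg_def)
    have \<phi>_close: "\<phi> u v \<le> \<phi> u' v' + 3 * \<epsilon>" if "\<bar>u - u'\<bar> \<le> \<epsilon>" "\<bar>v - v'\<bar> \<le> \<epsilon>" "\<bar>v\<bar> \<le> 1" "\<bar>v'\<bar> \<le> 1" for u v u' v'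
    proof -
      have "\<bar>v' - v\<bar> * \<bar>v' + v\<bar> \<le> \<epsilon> * 2" using that eps by (intro mult_mono) auto
      then have "\<bar>v'\<^sup>2 - v\<^sup>2\<bar> \<le> 2 * \<epsilon>"
        by (simp add: abs_mult[symmetric] power2_eq_square algebra_simps)
      then have "c * \<bar>v'\<^sup>2 - v\<^sup>2\<bar> \<le> 1/2 * (2 * \<epsilon>)" using c eps by (intro mult_mono) auto
      moreover have "c * (v'\<^sup>2 - v\<^sup>2) \<le> c * \<bar>v'\<^sup>2 - v\<^sup>2\<bar>" using c by (intro mult_left_mono) auto
      ultimately have "c * v'\<^sup>2 - c * v\<^sup>2 \<le> \<epsilon>" by (simp add: right_diff_distrib)
      then show ?thesis using that by (simp add: \<phi>_def)
    qed
    \<comment> \<open>Replacing \<open>q\<close> by its representative moves each summand by at most \<open>3 * \<epsilon>\<close>.\<close>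
    have le: "G (\<lambda>j\<in>?J. w (fst j, snd j \<noteq> (fst j \<in> \<sigma>)))
       \<le> ennreal (\<Sum>q\<in>C. exp (lam * (3 * \<epsilon> * card I)) * (\<Prod>i\<in>I. exp (lam * sg \<sigma> q i)))" for \<sigma>
      unfolding Gsw
    proof (rule SUP_least, rule ennreal_leI)
      fix q assume q: "q \<in> A"
      from cl[OF q] obtain q' where q': "q' \<in> C" "\<And>j. j \<in> ?J \<Longrightarrow> \<bar>f q (w j) - f q' (w j)\<bar> \<le> \<epsilon>" by blast
      have q'A: "q' \<in> A" using q' C by auto
      have "sg \<sigma> q i \<le> sg \<sigma> q' i + 3 * \<epsilon>" if i: "i \<in> I" for i
        using q'(2)[of "(i, True)"] q'(2)[of "(i, False)"] i bd[OF q wsp[of "(i, True)"]] bd[OF q wsp[of "(i, False)"]]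
           bd[OF q'A wsp[of "(i, True)"]] bd[OF q'A wsp[of "(i, False)"]]
        by (auto simp: sg_def intro!: \<phi>_close)
      then have "(\<Sum>i\<in>I. sg \<sigma> q i) \<le> (\<Sum>i\<in>I. sg \<sigma> q' i + 3 * \<epsilon>)" by (intro sum_mono)
      also have "\<dots> = (\<Sum>i\<in>I. sg \<sigma> q' i) + 3 * \<epsilon> * card I" by (simp add: sum.distrib)
      finally have "exp (lam * (\<Sum>i\<in>I. sg \<sigma> q i)) \<le> exp (lam * (3 * \<epsilon> * card I) + (\<Sum>i\<in>I. lam * sg \<sigma> q' i))"
        using lam by (simp add: sum_distrib_left[symmetric] distrib_left[symmetric] mult_left_mono add.commute)
      also have "\<dots> = exp (lam * (3 * \<epsilon> * card I)) * (\<Prod>i\<in>I. exp (lam * sg \<sigma> q' i))"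
        using I by (simp add: exp_add exp_sum)
      also have "\<dots> \<le> (\<Sum>q\<in>C. exp (lam * (3 * \<epsilon> * card I)) * (\<Prod>i\<in>I. exp (lam * sg \<sigma> q i)))"
        using C q' by (intro member_le_sum) (auto intro!: mult_nonneg_nonneg prod_nonneg simp del: mult_le_0_iff zero_le_mult_iff)
      finally show "exp (lam * (\<Sum>i\<in>I. sg \<sigma> q i)) \<le> \<dots>" .
    qed
    have each: "(\<Sum>\<sigma>\<in>Pow I. \<Prod>i\<in>I. exp (lam * sg \<sigma> q i)) \<le> 2 ^ card I" if q: "q \<in> C" for q
    proof -
      have qA: "q \<in> A" using q C by auto
      let ?a = "\<lambda>i. exp (lam * \<phi> (f q (w (i, False))) (f q (w (i, True))))"
      let ?b = "\<lambda>i. exp (lam * \<phi> (f q (w (i, True))) (f q (w (i, False))))"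
      have "(\<Sum>\<sigma>\<in>Pow I. \<Prod>i\<in>I. exp (lam * sg \<sigma> q i)) = (\<Sum>\<sigma>\<in>Pow I. (\<Prod>i\<in>\<sigma>. ?a i) * (\<Prod>i\<in>I - \<sigma>. ?b i))"
      proof (intro sum.cong refl)
        fix \<sigma> assume "\<sigma> \<in> Pow I"
        then have s: "\<sigma> \<subseteq> I" by simp
        have "(\<Prod>i\<in>I. exp (lam * sg \<sigma> q i)) = (\<Prod>i\<in>I - \<sigma>. exp (lam * sg \<sigma> q i)) * (\<Prod>i\<in>\<sigma>. exp (lam * sg \<sigma> q i))"
          by (rule prod.subset_diff[OF s I])
        also have "(\<Prod>i\<in>I - \<sigma>. exp (lam * sg \<sigma> q i)) = (\<Prod>i\<in>I - \<sigma>. ?b i)"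
          by (intro prod.cong) (auto simp: sg_def)
        also have "(\<Prod>i\<in>\<sigma>. exp (lam * sg \<sigma> q i)) = (\<Prod>i\<in>\<sigma>. ?a i)"
          by (intro prod.cong) (auto simp: sg_def)
        finally show "(\<Prod>i\<in>I. exp (lam * sg \<sigma> q i)) = (\<Prod>i\<in>\<sigma>. ?a i) * (\<Prod>i\<in>I - \<sigma>. ?b i)" by simp
      qed
      also have "\<dots> = (\<Prod>i\<in>I. ?a i + ?b i)" by (rule prod_add[OF I, symmetric])
      also have "\<dots> \<le> (\<Prod>i\<in>I. 2)"
      proof (intro prod_mono conjI)
        fix i assume i: "i \<in> I"
        show "?a i + ?b i \<le> 2" unfolding \<phi>_def
          using c lam bd[OF qA wsp[of "(i, True)"]] bd[OF qA wsp[of "(i, False)"]] i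
          by (intro exp_swap_le) auto
      qed (auto intro: add_nonneg_nonneg)
      finally show ?thesis by simp
    qed
    have "(\<Sum>\<sigma>\<in>Pow I. G (\<lambda>j\<in>?J. w (fst j, snd j \<noteq> (fst j \<in> \<sigma>))))
      \<le> (\<Sum>\<sigma>\<in>Pow I. ennreal (\<Sum>q\<in>C. exp (lam * (3 * \<epsilon> * card I)) * (\<Prod>i\<in>I. exp (lam * sg \<sigma> q i))))"
      by (intro sum_mono le)
    also have "\<dots> = ennreal (\<Sum>\<sigma>\<in>Pow I. \<Sum>q\<in>C. exp (lam * (3 * \<epsilon> * card I)) * (\<Prod>i\<in>I. exp (lam * sg \<sigma> q i)))"
      by (intro sum_ennreal) (auto intro!: sum_nonneg mult_nonneg_nonneg prod_nonneg)
    also have "\<dots> \<le> ennreal (2 ^ card I * (N * exp (lam * (3 * \<epsilon> * card I))))"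
    proof (rule ennreal_leI)
      have "(\<Sum>\<sigma>\<in>Pow I. \<Sum>q\<in>C. exp (lam * (3 * \<epsilon> * card I)) * (\<Prod>i\<in>I. exp (lam * sg \<sigma> q i)))
        = exp (lam * (3 * \<epsilon> * card I)) * (\<Sum>q\<in>C. \<Sum>\<sigma>\<in>Pow I. \<Prod>i\<in>I. exp (lam * sg \<sigma> q i))"
        by (subst sum.swap) (simp add: sum_distrib_left)
      also have "\<dots> \<le> exp (lam * (3 * \<epsilon> * card I)) * (\<Sum>q\<in>C. 2 ^ card I)"
        using each by (intro mult_left_mono sum_mono) auto
      also have "\<dots> \<le> exp (lam * (3 * \<epsilon> * card I)) * (N * 2 ^ card I)"
        using C by (intro mult_left_mono) auto
      finally show "(\<Sum>\<sigma>\<in>Pow I. \<Sum>q\<in>C. exp (lam * (3 * \<epsilon> * card I)) * (\<Prod>i\<in>I. exp (lam * sg \<sigma> q i)))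
         \<le> 2 ^ card I * (N * exp (lam * (3 * \<epsilon> * card I)))" by (simp add: mult_ac)
    qed
    also have "\<dots> = 2 ^ card I * ennreal (N * exp (lam * (3 * \<epsilon> * card I)))"
    proof -
      have "N \<ge> 0" using C(3) of_nat_0_le_iff[of "card C"] by linarith
      then show ?thesis by (subst ennreal_mult) (auto simp: ennreal_power[symmetric])
    qed
    finally show "(\<Sum>\<sigma>\<in>Pow I. G (\<lambda>j\<in>?J. w (fst j, snd j \<noteq> (fst j \<in> \<sigma>))))
       \<le> 2 ^ card I * ennreal (N * exp (lam * (3 * \<epsilon> * card I)))" .
  qed auto
  finally show ?thesis unfolding E_def .
qed

section \<open>Comparing Hellinger distances\<close>

lemma prob_space_absolutely_continuous_density:
  assumes "sigma_finite_measure \<nu>" "prob_space P" "sets P = sets \<nu>" "absolutely_continuous \<nu> P"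
  obtains p :: "'a \<Rightarrow> real" where "p \<in> borel_measurable \<nu>" "\<And>x. 0 \<le> p x" "P = density \<nu> p"
proof -
  interpret sigma_finite_measure \<nu> by fact
  interpret P: prob_space P by fact
  obtain D where D: "D \<in> borel_measurable \<nu>" "AE x in \<nu>. RN_deriv \<nu> P x = ennreal (D x)"
      "AE x in P. 0 < D x" "\<And>x. 0 \<le> D x"
    by (rule real_RN_deriv[OF P.finite_measure_axioms assms(4,3)]) (rule that)
  have "density \<nu> (\<lambda>x. ennreal (D x)) = density \<nu> (RN_deriv \<nu> P)"
    using D by (intro density_cong) auto
  also have "\<dots> = P" by (rule density_RN_deriv[OF assms(4,3)])
  finally show ?thesis using that[OF D(1) D(4)] by simp
qed

lemma sigma_finite_sum_measure:
  assumes "sigma_finite_measure \<mu>" "finite_measure R" "sets R = sets \<mu>"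
  shows "sigma_finite_measure (sum_measure \<mu> R)"
proof -
  from sigma_finite_measure.sigma_finite_countable[OF assms(1)]
  obtain A where A: "countable A" "A \<subseteq> sets \<mu>" "\<Union>A = space \<mu>" "\<forall>a\<in>A. emeasure \<mu> a \<noteq> \<infinity>" by blast
  interpret R: finite_measure R by fact
  show ?thesis
  proof (rule sigma_finite_measure.intro, intro exI conjI ballI)
    fix a assume a: "a \<in> A"
    then have "emeasure (sum_measure \<mu> R) a = emeasure \<mu> a + emeasure R a"
      using A assms(3) by (intro emeasure_sum_measure) auto
    then show "emeasure (sum_measure \<mu> R) a \<noteq> \<infinity>" using A(4) a R.emeasure_finite[of a] by simp
  qed (use A in auto)
qed

lemma absolutely_continuous_sum_measure:
  assumes "sets R = sets \<mu>"
  shows "absolutely_continuous (sum_measure \<mu> R) \<mu>" "absolutely_continuous (sum_measure \<mu> R) R"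
  using assms by (auto simp: absolutely_continuous_def null_sets_def emeasure_sum_measure)

lemma absolutely_continuous_trans:
  "absolutely_continuous M N \<Longrightarrow> absolutely_continuous N L \<Longrightarrow> absolutely_continuous M L"
  by (auto simp: absolutely_continuous_def)

lemma common_densities:
  assumes P: "prob_space P" and Q: "prob_space Q" and S: "prob_space S"
    and sets: "sets Q = sets P" "sets S = sets P"
  obtains \<nu> p q s where "sigma_finite_measure \<nu>" "sets \<nu> = sets P"
    "p \<in> borel_measurable \<nu>" "\<And>x. 0 \<le> (p x :: real)" "P = density \<nu> p"
    "q \<in> borel_measurable \<nu>" "\<And>x. 0 \<le> (q x :: real)" "Q = density \<nu> q"
    "s \<in> borel_measurable \<nu>" "\<And>x. 0 \<le> (s x :: real)" "S = density \<nu> s"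
proof -
  let ?\<nu> = "sum_measure (sum_measure P Q) S"
  note fin = prob_space.finite_measure[OF P] prob_space.finite_measure[OF Q] prob_space.finite_measure[OF S]
  have sf: "sigma_finite_measure ?\<nu>"
    using fin sets by (intro sigma_finite_sum_measure prob_space_imp_sigma_finite P) auto
  have S': "sets S = sets (sum_measure P Q)" using sets by simp
  note ac1 = absolutely_continuous_sum_measure[OF S']
  note ac2 = absolutely_continuous_sum_measure[OF sets(1)]
  have ac: "absolutely_continuous ?\<nu> P" "absolutely_continuous ?\<nu> Q" "absolutely_continuous ?\<nu> S"
    using absolutely_continuous_trans[OF ac1(1) ac2(1)] absolutely_continuous_trans[OF ac1(1) ac2(2)] ac1(2) .
  obtain p where p: "p \<in> borel_measurable ?\<nu>" "\<And>x. 0 \<le> (p x :: real)" "P = density ?\<nu> p"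
    by (rule prob_space_absolutely_continuous_density[OF sf P _ ac(1)]) auto
  obtain q where q: "q \<in> borel_measurable ?\<nu>" "\<And>x. 0 \<le> (q x :: real)" "Q = density ?\<nu> q"
    by (rule prob_space_absolutely_continuous_density[OF sf Q _ ac(2)]) (use sets in auto)
  obtain s where s: "s \<in> borel_measurable ?\<nu>" "\<And>x. 0 \<le> (s x :: real)" "S = density ?\<nu> s"
    by (rule prob_space_absolutely_continuous_density[OF sf S _ ac(3)]) (use sets in auto)
  show ?thesis by (rule that[OF sf _ p q s]) simp
qed

lemma prob_density_integral:
  fixes f :: "'a \<Rightarrow> real"
  assumes [measurable]: "f \<in> borel_measurable \<nu>" and f0: "\<And>x. x \<in> space \<nu> \<Longrightarrow> 0 \<le> f x"
    and P: "prob_space (density \<nu> f)"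
  shows "integrable \<nu> f" "(\<integral>x. f x \<partial>\<nu>) = 1"
proof -
  have "(\<integral>\<^sup>+x. ennreal (f x) \<partial>\<nu>) = emeasure (density \<nu> f) (space \<nu>)"
    by (subst emeasure_density) (auto intro!: nn_integral_cong)
  also have "\<dots> = 1" using prob_space.emeasure_space_1[OF P] by simp
  finally have nn: "(\<integral>\<^sup>+x. ennreal (f x) \<partial>\<nu>) = ennreal 1" by simp
  show "integrable \<nu> f" using f0 nn by (intro integrableI_nonneg) (auto intro!: AE_I2)
  show "(\<integral>x. f x \<partial>\<nu>) = 1" using f0 nn by (intro integral_eq_nn_integral[THEN trans]) (auto intro!: AE_I2)
qed

lemma sqrt_diff_sq_le: "0 \<le> a \<Longrightarrow> 0 \<le> b \<Longrightarrow> (sqrt a - sqrt b)\<^sup>2 \<le> \<bar>a - b\<bar>"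
proof -
  assume ab: "0 \<le> a" "0 \<le> b"
  have "\<bar>sqrt a - sqrt b\<bar> * \<bar>sqrt a - sqrt b\<bar> \<le> \<bar>sqrt a - sqrt b\<bar> * \<bar>sqrt a + sqrt b\<bar>"
  proof (rule mult_left_mono)
    have "0 \<le> sqrt a" "0 \<le> sqrt b" using ab by auto
    then show "\<bar>sqrt a - sqrt b\<bar> \<le> \<bar>sqrt a + sqrt b\<bar>" by linarith
  qed simp
  also have "\<dots> = \<bar>(sqrt a - sqrt b) * (sqrt a + sqrt b)\<bar>" by (simp only: abs_mult)
  also have "(sqrt a - sqrt b) * (sqrt a + sqrt b) = a - b"
    using ab by (simp add: algebra_simps)
  finally show ?thesis by (simp add: power2_eq_square abs_mult[symmetric])
qed

lemma integrable_sqrt_diff_sq: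
  fixes f g :: "'a \<Rightarrow> real"
  assumes f: "integrable \<nu> f" and g: "integrable \<nu> g"
    and f0: "\<And>x. x \<in> space \<nu> \<Longrightarrow> 0 \<le> f x" and g0: "\<And>x. x \<in> space \<nu> \<Longrightarrow> 0 \<le> g x"
  shows "integrable \<nu> (\<lambda>x. (sqrt (f x) - sqrt (g x))\<^sup>2)"
proof (rule Bochner_Integration.integrable_bound)
  show "integrable \<nu> (\<lambda>x. \<bar>f x - g x\<bar>)" using f g by auto
  have [measurable]: "f \<in> borel_measurable \<nu>" "g \<in> borel_measurable \<nu>" using f g by auto
  show "(\<lambda>x. (sqrt (f x) - sqrt (g x))\<^sup>2) \<in> borel_measurable \<nu>" by measurable
  show "AE x in \<nu>. norm ((sqrt (f x) - sqrt (g x))\<^sup>2) \<le> norm \<bar>f x - g x\<bar>"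
    using sqrt_diff_sq_le f0 g0 by (intro AE_I2) auto
qed

lemma hellinger_sq_nonneg: "0 \<le> hellinger_sq P Q"
  by (auto simp: hellinger_sq_def intro!: Bochner_Integration.integral_nonneg)

lemma hellinger_sq_commute:
  assumes "sets P = sets Q"
  shows "hellinger_sq P Q = hellinger_sq Q P"
proof -
  have "sum_measure P Q = sum_measure Q P"
    using assms sets_eq_imp_space_eq[OF assms] by (simp add: sum_measure_def add.commute)
  then show ?thesis by (simp add: hellinger_sq_def power2_commute)
qed

lemma hellinger_sq_le_1:
  assumes "prob_space P" "prob_space Q" "sets Q = sets P"
  shows "hellinger_sq P Q \<le> 1"
proof -
  obtain \<nu> p q s where nu: "sigma_finite_measure \<nu>"
    and p: "p \<in> borel_measurable \<nu>" "\<And>x. 0 \<le> (p x :: real)" "P = density \<nu> p"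
    and q: "q \<in> borel_measurable \<nu>" "\<And>x. 0 \<le> (q x :: real)" "Q = density \<nu> q"
    by (rule common_densities[OF assms(1,2,2) assms(3,3)]) blast
  note ip = prob_density_integral[OF p(1,2) assms(1)[unfolded p(3)]]
  note iq = prob_density_integral[OF q(1,2) assms(2)[unfolded q(3)]]
  have "(\<integral>x. (sqrt (p x) - sqrt (q x))\<^sup>2 \<partial>\<nu>) \<le> (\<integral>x. p x + q x \<partial>\<nu>)"
  proof (intro integral_mono integrable_sqrt_diff_sq ip iq p q Bochner_Integration.integrable_add)
    fix x show "(sqrt (p x) - sqrt (q x))\<^sup>2 \<le> p x + q x"
      using p(2)[of x] q(2)[of x] by (simp add: power2_diff)
  qed
  also have "\<dots> = 2" using ip iq by simp
  finally have "(\<integral>x. (sqrt (p x) - sqrt (q x))\<^sup>2 \<partial>\<nu>) \<le> 2" .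
  moreover have "hellinger_sq P Q = (1/2) * (\<integral>x. (sqrt (p x) - sqrt (q x))\<^sup>2 \<partial>\<nu>)"
    unfolding p(3) q(3)
    by (intro hellinger_sq_density nu p q) (use assms(1,2) p(3) q(3) in argo)+
  ultimately show ?thesis by simp
qed

text \<open>Relaxed triangle inequality; the pointwise form \<open>(x + y)\<^sup>2 \<le> (1 + e) x\<^sup>2 + (1 + 1/e) y\<^sup>2\<close> suffices.\<close>

lemma hellinger_sq_triangle:
  assumes "prob_space P" "prob_space Q" "prob_space S" and sets: "sets Q = sets P" "sets S = sets P"
    and e: "e > 0"
  shows "hellinger_sq P Q \<le> (1 + e) * hellinger_sq P S + (1 + 1 / e) * hellinger_sq S Q"
proof -
  obtain \<nu> p q s where nu: "sigma_finite_measure \<nu>" "sets \<nu> = sets P"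
    and p: "p \<in> borel_measurable \<nu>" "\<And>x. 0 \<le> (p x :: real)" "P = density \<nu> p"
    and q: "q \<in> borel_measurable \<nu>" "\<And>x. 0 \<le> (q x :: real)" "Q = density \<nu> q"
    and s: "s \<in> borel_measurable \<nu>" "\<And>x. 0 \<le> (s x :: real)" "S = density \<nu> s"
    by (rule common_densities[OF assms(1-3) sets]) blast
  note ip = prob_density_integral[OF p(1,2) assms(1)[unfolded p(3)]]
  note iq = prob_density_integral[OF q(1,2) assms(2)[unfolded q(3)]]
  note js = prob_density_integral[OF s(1,2) assms(3)[unfolded s(3)]]
  have pt: "(x - y)\<^sup>2 \<le> (1 + e) * (x - z)\<^sup>2 + (1 + 1 / e) * (z - y)\<^sup>2" for x y z :: real
  proof -
    have "0 \<le> (e * (x - z) - (z - y))\<^sup>2 / e" using e by simp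
    also have "\<dots> = (1 + e) * (x - z)\<^sup>2 + (1 + 1 / e) * (z - y)\<^sup>2 - (x - y)\<^sup>2"
      using e by (simp add: power2_eq_square field_simps)
    finally show ?thesis by simp
  qed
  have "(\<integral>x. (sqrt (p x) - sqrt (q x))\<^sup>2 \<partial>\<nu>)
    \<le> (\<integral>x. (1 + e) * (sqrt (p x) - sqrt (s x))\<^sup>2 + (1 + 1 / e) * (sqrt (s x) - sqrt (q x))\<^sup>2 \<partial>\<nu>)"
    by (intro integral_mono Bochner_Integration.integrable_add integrable_mult_right integrable_sqrt_diff_sq ip iq js p q s pt)
  also have "\<dots> = (1 + e) * (\<integral>x. (sqrt (p x) - sqrt (s x))\<^sup>2 \<partial>\<nu>) + (1 + 1 / e) * (\<integral>x. (sqrt (s x) - sqrt (q x))\<^sup>2 \<partial>\<nu>)"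
    by (subst Bochner_Integration.integral_add)
      (auto intro!: integrable_mult_right integrable_sqrt_diff_sq ip iq js p q s)
  finally have le: "(\<integral>x. (sqrt (p x) - sqrt (q x))\<^sup>2 \<partial>\<nu>)
    \<le> (1 + e) * (\<integral>x. (sqrt (p x) - sqrt (s x))\<^sup>2 \<partial>\<nu>) + (1 + 1 / e) * (\<integral>x. (sqrt (s x) - sqrt (q x))\<^sup>2 \<partial>\<nu>)" .
  have hell: "hellinger_sq P Q = (1/2) * (\<integral>x. (sqrt (p x) - sqrt (q x))\<^sup>2 \<partial>\<nu>)"
    "hellinger_sq P S = (1/2) * (\<integral>x. (sqrt (p x) - sqrt (s x))\<^sup>2 \<partial>\<nu>)"
    "hellinger_sq S Q = (1/2) * (\<integral>x. (sqrt (s x) - sqrt (q x))\<^sup>2 \<partial>\<nu>)"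
    unfolding p(3) q(3) s(3)
    by (intro hellinger_sq_density nu p q s; use assms(1-3) p(3) q(3) s(3) in argo)+
  have lin: "x / 2 \<le> (1 + e) * (y / 2) + (1 + 1 / e) * (z / 2)"
    if "x \<le> (1 + e) * y + (1 + 1 / e) * z" for x y z :: real
    using that by (simp add: add_divide_distrib[symmetric])
  show ?thesis using lin[OF le] unfolding hell by simp
qed

lemma prob_densityD:
  assumes "prob_density \<mu> f"
  shows "f \<in> borel_measurable \<mu>" "\<And>x. x \<in> space \<mu> \<Longrightarrow> 0 \<le> f x" "prob_space (density \<mu> f)"
    "integrable \<mu> f" "(\<integral>x. f x \<partial>\<mu>) = 1" "prob_space (dens_measure \<mu> f)"
proof -
  show f: "f \<in> borel_measurable \<mu>" "\<And>x. x \<in> space \<mu> \<Longrightarrow> 0 \<le> f x" "prob_space (dens_measure \<mu> f)"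
    using assms unfolding prob_density_def by blast+
  then show p: "prob_space (density \<mu> f)" unfolding dens_measure_def by blast
  show "integrable \<mu> f" "(\<integral>x. f x \<partial>\<mu>) = 1" using prob_density_integral[OF f(1,2) p] by blast+
qed

lemma sets_dens_measure [simp]: "sets (dens_measure \<mu> f) = sets \<mu>"
  and space_dens_measure [simp]: "space (dens_measure \<mu> f) = space \<mu>"
  by (simp_all add: dens_measure_def)

lemma hellinger_sq_dens_measure:
  assumes "sigma_finite_measure \<mu>" "prob_density \<mu> f" "prob_density \<mu> g"
  shows "hellinger_sq (dens_measure \<mu> f) (dens_measure \<mu> g) = (1/2) * (\<integral>x. (sqrt (f x) - sqrt (g x))\<^sup>2 \<partial>\<mu>)"
  unfolding dens_measure_def
  by (intro hellinger_sq_density assms(1) prob_densityD[OF assms(2)] prob_densityD[OF assms(3)])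

lemma prob_density_mixture:
  assumes f: "\<And>k. k \<in> S \<Longrightarrow> prob_density \<mu> (f k)" and w: "\<And>k. k \<in> S \<Longrightarrow> 0 \<le> w k" and one: "(\<Sum>k\<in>S. w k) = 1"
  shows "prob_density \<mu> (\<lambda>x. \<Sum>k\<in>S. w k * f k x)"
proof -
  let ?g = "\<lambda>x. \<Sum>k\<in>S. w k * f k x"
  have [measurable]: "?g \<in> borel_measurable \<mu>" using prob_densityD(1)[OF f] by measurable
  have g0: "0 \<le> ?g x" if "x \<in> space \<mu>" for x
    using w prob_densityD(2)[OF f] that by (auto intro!: sum_nonneg)
  have int: "integrable \<mu> ?g"
    using prob_densityD(4)[OF f] by (intro Bochner_Integration.integrable_sum integrable_mult_right) auto
  have "(\<integral>x. ?g x \<partial>\<mu>) = 1"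
    using prob_densityD(4,5)[OF f] one by (subst Bochner_Integration.integral_sum) auto
  then have "(\<integral>\<^sup>+x. ennreal (?g x) \<partial>\<mu>) = 1"
    using nn_integral_eq_integral[OF int] g0 by (auto intro!: AE_I2)
  moreover have "emeasure (density \<mu> ?g) (space \<mu>) = (\<integral>\<^sup>+x. ennreal (?g x) \<partial>\<mu>)"
    by (subst emeasure_density) (auto intro!: nn_integral_cong)
  ultimately have "prob_space (dens_measure \<mu> ?g)"
    by (intro prob_spaceI) (simp add: dens_measure_def)
  then show ?thesis using g0 by (auto simp: prob_density_def)
qed

lemma hellinger_sq_mixture_weights:
  assumes mu: "sigma_finite_measure \<mu>" and f: "\<And>k. k \<in> S \<Longrightarrow> prob_density \<mu> (f k)"
    and w: "\<And>k. k \<in> S \<Longrightarrow> 0 \<le> w k" "(\<Sum>k\<in>S. w k) = 1"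
    and v: "\<And>k. k \<in> S \<Longrightarrow> 0 \<le> v k" "(\<Sum>k\<in>S. v k) = 1"
  shows "hellinger_sq (dens_measure \<mu> (\<lambda>x. \<Sum>k\<in>S. w k * f k x)) (dens_measure \<mu> (\<lambda>x. \<Sum>k\<in>S. v k * f k x))
     \<le> (1/2) * (\<Sum>k\<in>S. \<bar>w k - v k\<bar>)"
proof -
  let ?g = "\<lambda>x. \<Sum>k\<in>S. w k * f k x" and ?h = "\<lambda>x. \<Sum>k\<in>S. v k * f k x"
  have g: "prob_density \<mu> ?g" "prob_density \<mu> ?h" using prob_density_mixture f w v by blast+
  have "(\<integral>x. (sqrt (?g x) - sqrt (?h x))\<^sup>2 \<partial>\<mu>) \<le> (\<integral>x. (\<Sum>k\<in>S. \<bar>w k - v k\<bar> * f k x) \<partial>\<mu>)"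
  proof (intro integral_mono integrable_sqrt_diff_sq prob_densityD(4)[OF g(1)] prob_densityD(4)[OF g(2)]
      prob_densityD(2)[OF g(1)] prob_densityD(2)[OF g(2)] Bochner_Integration.integrable_sum integrable_mult_right)
    fix x assume x: "x \<in> space \<mu>"
    have "(sqrt (?g x) - sqrt (?h x))\<^sup>2 \<le> \<bar>?g x - ?h x\<bar>"
      using prob_densityD(2)[OF g(1) x] prob_densityD(2)[OF g(2) x] by (rule sqrt_diff_sq_le)
    also have "\<dots> = \<bar>\<Sum>k\<in>S. (w k - v k) * f k x\<bar>" by (simp add: sum_subtractf left_diff_distrib)
    also have "\<dots> \<le> (\<Sum>k\<in>S. \<bar>(w k - v k) * f k x\<bar>)" by (rule sum_abs)
    also have "\<dots> = (\<Sum>k\<in>S. \<bar>w k - v k\<bar> * f k x)"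
      using prob_densityD(2)[OF f x] by (intro sum.cong) (auto simp: abs_mult)
    finally show "(sqrt (?g x) - sqrt (?h x))\<^sup>2 \<le> (\<Sum>k\<in>S. \<bar>w k - v k\<bar> * f k x)" .
  qed (use prob_densityD(4)[OF f] in auto)
  also have "\<dots> = (\<Sum>k\<in>S. \<bar>w k - v k\<bar>)"
    using prob_densityD(4,5)[OF f] by (subst Bochner_Integration.integral_sum) auto
  finally show ?thesis using hellinger_sq_dens_measure[OF mu g] by simp
qed

text \<open>The squared Hellinger distance is jointly convex: for fixed weights this is the
  Cauchy--Schwarz inequality for the vectors with entries \<open>sqrt (w k * a k)\<close> and \<open>sqrt (w k * b k)\<close>.\<close>

lemma hellinger_sq_mixture_components:
  assumes mu: "sigma_finite_measure \<mu>" and f: "\<And>k. k \<in> S \<Longrightarrow> prob_density \<mu> (f k)"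
    and g: "\<And>k. k \<in> S \<Longrightarrow> prob_density \<mu> (g k)"
    and w: "\<And>k. k \<in> S \<Longrightarrow> 0 \<le> w k" "(\<Sum>k\<in>S. w k) = 1"
  shows "hellinger_sq (dens_measure \<mu> (\<lambda>x. \<Sum>k\<in>S. w k * f k x)) (dens_measure \<mu> (\<lambda>x. \<Sum>k\<in>S. w k * g k x))
     \<le> (\<Sum>k\<in>S. w k * hellinger_sq (dens_measure \<mu> (f k)) (dens_measure \<mu> (g k)))"
proof -
  let ?F = "\<lambda>x. \<Sum>k\<in>S. w k * f k x" and ?G = "\<lambda>x. \<Sum>k\<in>S. w k * g k x"
  have FG: "prob_density \<mu> ?F" "prob_density \<mu> ?G" using prob_density_mixture f g w by blast+
  have "(\<integral>x. (sqrt (?F x) - sqrt (?G x))\<^sup>2 \<partial>\<mu>) \<le> (\<integral>x. (\<Sum>k\<in>S. w k * (sqrt (f k x) - sqrt (g k x))\<^sup>2) \<partial>\<mu>)"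
  proof (intro integral_mono integrable_sqrt_diff_sq prob_densityD(4)[OF FG(1)] prob_densityD(4)[OF FG(2)]
      prob_densityD(2)[OF FG(1)] prob_densityD(2)[OF FG(2)] Bochner_Integration.integrable_sum integrable_mult_right)
    fix x assume x: "x \<in> space \<mu>"
    let ?a = "\<lambda>k. sqrt (w k * f k x)" and ?b = "\<lambda>k. sqrt (w k * g k x)"
    have nn: "0 \<le> w k * f k x" "0 \<le> w k * g k x" if "k \<in> S" for k
      using that w(1) prob_densityD(2)[OF f x] prob_densityD(2)[OF g x] by auto
    have "(\<Sum>k\<in>S. ?a k * ?b k) \<le> (\<Sum>k\<in>S. \<bar>?a k\<bar> * \<bar>?b k\<bar>)" by (intro sum_mono) (simp add: abs_mult[symmetric])
    also have "\<dots> \<le> L2_set ?a S * L2_set ?b S" by (rule L2_set_mult_ineq)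
    also have "\<dots> = sqrt (?F x) * sqrt (?G x)" using nn by (simp add: L2_set_def)
    finally have cs: "(\<Sum>k\<in>S. ?a k * ?b k) \<le> sqrt (?F x) * sqrt (?G x)" .
    have "(sqrt (?F x) - sqrt (?G x))\<^sup>2 = ?F x + ?G x - 2 * (sqrt (?F x) * sqrt (?G x))"
      using nn by (simp add: power2_diff sum_nonneg)
    also have "\<dots> \<le> ?F x + ?G x - 2 * (\<Sum>k\<in>S. ?a k * ?b k)" using cs by simp
    also have "\<dots> = (\<Sum>k\<in>S. w k * f k x + w k * g k x - 2 * (?a k * ?b k))"
      by (simp add: sum.distrib sum_subtractf sum_distrib_left)
    also have "\<dots> = (\<Sum>k\<in>S. w k * (sqrt (f k x) - sqrt (g k x))\<^sup>2)"
    proof (intro sum.cong refl)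
      fix k assume k: "k \<in> S"
      have "?a k * ?b k = w k * (sqrt (f k x) * sqrt (g k x))"
        using w(1)[OF k] by (simp add: real_sqrt_mult)
      moreover have "0 \<le> f k x" "0 \<le> g k x" using k prob_densityD(2)[OF f x] prob_densityD(2)[OF g x] by auto
      ultimately show "w k * f k x + w k * g k x - 2 * (?a k * ?b k) = w k * (sqrt (f k x) - sqrt (g k x))\<^sup>2"
        by (simp add: power2_diff algebra_simps)
    qed
    finally show "(sqrt (?F x) - sqrt (?G x))\<^sup>2 \<le> (\<Sum>k\<in>S. w k * (sqrt (f k x) - sqrt (g k x))\<^sup>2)" .
  qed (use prob_densityD[OF f] prob_densityD[OF g] in \<open>auto intro!: integrable_sqrt_diff_sq\<close>)
  also have "\<dots> = (\<Sum>k\<in>S. w k * (\<integral>x. (sqrt (f k x) - sqrt (g k x))\<^sup>2 \<partial>\<mu>))"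
    using prob_densityD[OF f] prob_densityD[OF g]
    by (subst Bochner_Integration.integral_sum) (auto intro!: integrable_mult_right integrable_sqrt_diff_sq)
  also have "\<dots> = (\<Sum>k\<in>S. 2 * (w k * hellinger_sq (dens_measure \<mu> (f k)) (dens_measure \<mu> (g k))))"
  proof (intro sum.cong refl)
    fix k assume k: "k \<in> S"
    show "w k * (\<integral>x. (sqrt (f k x) - sqrt (g k x))\<^sup>2 \<partial>\<mu>)
      = 2 * (w k * hellinger_sq (dens_measure \<mu> (f k)) (dens_measure \<mu> (g k)))"
      using hellinger_sq_dens_measure[OF mu f[OF k] g[OF k]] by simp
  qed
  finally show ?thesis using hellinger_sq_dens_measure[OF mu FG] by (simp add: sum_distrib_left[symmetric])
qed

section \<open>The expected comparison is controlled by Hellinger distances\<close>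

text \<open>Behind the next bounds is a polynomial inequality in \<open>R = sqrt r\<close>, \<open>A = sqrt a\<close>,
  \<open>B = sqrt b\<close>, where \<open>r\<close>, \<open>a\<close>, \<open>b\<close> are the densities of the true distribution and of the two
  candidates. The term \<open>(b - a) / 4\<close> integrates to zero for probability densities; its coefficient
  is the only one for which both sides agree to first order at \<open>R = A = B\<close>.\<close>

lemma hellinger_cubic_ineq:
  fixes R A B :: real
  assumes R: "0 \<le> R" and A: "0 \<le> A" and B: "0 \<le> B"
  shows "(B - A) * R\<^sup>2 \<le> (A + B) * (2 * (R - A)\<^sup>2 - 3/16 * (R - B)\<^sup>2 + (B\<^sup>2 - A\<^sup>2) / 4)"
proof -
  define S where "S = A + B"
  \<comment> \<open>The nonnegative quantity is 16 times the difference of the two sides of the claim.\<close>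
  have key: "0 \<le> S * (28 * (R - A)\<^sup>2 + (R - B)\<^sup>2) + 8 * R * ((R - B)\<^sup>2 - (R - A)\<^sup>2)"
  proof (cases "8 * R \<le> 28 * S \<or> B \<le> A")
    case True
    then show ?thesis
    proof
      assume "8 * R \<le> 28 * S"
      then have "8 * R * (R - A)\<^sup>2 \<le> 28 * S * (R - A)\<^sup>2" by (intro mult_right_mono) auto
      moreover have "0 \<le> S * (R - B)\<^sup>2" "0 \<le> 8 * R * (R - B)\<^sup>2" using assms by (auto simp: S_def)
      ultimately show ?thesis by (simp add: algebra_simps)
    next
      assume BA: "B \<le> A"
      show ?thesis
      proof (cases "2 * R \<le> S")
        case True
        then have "8 * R * (R - A)\<^sup>2 \<le> 28 * S * (R - A)\<^sup>2" using R by (intro mult_right_mono) auto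
        moreover have "0 \<le> S * (R - B)\<^sup>2" "0 \<le> 8 * R * (R - B)\<^sup>2" using assms by (auto simp: S_def)
        ultimately show ?thesis by (simp add: algebra_simps)
      next
        case False
        have "(R - B)\<^sup>2 - (R - A)\<^sup>2 = (A - B) * (2 * R - S)"
          by (simp add: S_def power2_eq_square algebra_simps)
        then have "0 \<le> 8 * R * ((R - B)\<^sup>2 - (R - A)\<^sup>2)" using False BA R by simp
        moreover have "0 \<le> S * (28 * (R - A)\<^sup>2 + (R - B)\<^sup>2)" using assms by (auto simp: S_def)
        ultimately show ?thesis by simp
      qed
    qed
  next
    case False
    then have "7 * S < 2 * R" "A < B" by auto
    then have AR: "6 * R \<le> 7 * (R - A)" by (simp add: S_def)
    have S0: "0 \<le> S" using assms by (simp add: S_def)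
    have "(6 * R)\<^sup>2 \<le> (7 * (R - A))\<^sup>2" using AR R by (intro power_mono) auto
    then have "36 * R\<^sup>2 \<le> 49 * (R - A)\<^sup>2" unfolding power_mult_distrib by simp
    then have "16 * R\<^sup>2 \<le> 28 * (R - A)\<^sup>2" using zero_le_power2[of R] by linarith
    then have "S * (16 * R\<^sup>2) \<le> S * (28 * (R - A)\<^sup>2 + (R - B)\<^sup>2)"
      using S0 by (intro mult_left_mono) (auto intro: add_increasing2)
    moreover have "8 * R * ((R - A)\<^sup>2 - (R - B)\<^sup>2) \<le> S * (16 * R\<^sup>2)"
    proof -
      have "(R - A)\<^sup>2 - (R - B)\<^sup>2 = (B - A) * (2 * R - S)"
        by (simp add: S_def power2_eq_square algebra_simps)
      also have "\<dots> \<le> S * (2 * R)" using False S0 assms by (intro mult_mono) (auto simp: S_def)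
      finally have "8 * R * ((R - A)\<^sup>2 - (R - B)\<^sup>2) \<le> 8 * R * (S * (2 * R))"
        using R by (intro mult_left_mono) auto
      then show ?thesis by (simp add: power2_eq_square mult_ac)
    qed
    ultimately show ?thesis by (simp add: algebra_simps)
  qed
  have "16 * ((A + B) * (2 * (R - A)\<^sup>2 - 3/16 * (R - B)\<^sup>2 + (B\<^sup>2 - A\<^sup>2) / 4) - (B - A) * R\<^sup>2)
     = S * (28 * (R - A)\<^sup>2 + (R - B)\<^sup>2) + 8 * R * ((R - B)\<^sup>2 - (R - A)\<^sup>2)"
    by (simp add: S_def power2_eq_square field_simps)
  moreover have "y \<le> x" if "16 * (x - y) = z" "0 \<le> z" for x y z :: real using that by simp
  ultimately show ?thesis using key by blast
qed

lemma hellinger_square_ineq: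
  fixes R A B :: real
  assumes R: "0 \<le> R" and A: "0 \<le> A" and B: "0 \<le> B"
  shows "(B - A)\<^sup>2 * R\<^sup>2 \<le> 2 * (A + B)\<^sup>2 * ((R - A)\<^sup>2 + (R - B)\<^sup>2)"
proof (cases "A + B \<le> R")
  case True
  have "(B - A)\<^sup>2 \<le> (A + B)\<^sup>2" using assms by (simp add: abs_le_square_iff[symmetric])
  moreover have "R\<^sup>2 \<le> 2 * ((R - A)\<^sup>2 + (R - B)\<^sup>2)"
  proof -
    have "R\<^sup>2 \<le> ((R - A) + (R - B))\<^sup>2" using True R by (intro power_mono) auto
    also have "\<dots> \<le> 2 * ((R - A)\<^sup>2 + (R - B)\<^sup>2)"
      using zero_le_power2[of "(R - A) - (R - B)"] by (simp add: power2_eq_square algebra_simps)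
    finally show ?thesis .
  qed
  ultimately have "(B - A)\<^sup>2 * R\<^sup>2 \<le> (A + B)\<^sup>2 * (2 * ((R - A)\<^sup>2 + (R - B)\<^sup>2))"
    by (intro mult_mono) auto
  then show ?thesis by (simp only: mult_ac)
next
  case False
  have "(B - A)\<^sup>2 \<le> 2 * ((R - A)\<^sup>2 + (R - B)\<^sup>2)"
    using zero_le_power2[of "(R - A) + (R - B)"] by (simp add: power2_eq_square algebra_simps)
  moreover have "R\<^sup>2 \<le> (A + B)\<^sup>2" using False R by (intro power_mono) auto
  ultimately have "(B - A)\<^sup>2 * R\<^sup>2 \<le> (2 * ((R - A)\<^sup>2 + (R - B)\<^sup>2)) * (A + B)\<^sup>2"
    by (intro mult_mono) auto
  then show ?thesis by (simp only: mult_ac)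
qed

text \<open>Here \<open>b\<close> is an enlarged version of \<open>b0\<close>, and where both \<open>a\<close> and \<open>b\<close> vanish the value of the
  test \<open>t\<close> is left free. The latter covers the part of the true distribution that is singular
  with respect to the dominating measure.\<close>

lemma test_pointwise_ineq:
  fixes r a b b0 t :: real
  assumes r: "0 \<le> r" and a: "0 \<le> a" and b0: "0 \<le> b0" "b0 \<le> b" and t: "\<bar>t\<bar> \<le> 1"
    and teq: "0 < a + b \<Longrightarrow> t = rho a b"
  shows "r * (t + 1/25 * t\<^sup>2) \<le> 52/25 * (sqrt r - sqrt a)\<^sup>2 - 39/400 * (sqrt r - sqrt b0)\<^sup>2
           + (b - a) / 4 + 43/40 * (b - b0)"
proof -
  have b: "0 \<le> b" using b0 by simp
  define R where "R = sqrt r"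
  define A where "A = sqrt a"
  define B where "B = sqrt b"
  define B0 where "B0 = sqrt b0"
  have nn: "0 \<le> R" "0 \<le> A" "0 \<le> B" "0 \<le> B0" "R\<^sup>2 = r" "A\<^sup>2 = a" "B\<^sup>2 = b" "B0\<^sup>2 = b0" "B0 \<le> B"
    using r a b b0 by (auto simp: R_def A_def B_def B0_def)
  have 1: "t * R\<^sup>2 \<le> 2 * (R - A)\<^sup>2 - 3/16 * (R - B)\<^sup>2 + (B\<^sup>2 - A\<^sup>2) / 4"
    and 2: "t\<^sup>2 * R\<^sup>2 \<le> 2 * ((R - A)\<^sup>2 + (R - B)\<^sup>2)"
  proof -
    have "t * R\<^sup>2 \<le> 2 * (R - A)\<^sup>2 - 3/16 * (R - B)\<^sup>2 + (B\<^sup>2 - A\<^sup>2) / 4 \<and>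
       t\<^sup>2 * R\<^sup>2 \<le> 2 * ((R - A)\<^sup>2 + (R - B)\<^sup>2)"
    proof (cases "A + B = 0")
      case True
      then have "A = 0" "B = 0" using nn by auto
      moreover have "t * R\<^sup>2 \<le> 1 * R\<^sup>2" using t by (intro mult_right_mono) auto
      moreover have "t\<^sup>2 * R\<^sup>2 \<le> 1 * R\<^sup>2" using t by (intro mult_right_mono) (auto simp: abs_square_le_1)
      moreover have "2 * (R - A)\<^sup>2 - 3/16 * (R - B)\<^sup>2 + (B\<^sup>2 - A\<^sup>2) / 4 = 29/16 * R\<^sup>2"
        "2 * ((R - A)\<^sup>2 + (R - B)\<^sup>2) = 4 * R\<^sup>2" using \<open>A = 0\<close> \<open>B = 0\<close> by simp_all
      moreover have "x \<le> 29/16 * y \<and> z \<le> 4 * y" if "x \<le> 1 * y" "z \<le> 1 * y" "0 \<le> y" for x y z :: real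
        using that by auto
      ultimately show ?thesis using zero_le_power2[of R] by presburger
    next
      case False
      then have S: "A + B > 0" using nn by auto
      then have "0 < a + b" using a b nn by (metis A_def B_def add.right_neutral add_nonneg_eq_0_iff add_nonneg_nonneg less_eq_real_def real_sqrt_zero)
      then have teq: "t = (B - A) / (A + B)" using teq by (simp add: rho_def A_def B_def add.commute)
      have "(B - A) * R\<^sup>2 / (A + B) \<le> 2 * (R - A)\<^sup>2 - 3/16 * (R - B)\<^sup>2 + (B\<^sup>2 - A\<^sup>2) / 4"
        using hellinger_cubic_ineq[of R A B] nn S by (subst pos_divide_le_eq) (auto simp: mult.commute)
      moreover have "(B - A)\<^sup>2 * R\<^sup>2 / (A + B)\<^sup>2 \<le> 2 * ((R - A)\<^sup>2 + (R - B)\<^sup>2)"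
      proof -
        have "0 < (A + B)\<^sup>2" using S by simp
        moreover have "(B - A)\<^sup>2 * R\<^sup>2 \<le> 2 * ((R - A)\<^sup>2 + (R - B)\<^sup>2) * (A + B)\<^sup>2"
          using hellinger_square_ineq[of R A B] nn by (simp only: mult_ac)
        ultimately show ?thesis by (simp only: pos_divide_le_eq)
      qed
      ultimately show ?thesis unfolding teq by (simp add: power_divide)
    qed
    then show "t * R\<^sup>2 \<le> 2 * (R - A)\<^sup>2 - 3/16 * (R - B)\<^sup>2 + (B\<^sup>2 - A\<^sup>2) / 4"
      "t\<^sup>2 * R\<^sup>2 \<le> 2 * ((R - A)\<^sup>2 + (R - B)\<^sup>2)" by auto
  qed
  have 3: "(R - B0)\<^sup>2 \<le> 11/10 * (R - B)\<^sup>2 + 11 * (b - b0)"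
  proof -
    have young: "(x + y)\<^sup>2 \<le> 11/10 * x\<^sup>2 + 11 * z" if "y\<^sup>2 \<le> z" for x y z :: real
    proof -
      have "11/10 * x\<^sup>2 + 11 * y\<^sup>2 = (x + y)\<^sup>2 + (x - 10 * y)\<^sup>2 / 10"
        by (simp add: power2_eq_square field_simps)
      moreover have "0 \<le> (x - 10 * y)\<^sup>2 / 10" by simp
      ultimately have "(x + y)\<^sup>2 \<le> 11/10 * x\<^sup>2 + 11 * y\<^sup>2" by argo
      then show ?thesis using that by argo
    qed
    have "(B - B0)\<^sup>2 \<le> b - b0" using sqrt_diff_sq_le[of b b0] b b0 by (simp add: B_def B0_def)
    then show ?thesis using young[of "B - B0" "b - b0" "R - B"] by simp
  qed
  have "r * (t + 1/25 * t\<^sup>2) = t * R\<^sup>2 + 1/25 * (t\<^sup>2 * R\<^sup>2)" using nn by (simp add: algebra_simps)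
  also have "\<dots> \<le> 52/25 * (R - A)\<^sup>2 - 43/400 * (R - B)\<^sup>2 + (b - a) / 4"
  proof -
    have lin: "x + 1/25 * y \<le> 52/25 * u - 43/400 * v + w" if "x \<le> 2 * u - 3/16 * v + w" "y \<le> 2 * (u + v)"
      for x y u v w :: real using that by simp
    show ?thesis using lin[OF 1 2] by (simp only: nn(6,7))
  qed
  also have "\<dots> \<le> 52/25 * (R - A)\<^sup>2 - 39/400 * (R - B0)\<^sup>2 + (b - a) / 4 + 43/40 * (b - b0)"
  proof -
    have lin: "x - 43/400 * v + w \<le> x - 39/400 * u + w + 43/40 * z" if "u \<le> 11/10 * v + 11 * z" "0 \<le> v" "0 \<le> z"
      for x u v w z :: real using that by simp
    have "0 \<le> b - b0" using b0 by simp
    from lin[OF 3 zero_le_power2 this] show ?thesis .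
  qed
  finally show ?thesis by (simp add: R_def A_def B0_def)
qed

text \<open>The pointwise inequality is integrated against \<open>\<nu> = \<mu> + R\<close>. With \<open>m\<close> the density of \<open>\<mu>\<close> with
  respect to \<open>\<nu>\<close>, the densities of the candidates are \<open>m * q0\<close> and \<open>m * q\<close>, and \<open>rho\<close> is
  invariant under the common factor \<open>m\<close>. A relation that holds almost everywhere for \<open>\<mu>\<close> may fail
  for \<open>R\<close> only where \<open>m = 0\<close>; there both densities vanish and the value of the test is free.\<close>

lemma expected_test_le:
  fixes \<mu> R :: "'a measure" and f q q0 qe :: "'a \<Rightarrow> real"
  assumes mu: "sigma_finite_measure \<mu>" and R: "prob_space R" "sets R = sets \<mu>"
    and q0: "prob_density \<mu> q0" and q: "prob_density \<mu> q"
    and qe: "integrable \<mu> qe" "\<And>x. x \<in> space \<mu> \<Longrightarrow> 0 \<le> qe x" "(\<integral>x. qe x \<partial>\<mu>) \<le> 1 + s"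
    and le: "AE x in \<mu>. q x \<le> qe x"
    and f: "f \<in> borel_measurable \<mu>" "\<And>x. x \<in> space \<mu> \<Longrightarrow> \<bar>f x\<bar> \<le> 1"
    and feq: "AE x in \<mu>. f x = rho (q0 x) (qe x)"
  shows "(\<integral>x. f x + 1/25 * (f x)\<^sup>2 \<partial>R)
     \<le> 4.16 * hellinger_sq R (dens_measure \<mu> q0) - 0.195 * hellinger_sq R (dens_measure \<mu> q) + 1.4 * s"
proof -
  define \<nu> where "\<nu> = sum_measure \<mu> R"
  have sp: "sets \<nu> = sets \<mu>" "space \<nu> = space \<mu>" by (simp_all add: \<nu>_def)
  have finR: "finite_measure R" using R(1) by (rule prob_space.finite_measure)
  have nu: "sigma_finite_measure \<nu>" unfolding \<nu>_def by (rule sigma_finite_sum_measure[OF mu finR R(2)])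
  have ac: "absolutely_continuous \<nu> \<mu>" "absolutely_continuous \<nu> R"
    using absolutely_continuous_sum_measure[OF R(2)] unfolding \<nu>_def by auto
  obtain r where r: "r \<in> borel_measurable \<nu>" "\<And>x. 0 \<le> (r x :: real)" "R = density \<nu> r"
    by (rule prob_space_absolutely_continuous_density[OF nu R(1) _ ac(2)]) (use R sp in auto)
  \<comment> \<open>\<open>enn2real\<close> maps an infinite density to \<open>0\<close>, but \<open>\<mu>\<close> is \<open>\<sigma>\<close>-finite, so this happens on a null set only.\<close>
  define m where "m = (\<lambda>x. enn2real (RN_deriv \<nu> \<mu> x))"
  have m: "m \<in> borel_measurable \<nu>" "\<And>x. 0 \<le> m x" by (auto simp: m_def)
  have mdens: "\<mu> = density \<nu> m"
  proof -
    have "AE x in \<nu>. RN_deriv \<nu> \<mu> x \<noteq> \<infinity>"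
      by (rule sigma_finite_measure.RN_deriv_finite[OF nu mu ac(1)]) (simp add: sp)
    then have "AE x in \<nu>. ennreal (m x) = RN_deriv \<nu> \<mu> x"
      by eventually_elim (simp add: m_def less_top)
    then have "density \<nu> (\<lambda>x. ennreal (m x)) = density \<nu> (RN_deriv \<nu> \<mu>)"
      using m by (intro density_cong) auto
    then show ?thesis using sigma_finite_measure.density_RN_deriv[OF nu ac(1)] sp by simp
  qed
  have meas: "borel_measurable \<nu> = borel_measurable \<mu>" by (intro measurable_cong_sets) (auto simp: sp)
  note qd = prob_densityD[OF q] and q0d = prob_densityD[OF q0]
  have [measurable]: "q \<in> borel_measurable \<nu>" "q0 \<in> borel_measurable \<nu>" "qe \<in> borel_measurable \<nu>"
    "f \<in> borel_measurable \<nu>" "m \<in> borel_measurable \<nu>" "r \<in> borel_measurable \<nu>"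
    using qd q0d qe(1) f m r by (auto simp: meas)
  have trans: "dens_measure \<mu> g = density \<nu> (\<lambda>x. m x * g x)"
    if [measurable]: "g \<in> borel_measurable \<nu>" for g
  proof -
    have "dens_measure \<mu> g = density (density \<nu> m) g" using mdens by (simp add: dens_measure_def)
    also have "\<dots> = density \<nu> (\<lambda>x. ennreal (m x) * ennreal (g x))" by (rule density_density_eq) auto
    also have "\<dots> = density \<nu> (\<lambda>x. m x * g x)"
      by (intro density_cong) (use m in \<open>auto simp: ennreal_mult'[symmetric]\<close>)
    finally show ?thesis .
  qed
  have int: "integrable \<nu> (\<lambda>x. m x * g x)" "(\<integral>x. m x * g x \<partial>\<nu>) = (\<integral>x. g x \<partial>\<mu>)"
    if g: "integrable \<mu> g" for g :: "'a \<Rightarrow> real"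
  proof -
    have [measurable]: "g \<in> borel_measurable \<nu>" using g by (auto simp: meas)
    have "integrable (density \<nu> m) g" using g mdens by simp
    then show "integrable \<nu> (\<lambda>x. m x * g x)" using m by (subst (asm) integrable_density) (auto intro!: AE_I2)
    have "(\<integral>x. g x \<partial>\<mu>) = (\<integral>x. g x \<partial>density \<nu> m)" using mdens by simp
    also have "\<dots> = (\<integral>x. m x * g x \<partial>\<nu>)" using m by (subst integral_density) (auto intro!: AE_I2)
    finally show "(\<integral>x. m x * g x \<partial>\<nu>) = (\<integral>x. g x \<partial>\<mu>)" by simp
  qed
  have ir: "integrable \<nu> r" using prob_density_integral[OF r(1,2) R(1)[unfolded r(3)]] by simp
  have nn: "0 \<le> m x * q x" "0 \<le> m x * q0 x" "0 \<le> m x * qe x" if "x \<in> space \<nu>" for x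
    using that m qd(2) q0d(2) qe(2) by (auto simp: sp)
  have hR: "hellinger_sq R (dens_measure \<mu> g) = (1/2) * (\<integral>x. (sqrt (r x) - sqrt (m x * g x))\<^sup>2 \<partial>\<nu>)"
    if g: "prob_density \<mu> g" for g
  proof -
    note gd = prob_densityD[OF g]
    have [measurable]: "g \<in> borel_measurable \<nu>" using gd by (auto simp: meas)
    have pg: "prob_space (density \<nu> (\<lambda>x. m x * g x))" using gd(6) trans[of g] by simp
    have pr: "prob_space (density \<nu> r)" using R(1) r(3) by simp
    have "hellinger_sq (density \<nu> r) (density \<nu> (\<lambda>x. m x * g x))
       = (1/2) * (\<integral>x. (sqrt (r x) - sqrt (m x * g x))\<^sup>2 \<partial>\<nu>)"
      by (rule hellinger_sq_density[OF nu _ _ _ _ pr pg]) (use r gd(2) m sp in auto)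
    then show ?thesis using trans[of g] r(3) by simp
  qed
  have "AE x in density \<nu> m. q x \<le> qe x \<and> f x = rho (q0 x) (qe x)" using le feq mdens by auto
  then have AE: "AE x in \<nu>. 0 < m x \<longrightarrow> q x \<le> qe x \<and> f x = rho (q0 x) (qe x)"
    by (subst (asm) AE_density) auto
  let ?H = "\<lambda>x. 52/25 * (sqrt (r x) - sqrt (m x * q0 x))\<^sup>2 - 39/400 * (sqrt (r x) - sqrt (m x * q x))\<^sup>2
           + (m x * qe x - m x * q0 x) / 4 + 43/40 * (m x * qe x - m x * q x)"
  have i1: "integrable \<nu> (\<lambda>x. (sqrt (r x) - sqrt (m x * q0 x))\<^sup>2)"
    "integrable \<nu> (\<lambda>x. (sqrt (r x) - sqrt (m x * q x))\<^sup>2)"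
    using ir int(1)[OF qd(4)] int(1)[OF q0d(4)] nn r(2) by (auto intro!: integrable_sqrt_diff_sq)
  note i2 = int(1)[OF qd(4)] int(1)[OF q0d(4)] int(1)[OF qe(1)]
  have "(\<integral>x. f x + 1/25 * (f x)\<^sup>2 \<partial>R) = (\<integral>x. r x * (f x + 1/25 * (f x)\<^sup>2) \<partial>\<nu>)"
    unfolding r(3) using r(2) by (subst integral_density) (auto intro!: AE_I2 simp: r(3)[symmetric])
  also have "\<dots> \<le> (\<integral>x. ?H x \<partial>\<nu>)"
  proof (rule integral_mono_AE)
    show "integrable \<nu> (\<lambda>x. r x * (f x + 1/25 * (f x)\<^sup>2))"
    proof (rule Bochner_Integration.integrable_bound)
      show "integrable \<nu> (\<lambda>x. 2 * r x)" using ir by simp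
      show "AE x in \<nu>. norm (r x * (f x + 1/25 * (f x)\<^sup>2)) \<le> norm (2 * r x)"
      proof (rule AE_I2)
        fix x assume "x \<in> space \<nu>"
        then have fb: "\<bar>f x\<bar> \<le> 1" using f sp by auto
        then have "(f x)\<^sup>2 \<le> 1" by (simp add: abs_square_le_1)
        then have "\<bar>f x + 1/25 * (f x)\<^sup>2\<bar> \<le> 2" using fb zero_le_power2[of "f x"] by linarith
        then have "r x * \<bar>f x + 1/25 * (f x)\<^sup>2\<bar> \<le> r x * 2" using r(2) by (intro mult_left_mono) auto
        then show "norm (r x * (f x + 1/25 * (f x)\<^sup>2)) \<le> norm (2 * r x)" using r(2)[of x] by (simp add: abs_mult)
      qed
    qed measurable
    show "integrable \<nu> ?H" using i1 i2 by (intro Bochner_Integration.integrable_add Bochner_Integration.integrable_diff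
       integrable_mult_right integrable_divide_zero) auto
    show "AE x in \<nu>. r x * (f x + 1/25 * (f x)\<^sup>2) \<le> ?H x"
      using AE AE_space
    proof eventually_elim
      case (elim x)
      then have xs: "x \<in> space \<mu>" by (simp add: sp)
      show ?case
      proof (cases "m x = 0")
        case True
        then show ?thesis using test_pointwise_ineq[of "r x" 0 0 0 "f x"] r(2)[of x] f(2)[of x] elim sp by simp
      next
        case False
        then have mx: "0 < m x" using m(2)[of x] by simp
        then have sm: "sqrt (m x) > 0" by simp
        have "rho (m x * q0 x) (m x * qe x) = rho (q0 x) (qe x)"
        proof -
          have "rho (m x * q0 x) (m x * qe x) = (sqrt (m x) * (sqrt (qe x) - sqrt (q0 x))) / (sqrt (m x) * (sqrt (qe x) + sqrt (q0 x)))"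
            by (simp add: rho_def real_sqrt_mult algebra_simps)
          then show ?thesis using sm by (simp add: rho_def)
        qed
        then show ?thesis using mx elim r(2)[of x] nn[of x] f(2)[OF xs] by (intro test_pointwise_ineq) auto
      qed
    qed
  qed
  also have "\<dots> = 52/25 * (\<integral>x. (sqrt (r x) - sqrt (m x * q0 x))\<^sup>2 \<partial>\<nu>) - 39/400 * (\<integral>x. (sqrt (r x) - sqrt (m x * q x))\<^sup>2 \<partial>\<nu>)
      + ((\<integral>x. qe x \<partial>\<mu>) - 1) / 4 + 43/40 * ((\<integral>x. qe x \<partial>\<mu>) - 1)"
    using i1 i2 int(2)[OF qd(4)] int(2)[OF q0d(4)] int(2)[OF qe(1)] qd(5) q0d(5) by simp
  also have "\<dots> \<le> 4.16 * hellinger_sq R (dens_measure \<mu> q0) - 0.195 * hellinger_sq R (dens_measure \<mu> q) + 1.4 * s"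
  proof -
    have "1 \<le> (\<integral>x. qe x \<partial>\<mu>)"
      using integral_mono_AE[OF qd(4) qe(1) le] qd(5) by simp
    then show ?thesis using hR[OF q] hR[OF q0] qe(3) by (simp add: field_simps)
  qed
  finally show ?thesis .
qed

section \<open>Finite coverings of mixture classes\<close>

text \<open>Weights are rounded upwards. As \<open>rho a\<close> is increasing this only enlarges the test
  function of a mixture, at the price of a total mass slightly above \<open>1\<close>; in particular tiny
  weights are lifted to \<open>\<tau>\<close>, so that no class \<open>{w * f}\<close> with \<open>w\<close> arbitrarily close to \<open>0\<close>, which
  may have infinite VC-index, has to be covered.\<close>

definition weight_grid :: "real \<Rightarrow> real set" where
  "weight_grid \<tau> = (\<lambda>j. \<tau> * (real j + 1)) ` {..nat \<lfloor>1 / \<tau>\<rfloor>}"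

definition round_up :: "real \<Rightarrow> real \<Rightarrow> real" where
  "round_up \<tau> w = \<tau> * (real (nat \<lfloor>w / \<tau>\<rfloor>) + 1)"

lemma round_up:
  assumes "0 < \<tau>" "0 \<le> w" "w \<le> 1"
  shows "round_up \<tau> w \<in> weight_grid \<tau>" "w \<le> round_up \<tau> w" "round_up \<tau> w \<le> w + \<tau>"
proof -
  have q: "0 \<le> w / \<tau>" "w / \<tau> \<le> 1 / \<tau>" using assms by (auto intro: divide_right_mono)
  then have "nat \<lfloor>w / \<tau>\<rfloor> \<le> nat \<lfloor>1 / \<tau>\<rfloor>" by (intro nat_mono floor_mono)
  then show "round_up \<tau> w \<in> weight_grid \<tau>" by (auto simp: round_up_def weight_grid_def)
  have "0 \<le> \<lfloor>w / \<tau>\<rfloor>" using q by simp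
  then have e: "real (nat \<lfloor>w / \<tau>\<rfloor>) = of_int \<lfloor>w / \<tau>\<rfloor>" by (rule of_nat_nat)
  have a: "w / \<tau> \<le> real (nat \<lfloor>w / \<tau>\<rfloor>) + 1" and b: "real (nat \<lfloor>w / \<tau>\<rfloor>) \<le> w / \<tau>"
    unfolding e by linarith+
  have "w = \<tau> * (w / \<tau>)" using assms by simp
  also have "\<dots> \<le> round_up \<tau> w" unfolding round_up_def using a assms by (intro mult_left_mono) auto
  finally show "w \<le> round_up \<tau> w" .
  have "round_up \<tau> w \<le> \<tau> * (w / \<tau> + 1)" unfolding round_up_def using b assms by (intro mult_left_mono) auto
  also have "\<dots> = w + \<tau>" using assms by (simp add: distrib_left)
  finally show "round_up \<tau> w \<le> w + \<tau>" .
qed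

lemma weight_grid:
  assumes "0 < \<tau>" "\<tau> \<le> 1"
  shows "finite (weight_grid \<tau>)" "real (card (weight_grid \<tau>)) \<le> 2 / \<tau>" "w \<in> weight_grid \<tau> \<Longrightarrow> 0 < w"
proof -
  show "finite (weight_grid \<tau>)" by (simp add: weight_grid_def)
  have "card (weight_grid \<tau>) \<le> card {..nat \<lfloor>1 / \<tau>\<rfloor>}" unfolding weight_grid_def by (rule card_image_le) simp
  then have "real (card (weight_grid \<tau>)) \<le> real (nat \<lfloor>1 / \<tau>\<rfloor>) + 1" by simp
  moreover have "real (nat \<lfloor>1 / \<tau>\<rfloor>) \<le> 1 / \<tau>" "1 \<le> 1 / \<tau>" "2 / \<tau> = 1 / \<tau> + 1 / \<tau>"
    using assms by simp_all
  ultimately show "real (card (weight_grid \<tau>)) \<le> 2 / \<tau>" by linarith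
  show "w \<in> weight_grid \<tau> \<Longrightarrow> 0 < w" using assms by (auto simp: weight_grid_def)
qed

text \<open>Two mixtures with the same grid weights are close on \<open>X\<close> as soon as each pair of
  corresponding components compares in the same way with \<open>m\<close> levels above every point of \<open>X\<close>,
  that is, has the same trace on a set of \<open>m * |X|\<close> points of the product space; the traces are
  counted by the Sauer--Shelah bound.\<close>

lemma mixture_cover:
  fixes \<mu> :: "'a measure" and Fb :: "nat \<Rightarrow> ('a \<Rightarrow> real) set" and W :: "'q \<Rightarrow> nat \<Rightarrow> real"
    and Fn :: "'q \<Rightarrow> nat \<Rightarrow> 'a \<Rightarrow> real" and x0 :: real
  assumes S: "finite S" and ns: "\<And>k. k \<in> S \<Longrightarrow> no_shattered \<mu> (Fb k) (V k)"
    and f0: "\<And>k f x. k \<in> S \<Longrightarrow> f \<in> Fb k \<Longrightarrow> x \<in> space \<mu> \<Longrightarrow> 0 \<le> f x"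
    and q0: "\<And>x. x \<in> space \<mu> \<Longrightarrow> 0 \<le> q0 x"
    and G: "finite G" "\<And>w. w \<in> G \<Longrightarrow> 0 < w"
    and W: "\<And>q k. q \<in> A \<Longrightarrow> k \<in> S \<Longrightarrow> W q k \<in> G"
    and Fn: "\<And>q k. q \<in> A \<Longrightarrow> k \<in> S \<Longrightarrow> Fn q k \<in> Fb k"
    and m: "m \<ge> 1" and x0: "0 < x0" "x0 \<le> 1"
    and X: "finite X" "X \<subseteq> space \<mu>" "card X \<le> L"
  shows "\<exists>C\<subseteq>A. finite C \<and>
     real (card C) \<le> (\<Prod>k\<in>S. real (card G) * ((1 / x0) ^ V k * exp (x0 * (real L * real m)))) \<and>
     (\<forall>q\<in>A. \<exists>q'\<in>C. \<forall>x\<in>X. \<bar>(if x \<in> N0 then 1 else rho (q0 x) (\<Sum>k\<in>S. W q k * Fn q k x))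
          - (if x \<in> N0 then 1 else rho (q0 x) (\<Sum>k\<in>S. W q' k * Fn q' k x))\<bar> \<le> real (card S) * (2 / real m))"
proof -
  define P where "P = (\<lambda>w. (\<lambda>(x, j). (x, q0 x * (real j / real (m - j))\<^sup>2 / w)) ` (X \<times> {..<m}))"
  define cell where "cell = (\<lambda>q. \<lambda>k\<in>S. (W q k, subgraph \<mu> (Fn q k) \<inter> P (W q k)))"
  define D where "D = (\<Pi>\<^sub>E k\<in>S. SIGMA w:G. (\<lambda>f. subgraph \<mu> f \<inter> P w) ` Fb k)"
  have P: "finite (P w)" "P w \<subseteq> space \<mu> \<times> UNIV" "card (P w) \<le> L * m" for w
  proof -
    show "finite (P w)" "P w \<subseteq> space \<mu> \<times> UNIV" using X by (auto simp: P_def)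
    have "card (P w) \<le> card (X \<times> {..<m})" unfolding P_def using X by (intro card_image_le) simp
    also have "\<dots> \<le> L * m" using X by (simp add: card_cartesian_product)
    finally show "card (P w) \<le> L * m" .
  qed
  have fin1: "finite ((\<lambda>f. subgraph \<mu> f \<inter> P w) ` Fb k)" for w k
    by (rule finite_subset[of _ "Pow (P w)"]) (use P(1) in auto)
  have finD: "finite D" unfolding D_def using S G fin1 by (intro finite_PiE finite_SigmaI) auto
  have cellD: "cell ` A \<subseteq> D" using W Fn by (auto simp: cell_def D_def)
  have cardD: "real (card D) \<le> (\<Prod>k\<in>S. real (card G) * ((1 / x0) ^ V k * exp (x0 * (real L * real m))))"
  proof -
    have "real (card D) = (\<Prod>k\<in>S. real (card (SIGMA w:G. (\<lambda>f. subgraph \<mu> f \<inter> P w) ` Fb k)))"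
      unfolding D_def using S by (simp add: card_PiE)
    also have "\<dots> \<le> (\<Prod>k\<in>S. real (card G) * ((1 / x0) ^ V k * exp (x0 * (real L * real m))))"
    proof (intro prod_mono conjI)
      fix k assume k: "k \<in> S"
      have "real (card (SIGMA w:G. (\<lambda>f. subgraph \<mu> f \<inter> P w) ` Fb k))
        = (\<Sum>w\<in>G. real (card ((\<lambda>f. subgraph \<mu> f \<inter> P w) ` Fb k)))"
        using G fin1 by (simp add: card_SigmaI)
      also have "\<dots> \<le> (\<Sum>w\<in>G. (1 / x0) ^ V k * exp (x0 * (real L * real m)))"
      proof (intro sum_mono)
        fix w
        have "real (card ((\<lambda>f. subgraph \<mu> f \<inter> P w) ` Fb k)) \<le> (1 / x0) ^ V k * exp (x0 * real (card (P w)))"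
          by (rule card_traces_le[OF ns[OF k] P(1,2) x0])
        also have "\<dots> \<le> (1 / x0) ^ V k * exp (x0 * (real L * real m))"
        proof (intro mult_left_mono)
          have "real (card (P w)) \<le> real (L * m)" using P(3)[of w] by (simp only: of_nat_le_iff)
          then have "x0 * real (card (P w)) \<le> x0 * (real L * real m)"
            using x0 by (intro mult_left_mono) auto
          then show "exp (x0 * real (card (P w))) \<le> exp (x0 * (real L * real m))" by simp
        qed (use x0 in auto)
        finally show "real (card ((\<lambda>f. subgraph \<mu> f \<inter> P w) ` Fb k)) \<le> (1 / x0) ^ V k * exp (x0 * (real L * real m))" .
      qed
      also have "\<dots> = real (card G) * ((1 / x0) ^ V k * exp (x0 * (real L * real m)))" by simp
      finally show "real (card (SIGMA w:G. (\<lambda>f. subgraph \<mu> f \<inter> P w) ` Fb k)) \<le> \<dots>" .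
    qed simp
    finally show ?thesis .
  qed
  define C where "C = (\<lambda>d. SOME q. q \<in> A \<and> cell q = d) ` cell ` A"
  have rep: "(SOME q'. q' \<in> A \<and> cell q' = cell q) \<in> A \<and> cell (SOME q'. q' \<in> A \<and> cell q' = cell q) = cell q"
    if "q \<in> A" for q
    using that by (intro someI_ex[of "\<lambda>q'. q' \<in> A \<and> cell q' = cell q"]) blast
  have CA: "C \<subseteq> A" unfolding C_def using rep by auto
  have fincell: "finite (cell ` A)" using finD cellD by (rule finite_subset[rotated])
  have "finite C" unfolding C_def using fincell by simp
  have "card C \<le> card (cell ` A)" unfolding C_def using fincell by (rule card_image_le)
  also have "\<dots> \<le> card D" using finD cellD by (rule card_mono)
  finally have cardC: "real (card C) \<le> real (card D)" by simp
  show ?thesis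
  proof (intro exI conjI ballI)
    show "C \<subseteq> A" "finite C" by fact+
    show "real (card C) \<le> (\<Prod>k\<in>S. real (card G) * ((1 / x0) ^ V k * exp (x0 * (real L * real m))))"
      using cardC cardD by linarith
    fix q assume q: "q \<in> A"
    define q' where "q' = (SOME q'. q' \<in> A \<and> cell q' = cell q)"
    have q': "q' \<in> C" "q' \<in> A" "cell q' = cell q"
    proof -
      show "q' \<in> A" "cell q' = cell q"
        using rep[OF q] unfolding q'_def by (rule conjunct1, rule conjunct2)
      show "q' \<in> C" unfolding C_def q'_def by (rule image_eqI[of _ _ "cell q"], rule refl, rule imageI, rule q)
    qed
    have "\<bar>(if x \<in> N0 then 1 else rho (q0 x) (\<Sum>k\<in>S. W q k * Fn q k x))
          - (if x \<in> N0 then 1 else rho (q0 x) (\<Sum>k\<in>S. W q' k * Fn q' k x))\<bar> \<le> real (card S) * (2 / real m)"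
      if x: "x \<in> X" for x
    proof (cases "x \<in> N0")
      case False
      have xs: "x \<in> space \<mu>" using x X by auto
      have each: "\<bar>rho (q0 x) (W q k * Fn q k x) - rho (q0 x) (W q' k * Fn q' k x)\<bar> \<le> 2 / real m"
        and nn: "0 \<le> W q k * Fn q k x" "0 \<le> W q' k * Fn q' k x" if k: "k \<in> S" for k
      proof -
        have "cell q' k = cell q k" using q'(3) by (rule fun_cong)
        then have pair: "(W q' k, subgraph \<mu> (Fn q' k) \<inter> P (W q' k)) = (W q k, subgraph \<mu> (Fn q k) \<inter> P (W q k))"
          unfolding cell_def restrict_apply'[OF k] .
        from pair have w: "W q' k = W q k" by (rule Pair_inject)
        from pair have tr: "subgraph \<mu> (Fn q' k) \<inter> P (W q k) = subgraph \<mu> (Fn q k) \<inter> P (W q k)"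
          unfolding w by (rule Pair_inject)
        have wp: "0 < W q k" using G W[OF q k] by auto
        have fn: "0 \<le> Fn q k x" "0 \<le> Fn q' k x" using f0[OF k] Fn[OF q k] Fn[OF q'(2) k] xs by auto
        then show nn: "0 \<le> W q k * Fn q k x" "0 \<le> W q' k * Fn q' k x" using w wp by auto
        show "\<bar>rho (q0 x) (W q k * Fn q k x) - rho (q0 x) (W q' k * Fn q' k x)\<bar> \<le> 2 / real m"
        proof (rule rho_close_of_same_levels[OF q0[OF xs] nn m])
          fix j assume j: "j < m"
          let ?s = "q0 x * (real j / real (m - j))\<^sup>2"
          have "(x, ?s / W q k) \<in> P (W q k)" using x j unfolding P_def by force
          then have "(x, ?s / W q k) \<in> subgraph \<mu> (Fn q k) \<longleftrightarrow> (x, ?s / W q k) \<in> subgraph \<mu> (Fn q' k)"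
            using tr by blast
          then have "?s / W q k < Fn q k x \<longleftrightarrow> ?s / W q k < Fn q' k x" using xs by (simp add: subgraph_def)
          then show "?s < W q k * Fn q k x \<longleftrightarrow> ?s < W q' k * Fn q' k x"
            using wp w by (simp add: pos_divide_less_eq mult.commute)
        qed
      qed
      have "\<bar>rho (q0 x) (\<Sum>k\<in>S. W q k * Fn q k x) - rho (q0 x) (\<Sum>k\<in>S. W q' k * Fn q' k x)\<bar>
        \<le> (\<Sum>k\<in>S. \<bar>rho (q0 x) (W q k * Fn q k x) - rho (q0 x) (W q' k * Fn q' k x)\<bar>)"
        using S q0[OF xs] nn by (intro rho_sum_dist) auto
      also have "\<dots> \<le> (\<Sum>k\<in>S. 2 / real m)" using each by (intro sum_mono)
      finally show ?thesis using False by simp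
    qed simp
    then show "\<exists>q'\<in>C. \<forall>x\<in>X. \<bar>(if x \<in> N0 then 1 else rho (q0 x) (\<Sum>k\<in>S. W q k * Fn q k x))
          - (if x \<in> N0 then 1 else rho (q0 x) (\<Sum>k\<in>S. W q' k * Fn q' k x))\<bar> \<le> real (card S) * (2 / real m)"
      using q'(1) by blast
  qed
qed

text \<open>The free parameter of the Sauer--Shelah bound is taken as \<open>(V / (2 K n))\<^sup>2\<close>, the mesh of the
  weights as \<open>V / (n K)\<close>, and the number of levels as \<open>\<lceil>K n / V\<rceil>\<close>: then every contribution to the
  logarithm of the covering number is of order \<open>V * (1 + ln K + ln (n / V))\<close>.\<close>

lemma cover_count_le:
  fixes K n Vt :: nat and V :: "nat \<Rightarrow> nat" and c :: real
  assumes K: "1 \<le> K" "K \<le> Vt" and n: "Vt \<le> n" and V: "(\<Sum>k=1..K. V k) = Vt"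
    and m: "m = nat \<lceil>K * n / Vt\<rceil>" and c: "c = 3 * (ln K + ln (n / Vt)) + 4"
    and g: "0 \<le> g" "g \<le> 2 * (n * K / Vt)"
  shows "(\<Prod>k=1..K. g * ((1 / (Vt / (2 * K * n))\<^sup>2) ^ V k * exp ((Vt / (2 * K * n))\<^sup>2 * (real (2 * n) * real m))))
     \<le> exp (Vt * c)"
proof -
  define y where "y = real n / Vt"
  define z where "z = K * y"
  have pos: "0 < real K" "0 < real Vt" "0 < real n" using assms by auto
  have y1: "1 \<le> y" using n pos by (simp add: y_def)
  have z: "K * n / Vt = z" by (simp add: y_def z_def)
  have z1: "1 \<le> z" using mult_mono[of 1 "real K" 1 y] K y1 by (simp add: z_def)
  have m2: "real m \<le> 2 * z" using z1 unfolding m z by linarith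
  define x0 where "x0 = (Vt / (2 * K * n))\<^sup>2"
  have x0: "1 / x0 = 4 * z\<^sup>2" "x0 = 1 / (4 * z\<^sup>2)" using pos
    by (simp_all add: x0_def y_def z_def power_divide power_mult_distrib)
  have "x0 * (real (2 * n) * real m) \<le> x0 * (real (2 * n) * (2 * z))"
    using m2 by (intro mult_left_mono) (auto simp: x0_def)
  also have "\<dots> = Vt / K" using pos unfolding x0 y_def z_def by (simp add: power2_eq_square field_simps)
  finally have e1: "exp (x0 * (real (2 * n) * real m)) \<le> exp (Vt / K)" by simp
  have x0pos: "0 \<le> x0" by (simp add: x0_def)
  have g2: "g \<le> 2 * z" using g by (simp add: y_def z_def mult.commute)
  have P: "(\<Prod>k=1..K. (1 / x0) ^ V k) = (1 / x0) ^ Vt" by (simp only: power_sum[symmetric] V)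
  have E: "exp (Vt / K) ^ K = exp Vt" using pos by (simp add: exp_of_nat_mult[symmetric])
  have "(\<Prod>k=1..K. g * ((1 / x0) ^ V k * exp (x0 * (real (2 * n) * real m))))
      \<le> (\<Prod>k=1..K. (2 * z) * ((1 / x0) ^ V k * exp (Vt / K)))"
    using g(1) g2 e1 x0pos z1 by (intro prod_mono conjI mult_mono mult_left_mono) auto
  also have "\<dots> = (2 * z) ^ K * ((1 / x0) ^ Vt * exp Vt)"
    by (simp only: prod.distrib prod_constant P card_atLeastAtMost diff_Suc_1 E power_mult_distrib)
  also have "\<dots> \<le> (2 * z) ^ Vt * ((1 / x0) ^ Vt * exp Vt)"
    using z1 K x0pos by (intro mult_right_mono power_increasing) auto
  also have "\<dots> = (2 * z * (4 * z\<^sup>2)) ^ Vt * exp Vt"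
    unfolding x0(1) by (simp only: power_mult_distrib mult_ac)
  also have "\<dots> \<le> exp (c - 1) ^ Vt * exp Vt"
  proof (intro mult_right_mono power_mono)
    have "c - 1 = 3 + 3 * (ln K + ln y)" by (simp add: c y_def)
    also have "\<dots> = 3 * 1 + 3 * ln z" using pos y1 by (simp add: ln_mult z_def)
    finally have "exp (c - 1) = exp 1 ^ 3 * exp (ln z) ^ 3"
      by (simp only: exp_add exp_of_nat_mult[of 3, simplified])
    then have "exp (c - 1) = exp 1 ^ 3 * z ^ 3" using z1 by simp
    moreover have "(8::real) \<le> exp 1 ^ 3" using exp_ge_add_one_self[of 1] power_mono[of 2 "exp 1 :: real" 3] by simp
    ultimately have "8 * z ^ 3 \<le> exp (c - 1)" using z1 by (simp add: mult_right_mono)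
    then show "2 * z * (4 * z\<^sup>2) \<le> exp (c - 1)" by (simp add: power2_eq_square power3_eq_cube)
  qed (use z1 in auto)
  also have "exp (c - 1) ^ Vt * exp Vt = exp (Vt * c)"
    by (simp add: exp_of_nat_mult[symmetric] exp_add[symmetric] algebra_simps)
  finally show ?thesis unfolding x0_def .
qed

section \<open>Uniform deviations over the models\<close>

lemma emeasure_UN_le_nn_integral:
  assumes "countable T" "\<And>t. t \<in> T \<Longrightarrow> B t \<in> sets M"
  shows "emeasure M (\<Union>t\<in>T. B t) \<le> (\<integral>\<^sup>+t. emeasure M (B t) \<partial>count_space T)"
proof -
  have B: "(\<Union>t\<in>T. B t) \<in> sets M" using assms by (rule sets.countable_UN'')
  have "emeasure M (\<Union>t\<in>T. B t) = (\<integral>\<^sup>+x. indicator (\<Union>t\<in>T. B t) x \<partial>M)" using B by simp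
  also have "\<dots> \<le> (\<integral>\<^sup>+x. (\<integral>\<^sup>+t. indicator (B t) x \<partial>count_space T) \<partial>M)"
  proof (intro nn_integral_mono)
    fix x
    show "indicator (\<Union>t\<in>T. B t) x \<le> (\<integral>\<^sup>+t. indicator (B t) x \<partial>count_space T)"
    proof (cases "x \<in> (\<Union>t\<in>T. B t)")
      case True
      then obtain t where t: "t \<in> T" "x \<in> B t" by blast
      then show ?thesis using nn_integral_ge_point[OF t(1), of "\<lambda>t. indicator (B t) x"] True by simp
    qed simp
  qed
  also have "\<dots> = (\<integral>\<^sup>+t. (\<integral>\<^sup>+x. indicator (B t) x \<partial>M) \<partial>count_space T)"
    using assms by (intro nn_integral_count_space_nn_integral) auto
  also have "\<dots> = (\<integral>\<^sup>+t. emeasure M (B t) \<partial>count_space T)"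
    using assms(2) by (intro nn_integral_cong) simp
  finally show ?thesis .
qed

lemma VC_index:
  assumes "VC_subgraph M \<F>"
  shows "no_shattered M \<F> (VC_index M \<F>)" "1 \<le> VC_index M \<F>"
  using assms LeastI_ex[of "\<lambda>m. m \<ge> 1 \<and> no_shattered M \<F> m"]
  by (auto simp: VC_subgraph_def VC_index_def)

lemma mix_model_mixture:
  assumes "Q \<in> mix_model \<mu> Fbar (K, l)"
  shows "\<exists>w f. w \<in> weights K \<and> (\<forall>k\<in>{1..K}. f k \<in> Fbar k (l k)) \<and> Q = mixture \<mu> K w (\<lambda>k. dens_measure \<mu> (f k))"
proof -
  from assms obtain w P where w: "w \<in> weights K" and P: "\<forall>k\<in>{1..K}. P k \<in> dens_measure \<mu> ` Fbar k (l k)"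
    and eq: "Q = mixture \<mu> K w P" by (auto simp: mix_model_def)
  from P have "\<forall>k\<in>{1..K}. \<exists>f. f \<in> Fbar k (l k) \<and> P k = dens_measure \<mu> f" by blast
  then obtain f where f: "\<And>k. k \<in> {1..K} \<Longrightarrow> f k \<in> Fbar k (l k)" "\<And>k. k \<in> {1..K} \<Longrightarrow> P k = dens_measure \<mu> (f k)"
    by metis
  have "mixture \<mu> K w P = mixture \<mu> K w (\<lambda>k. dens_measure \<mu> (f k))"
    unfolding mixture_def using f(2) by (intro arg_cong[where f="measure_of (space \<mu>) (sets \<mu>)"] ext sum.cong) auto
  then show ?thesis using w f(1) eq by blast
qed

lemma mix_model_density:
  assumes mu: "sigma_finite_measure \<mu>" and q: "prob_density \<mu> q"
    and Fb: "\<And>k f. k \<in> {1..K} \<Longrightarrow> f \<in> Fbar k (l k) \<Longrightarrow> prob_density \<mu> f"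
    and mem: "dens_measure \<mu> q \<in> mix_model \<mu> Fbar (K, l)"
  shows "\<exists>w f. w \<in> weights K \<and> (\<forall>k\<in>{1..K}. f k \<in> Fbar k (l k)) \<and> (AE x in \<mu>. q x = (\<Sum>k=1..K. w k * f k x))"
proof -
  obtain w f where w: "w \<in> weights K" and f: "\<And>k. k \<in> {1..K} \<Longrightarrow> f k \<in> Fbar k (l k)"
    and eq: "dens_measure \<mu> q = mixture \<mu> K w (\<lambda>k. dens_measure \<mu> (f k))"
    using mix_model_mixture[OF mem] by blast
  have fd: "prob_density \<mu> (f k)" if "k \<in> {1..K}" for k using Fb f that by blast
  have w0: "0 \<le> w k" if "k \<in> {1..K}" for k using w that by (auto simp: weights_def)
  note eq
  also have "mixture \<mu> K w (\<lambda>k. dens_measure \<mu> (f k)) = dens_measure \<mu> (\<lambda>x. \<Sum>k=1..K. w k * f k x)"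
    by (intro mixture_dens_measure w0 prob_densityD(1)[OF fd] prob_densityD(2)[OF fd])
  finally have "density \<mu> q = density \<mu> (\<lambda>x. \<Sum>k=1..K. w k * f k x)"
    by (simp add: dens_measure_def)
  moreover have [measurable]: "q \<in> borel_measurable \<mu>" by (rule prob_densityD(1)[OF q])
  moreover have [measurable]: "(\<lambda>x. \<Sum>k=1..K. w k * f k x) \<in> borel_measurable \<mu>"
    using prob_densityD(1)[OF fd] by measurable
  ultimately have "AE x in \<mu>. ennreal (q x) = ennreal (\<Sum>k=1..K. w k * f k x)"
    by (intro sigma_finite_measure.density_unique[OF mu]) auto
  then have "AE x in \<mu>. q x = (\<Sum>k=1..K. w k * f k x)"
    using AE_space
  proof eventually_elim
    case (elim x)
    have "0 \<le> (\<Sum>k=1..K. w k * f k x)"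
      using w0 prob_densityD(2)[OF fd elim(2)] by (intro sum_nonneg mult_nonneg_nonneg)
    then show ?case using elim(1) prob_densityD(2)[OF q elim(2)] by simp
  qed
  then show ?thesis using w f by blast
qed

lemma abs_T_stat_le:
  assumes "\<And>i. i \<in> {1..n} \<Longrightarrow> 0 \<le> q (x i)" "\<And>i. i \<in> {1..n} \<Longrightarrow> 0 \<le> q' (x i)"
  shows "\<bar>T_stat n x q q'\<bar> \<le> n"
proof -
  have "\<bar>T_stat n x q q'\<bar> \<le> (\<Sum>i=1..n. \<bar>psi (sqrt_ratio (q' (x i)) (q (x i)))\<bar>)"
    unfolding T_stat_def by (rule sum_abs)
  also have "\<dots> \<le> (\<Sum>i=1..n. 1)"
    using assms by (intro sum_mono) (auto simp: psi_sqrt_ratio rho_bounds)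
  finally show ?thesis by simp
qed

lemma hellinger_sq_prod_bounds:
  assumes "\<And>i. i \<in> {1..n} \<Longrightarrow> prob_space (P i)" "prob_space Q" "\<And>i. i \<in> {1..n} \<Longrightarrow> sets Q = sets (P i)"
  shows "0 \<le> hellinger_sq_prod n P (\<lambda>_. Q)" "hellinger_sq_prod n P (\<lambda>_. Q) \<le> n"
proof -
  show "0 \<le> hellinger_sq_prod n P (\<lambda>_. Q)"
    unfolding hellinger_sq_prod_def by (intro sum_nonneg hellinger_sq_nonneg)
  have "hellinger_sq_prod n P (\<lambda>_. Q) \<le> (\<Sum>i=1..n. 1)"
    unfolding hellinger_sq_prod_def using assms by (intro sum_mono hellinger_sq_le_1) auto
  then show "hellinger_sq_prod n P (\<lambda>_. Q) \<le> n" by simp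
qed

text \<open>The second bound says that the logarithm of the covering number is at most three times the
  complexity. The summand \<open>ln ((K + 1)\<^sup>2 / \<delta>)\<close> of the latter dominates \<open>ln K\<close> because \<open>\<delta> \<le> 1\<close>.\<close>

lemma complexity_bounds:
  assumes K: "1 \<le> K" and VK: "K \<le> VC_total \<mu> Fbar (K, l)" and \<delta>: "0 < \<delta> (K, l)" "\<delta> (K, l) \<le> 1"
  defines "V \<equiv> real (VC_total \<mu> Fbar (K, l))"
  shows "5.82 * V \<le> complexity n \<mu> Fbar \<delta> (K, l)"
    "V * (3 * (ln K + ln (n / V)) + 4) \<le> 3 * complexity n \<mu> Fbar \<delta> (K, l)"
proof -
  have V: "1 \<le> V" using K VK by (simp add: V_def)
  have "real K * 1 \<le> (real K + 1) * (real K + 1)" using K by (intro mult_mono) auto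
  then have "real K * \<delta> (K, l) \<le> (real K + 1)\<^sup>2"
    using mult_left_mono[OF \<delta>(2), of "real K"] by (simp add: power2_eq_square)
  then have "real K \<le> (real K + 1)\<^sup>2 / \<delta> (K, l)" using \<delta> by (simp add: le_divide_eq)
  then have lnK: "ln K \<le> ln ((real K + 1)\<^sup>2 / \<delta> (K, l))" using K by (subst ln_le_cancel_iff) auto
  have lnK0: "0 \<le> ln (real K)" using K by simp
  have lp: "ln (n / V) \<le> log_plus (n / V)" "0 \<le> log_plus (n / V)" by (auto simp: log_plus_def)
  have c: "complexity n \<mu> Fbar \<delta> (K, l) = V * (5.82 + ln ((real K + 1)\<^sup>2 / \<delta> (K, l)) + log_plus (n / V))"
    by (simp add: complexity_def V_def Let_def)
  have "V * 5.82 \<le> V * (5.82 + ln ((real K + 1)\<^sup>2 / \<delta> (K, l)) + log_plus (n / V))"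
    using lnK lnK0 lp V by (intro mult_left_mono) auto
  then show "5.82 * V \<le> complexity n \<mu> Fbar \<delta> (K, l)" by (simp only: c mult.commute)
  have "V * (3 * (ln K + ln (n / V)) + 4) \<le> V * (3 * (5.82 + ln ((real K + 1)\<^sup>2 / \<delta> (K, l)) + log_plus (n / V)))"
    using lnK lp V by (intro mult_left_mono) auto
  then show "V * (3 * (ln K + ln (n / V)) + 4) \<le> 3 * complexity n \<mu> Fbar \<delta> (K, l)"
    by (simp only: c mult.left_commute)
qed

text \<open>The exponential inequality for one index \<open>(K, l)\<close> with \<open>V \<le> n\<close>. The test function of \<open>q\<close> uses
  the rounded weights, with mesh \<open>V / (n K)\<close> so that the mass in excess is at most \<open>V / n\<close>; on the
  null set \<open>N0\<close>, where \<open>q\<close> need not be the mixture, it is set to its largest possible value.\<close>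

lemma exp_moment_of_model:
  fixes \<mu> :: "'a measure" and P :: "nat \<Rightarrow> 'a measure" and W :: "('a \<Rightarrow> real) \<Rightarrow> nat \<Rightarrow> real"
  assumes mu: "sigma_finite_measure \<mu>"
    and P: "\<And>i. i \<in> {1..n} \<Longrightarrow> prob_space (P i)" "\<And>i. i \<in> {1..n} \<Longrightarrow> sets (P i) = sets \<mu>"
    and K: "1 \<le> K" and Fd: "\<And>k f. k \<in> {1..K} \<Longrightarrow> f \<in> Fbar k (l k) \<Longrightarrow> prob_density \<mu> f"
    and VC: "\<And>k. k \<in> {1..K} \<Longrightarrow> VC_subgraph \<mu> (Fbar k (l k))"
    and V: "V = VC_total \<mu> Fbar (K, l)" "V \<le> n"
    and q0: "prob_density \<mu> q0" and A: "countable A"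
    and W: "\<And>q. q \<in> A \<Longrightarrow> W q \<in> weights K"
    and Fn: "\<And>q k. q \<in> A \<Longrightarrow> k \<in> {1..K} \<Longrightarrow> Fn q k \<in> Fbar k (l k)"
    and N0: "N0 \<in> sets \<mu>"
  defines "qe \<equiv> \<lambda>q x. \<Sum>k=1..K. round_up (V / (n * K)) (W q k) * Fn q k x"
  defines "t \<equiv> \<lambda>q x. if x \<in> N0 then 1 else rho (q0 x) (qe q x)"
  shows "\<forall>q\<in>A. integrable \<mu> (qe q) \<and> (\<integral>x. qe q x \<partial>\<mu>) \<le> 1 + V / n \<and> t q \<in> borel_measurable \<mu> \<and>
      (\<forall>x\<in>space \<mu>. 0 \<le> qe q x \<and> (\<Sum>k=1..K. W q k * Fn q k x) \<le> qe q x \<and> \<bar>t q x\<bar> \<le> 1)"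
    "(\<integral>\<^sup>+x. (SUP q\<in>A. ennreal (exp (1/250 * ((\<Sum>i\<in>{1..n}. t q (x i))
        - (\<Sum>i\<in>{1..n}. \<integral>y. t q y + 1/25 * (t q y)\<^sup>2 \<partial>P i))))) \<partial>(\<Pi>\<^sub>M i\<in>{1..n}. P i))
      \<le> ennreal (exp (V * (3 * (ln K + ln (n / V)) + 4)) * exp (6/250 * V))"
proof -
  define \<tau> where "\<tau> = V / (n * K)"
  have ix: "1 \<le> VC_index \<mu> (Fbar k (l k))" if "k \<in> {1..K}" for k using VC_index(2)[OF VC[OF that]] .
  have Vsum: "V = (\<Sum>k=1..K. VC_index \<mu> (Fbar k (l k)))" by (simp add: V VC_total_def)
  have KV: "K \<le> V" using sum_mono[of "{1..K}" "\<lambda>_. 1" "\<lambda>k. VC_index \<mu> (Fbar k (l k))"] ix by (simp add: Vsum)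
  have pos: "0 < real K" "0 < real V" "0 < real n" using K KV V by auto
  have tau: "0 < \<tau>" "\<tau> \<le> 1" "K * \<tau> = V / n" "2 / \<tau> = 2 * (n * K / V)"
  proof -
    show "0 < \<tau>" using pos by (simp add: \<tau>_def)
    have "real V * 1 \<le> real n * real K" using V K by (intro mult_mono) auto
    then show "\<tau> \<le> 1" using pos by (simp add: \<tau>_def)
    show "K * \<tau> = V / n" "2 / \<tau> = 2 * (n * K / V)" using pos by (auto simp: \<tau>_def field_simps)
  qed
  have W01: "0 \<le> W q k" "W q k \<le> 1" if "q \<in> A" "k \<in> {1..K}" for q k
    using W[OF that(1)] that(2) by (auto simp: weights_def)
  have up: "round_up \<tau> (W q k) \<in> weight_grid \<tau>" "W q k \<le> round_up \<tau> (W q k)" "round_up \<tau> (W q k) \<le> W q k + \<tau>"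
    if "q \<in> A" "k \<in> {1..K}" for q k using round_up[OF tau(1) W01[OF that]] by blast+
  have fd: "prob_density \<mu> (Fn q k)" if "q \<in> A" "k \<in> {1..K}" for q k using Fd Fn that by blast
  note fdD = prob_densityD[OF fd]
  have qe: "qe = (\<lambda>q x. \<Sum>k=1..K. round_up \<tau> (W q k) * Fn q k x)" by (simp add: qe_def \<tau>_def)
  have int: "integrable \<mu> (qe q)" if "q \<in> A" for q
    unfolding qe using fdD(4)[OF that] by (intro Bochner_Integration.integrable_sum integrable_mult_right)
  have mass: "(\<integral>x. qe q x \<partial>\<mu>) \<le> 1 + V / n" if q: "q \<in> A" for q
  proof -
    have "(\<integral>x. qe q x \<partial>\<mu>) = (\<Sum>k=1..K. round_up \<tau> (W q k))"
      unfolding qe using fdD(4,5)[OF q] by (subst Bochner_Integration.integral_sum) auto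
    also have "\<dots> \<le> (\<Sum>k=1..K. W q k + \<tau>)" using up(3)[OF q] by (intro sum_mono) blast
    also have "\<dots> = 1 + K * \<tau>" using W[OF q] by (simp add: sum.distrib weights_def)
    finally show ?thesis by (simp only: tau)
  qed
  have le: "(\<Sum>k=1..K. W q k * Fn q k x) \<le> qe q x" if "q \<in> A" "x \<in> space \<mu>" for q x
    unfolding qe using up(2)[OF that(1)] fdD(2)[OF that(1) _ that(2)] by (intro sum_mono mult_right_mono) auto
  have qe0: "0 \<le> qe q x" if "q \<in> A" "x \<in> space \<mu>" for q x
  proof -
    have "0 \<le> (\<Sum>k=1..K. W q k * Fn q k x)"
      using W01(1)[OF that(1)] fdD(2)[OF that(1) _ that(2)] by (intro sum_nonneg mult_nonneg_nonneg)
    then show ?thesis using le[OF that] by linarith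
  qed
  have tm: "t q \<in> borel_measurable \<mu>" if q: "q \<in> A" for q
  proof -
    have [measurable]: "qe q \<in> borel_measurable \<mu>" using int[OF q] by simp
    have [measurable]: "q0 \<in> borel_measurable \<mu>" by (rule prob_densityD(1)[OF q0])
    have [measurable]: "(\<lambda>x. rho (q0 x) (qe q x)) \<in> borel_measurable \<mu>" by (rule rho_measurable) measurable
    have [measurable]: "Measurable.pred \<mu> (\<lambda>x. x \<in> N0)" using N0 by simp
    show ?thesis unfolding t_def by measurable
  qed
  have tb: "\<bar>t q x\<bar> \<le> 1" if "q \<in> A" "x \<in> space \<mu>" for q x
    using rho_bounds[OF prob_densityD(2)[OF q0 that(2)] qe0[OF that]] by (simp add: t_def)
  show "\<forall>q\<in>A. integrable \<mu> (qe q) \<and> (\<integral>x. qe q x \<partial>\<mu>) \<le> 1 + V / n \<and> t q \<in> borel_measurable \<mu> \<and>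
      (\<forall>x\<in>space \<mu>. 0 \<le> qe q x \<and> (\<Sum>k=1..K. W q k * Fn q k x) \<le> qe q x \<and> \<bar>t q x\<bar> \<le> 1)"
    using int mass le qe0 tm tb by blast
  define m where "m = nat \<lceil>K * n / V\<rceil>"
  define x0 where "x0 = (V / (2 * K * n))\<^sup>2"
  have Kn: "1 \<le> K * n / V"
  proof -
    have "1 * real V \<le> real K * real n" using V K by (intro mult_mono) auto
    then show ?thesis using pos by simp
  qed
  have mge: "K * n / V \<le> real m" unfolding m_def by (rule real_nat_ceiling_ge)
  then have m1: "m \<ge> 1" using Kn by linarith
  have x0: "0 < x0" "x0 \<le> 1"
  proof -
    show "0 < x0" using pos by (simp add: x0_def)
    have "real V * 1 \<le> real n * (2 * real K)" using V K by (intro mult_mono) auto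
    then have "V / (2 * K * n) \<le> 1" using pos by (simp add: mult_ac)
    then show "x0 \<le> 1" using pos unfolding x0_def by (intro power_le_one) auto
  qed
  \<comment> \<open>The scale of the covering: summed over the sample, the discretization costs a multiple of \<open>V\<close>.\<close>
  have eps: "real (card {1..K}) * (2 / real m) \<le> 2 * V / n"
  proof -
    have "real K * 2 * (real n / V) = 2 * (K * n / V)" by simp
    then have "real K * 2 * (real n / V) \<le> 2 * real m" using mge by linarith
    then have "real K * 2 / real m \<le> 2 / (real n / V)" using m1 pos by (simp add: field_simps)
    then show ?thesis by simp
  qed
  have count: "(\<Prod>k=1..K. real (card (weight_grid \<tau>)) * ((1 / x0) ^ VC_index \<mu> (Fbar k (l k)) * exp (x0 * (real (2 * n) * real m))))
     \<le> exp (V * (3 * (ln K + ln (n / V)) + 4))"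
    unfolding x0_def
    by (rule cover_count_le) (use K KV V Vsum m_def weight_grid(2)[OF tau(1,2)] tau(4) in auto)
  have "(\<integral>\<^sup>+x. (SUP q\<in>A. ennreal (exp (1/250 * ((\<Sum>i\<in>{1..n}. t q (x i))
        - (\<Sum>i\<in>{1..n}. \<integral>y. t q y + 1/25 * (t q y)\<^sup>2 \<partial>P i))))) \<partial>(\<Pi>\<^sub>M i\<in>{1..n}. P i))
     \<le> ennreal (exp (V * (3 * (ln K + ln (n / V)) + 4)) * exp (1/250 * (3 * (2 * V / n) * card {1..n})))"
  proof (rule nn_integral_exp_sup_le[where M=\<mu>])
    fix X :: "'a set" assume X: "finite X" "X \<subseteq> space \<mu>" "card X \<le> 2 * card {1..n}"
    have "\<exists>C\<subseteq>A. finite C \<and>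
      real (card C) \<le> (\<Prod>k=1..K. real (card (weight_grid \<tau>)) * ((1 / x0) ^ VC_index \<mu> (Fbar k (l k)) * exp (x0 * (real (2 * n) * real m)))) \<and>
      (\<forall>q\<in>A. \<exists>q'\<in>C. \<forall>x\<in>X. \<bar>t q x - t q' x\<bar> \<le> real (card {1..K}) * (2 / real m))"
      unfolding t_def qe
    proof (rule mixture_cover[where Fb="\<lambda>k. Fbar k (l k)"])
      show "no_shattered \<mu> (Fbar k (l k)) (VC_index \<mu> (Fbar k (l k)))" if "k \<in> {1..K}" for k
        by (rule VC_index(1)[OF VC[OF that]])
      show "0 \<le> f x" if "k \<in> {1..K}" "f \<in> Fbar k (l k)" "x \<in> space \<mu>" for k f x
        by (rule prob_densityD(2)[OF Fd[OF that(1,2)] that(3)])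
      show "0 \<le> q0 x" if "x \<in> space \<mu>" for x by (rule prob_densityD(2)[OF q0 that])
      show "card X \<le> 2 * n" using X by simp
    qed (use weight_grid[OF tau(1,2)] up(1) Fn m1 x0 X(1,2) in blast)+
    then obtain C where C: "C \<subseteq> A" "finite C"
      "real (card C) \<le> (\<Prod>k=1..K. real (card (weight_grid \<tau>)) * ((1 / x0) ^ VC_index \<mu> (Fbar k (l k)) * exp (x0 * (real (2 * n) * real m))))"
      "\<forall>q\<in>A. \<exists>q'\<in>C. \<forall>x\<in>X. \<bar>t q x - t q' x\<bar> \<le> real (card {1..K}) * (2 / real m)" by blast
    show "\<exists>C\<subseteq>A. finite C \<and> real (card C) \<le> exp (V * (3 * (ln K + ln (n / V)) + 4)) \<and>
       (\<forall>q\<in>A. \<exists>q'\<in>C. \<forall>x\<in>X. \<bar>t q x - t q' x\<bar> \<le> 2 * V / n)"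
    proof (intro exI[of _ C] conjI C(1,2))
      show "real (card C) \<le> exp (V * (3 * (ln K + ln (n / V)) + 4))" using C(3) count by linarith
      show "\<forall>q\<in>A. \<exists>q'\<in>C. \<forall>x\<in>X. \<bar>t q x - t q' x\<bar> \<le> 2 * V / n"
        using C(4) eps by (meson order_trans)
    qed
  qed (use P A tm tb in \<open>auto simp: power2_eq_square\<close>)
  also have "1/250 * (3 * (2 * V / n) * card {1..n}) = 6/250 * V" using pos by simp
  finally show "(\<integral>\<^sup>+x. (SUP q\<in>A. ennreal (exp (1/250 * ((\<Sum>i\<in>{1..n}. t q (x i))
        - (\<Sum>i\<in>{1..n}. \<integral>y. t q y + 1/25 * (t q y)\<^sup>2 \<partial>P i))))) \<partial>(\<Pi>\<^sub>M i\<in>{1..n}. P i))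
      \<le> ennreal (exp (V * (3 * (ln K + ln (n / V)) + 4)) * exp (6/250 * V))" .
qed

text \<open>The index \<open>th q\<close> is any index whose full model contains \<open>q \<cdot> \<mu>\<close>; it need not be one for which
  \<open>q\<close> belongs to the discretized family. The classes are therefore formed according to \<open>th\<close>, and
  all of them share one null set off which every \<open>q\<close> equals its mixture representation; a
  countable \<open>Q\<close> makes such a null set available.\<close>

lemma uniform_deviation:
  fixes \<mu> :: "'a measure" and P :: "nat \<Rightarrow> 'a measure" and \<Delta> \<delta> :: "'l mix_index \<Rightarrow> real"
  assumes mu: "sigma_finite_measure \<mu>"
    and P: "\<And>i. i \<in> {1..n} \<Longrightarrow> prob_space (P i)" "\<And>i. i \<in> {1..n} \<Longrightarrow> sets (P i) = sets \<mu>"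
    and Fd: "\<And>k j f. k \<ge> 1 \<Longrightarrow> j \<in> \<Lambda> k \<Longrightarrow> f \<in> Fbar k j \<Longrightarrow> prob_density \<mu> f"
    and VC: "\<And>k j. k \<ge> 1 \<Longrightarrow> j \<in> \<Lambda> k \<Longrightarrow> VC_subgraph \<mu> (Fbar k j)"
    and \<Theta>: "\<Theta> \<subseteq> mix_indices \<Lambda>" "countable \<Theta>"
    and \<delta>: "\<And>\<theta>. \<theta> \<in> \<Theta> \<Longrightarrow> \<delta> \<theta> \<in> {0<..1 / real (fst \<theta>)}"
    and \<Delta>: "\<And>\<theta>. \<theta> \<in> \<Theta> \<Longrightarrow> 0 \<le> \<Delta> \<theta>" "(\<lambda>\<theta>. exp (- \<Delta> \<theta>)) summable_on \<Theta>" "(\<Sum>\<^sub>\<infinity>\<theta>\<in>\<Theta>. exp (- \<Delta> \<theta>)) \<le> 1"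
    and q0: "prob_density \<mu> q0" and Q: "countable Q" "\<And>q. q \<in> Q \<Longrightarrow> prob_density \<mu> q"
    and th: "\<And>q. q \<in> Q \<Longrightarrow> th q \<in> \<Theta>" "\<And>q. q \<in> Q \<Longrightarrow> dens_measure \<mu> q \<in> mix_model \<mu> Fbar (th q)"
    and \<xi>: "0 \<le> \<xi>"
  shows "\<exists>B\<in>sets (\<Pi>\<^sub>M i\<in>{1..n}. P i). emeasure (\<Pi>\<^sub>M i\<in>{1..n}. P i) B \<le> ennreal (exp (- \<xi>)) \<and>
    (\<forall>x\<in>space (\<Pi>\<^sub>M i\<in>{1..n}. P i) - B. \<forall>q\<in>Q. T_stat n x q0 q
       \<le> 4.16 * hellinger_sq_prod n P (\<lambda>_. dens_measure \<mu> q0) - 0.195 * hellinger_sq_prod n P (\<lambda>_. dens_measure \<mu> q)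
         + 752 * complexity n \<mu> Fbar \<delta> (th q) + 250 * \<Delta> (th q) + 250 * \<xi>)"
proof -
  let ?PM = "\<Pi>\<^sub>M i\<in>{1..n}. P i"
  have Kl: "1 \<le> fst \<theta>" "\<And>k. k \<in> {1..fst \<theta>} \<Longrightarrow> snd \<theta> k \<in> \<Lambda> k" if "\<theta> \<in> \<Theta>" for \<theta>
    using \<Theta> that by (auto simp: mix_indices_def PiE_def Pi_def)
  have Fd': "prob_density \<mu> f" if "\<theta> \<in> \<Theta>" "k \<in> {1..fst \<theta>}" "f \<in> Fbar k (snd \<theta> k)" for \<theta> k f
    using Fd[OF _ Kl(2)[OF that(1,2)] that(3)] that(2) by simp
  have VC': "VC_subgraph \<mu> (Fbar k (snd \<theta> k))" if "\<theta> \<in> \<Theta>" "k \<in> {1..fst \<theta>}" for \<theta> k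
    using VC[OF _ Kl(2)[OF that]] that(2) by simp
  have "\<forall>q\<in>Q. \<exists>wf. fst wf \<in> weights (fst (th q)) \<and> (\<forall>k\<in>{1..fst (th q)}. snd wf k \<in> Fbar k (snd (th q) k))
      \<and> (AE x in \<mu>. q x = (\<Sum>k=1..fst (th q). fst wf k * snd wf k x))"
  proof
    fix q assume q: "q \<in> Q"
    have "dens_measure \<mu> q \<in> mix_model \<mu> Fbar (fst (th q), snd (th q))" using th(2)[OF q] by simp
    from mix_model_density[OF mu Q(2)[OF q] Fd'[OF th(1)[OF q]] this]
    show "\<exists>wf. fst wf \<in> weights (fst (th q)) \<and> (\<forall>k\<in>{1..fst (th q)}. snd wf k \<in> Fbar k (snd (th q) k))
      \<and> (AE x in \<mu>. q x = (\<Sum>k=1..fst (th q). fst wf k * snd wf k x))" by auto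
  qed
  then obtain wf where wf: "\<forall>q\<in>Q. fst (wf q) \<in> weights (fst (th q)) \<and> (\<forall>k\<in>{1..fst (th q)}. snd (wf q) k \<in> Fbar k (snd (th q) k))
      \<and> (AE x in \<mu>. q x = (\<Sum>k=1..fst (th q). fst (wf q) k * snd (wf q) k x))" by (rule bchoice[THEN exE])
  define W where "W = (\<lambda>q. fst (wf q))"
  define Fn where "Fn = (\<lambda>q. snd (wf q))"
  have W: "W q \<in> weights (fst (th q))" and Fn: "\<And>k. k \<in> {1..fst (th q)} \<Longrightarrow> Fn q k \<in> Fbar k (snd (th q) k)"
    and ae: "AE x in \<mu>. q x = (\<Sum>k=1..fst (th q). W q k * Fn q k x)" if "q \<in> Q" for q
    using wf that by (auto simp: W_def Fn_def)
  have "\<forall>q\<in>Q. \<exists>N. N \<in> null_sets \<mu> \<and> {x \<in> space \<mu>. \<not> q x = (\<Sum>k=1..fst (th q). W q k * Fn q k x)} \<subseteq> N"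
    using ae by (simp only: eventually_ae_filter) blast
  then obtain N where N: "\<forall>q\<in>Q. N q \<in> null_sets \<mu> \<and> {x \<in> space \<mu>. \<not> q x = (\<Sum>k=1..fst (th q). W q k * Fn q k x)} \<subseteq> N q"
    by (rule bchoice[THEN exE])
  \<comment> \<open>The sample may hit \<open>N0\<close>, since the true distributions need not be dominated by \<open>\<mu>\<close>.\<close>
  define N0 where "N0 = (\<Union>q\<in>Q. N q)"
  have N0: "N0 \<in> null_sets \<mu>" unfolding N0_def using N Q(1) by (intro null_sets_UN') auto
  then have N0s: "N0 \<in> sets \<mu>" by auto
  have off: "q x = (\<Sum>k=1..fst (th q). W q k * Fn q k x)" if "q \<in> Q" "x \<in> space \<mu>" "x \<notin> N0" for q x
    using N that unfolding N0_def by blast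
  define V where "V = (\<lambda>\<theta>. VC_total \<mu> Fbar \<theta>)"
  define A where "A = (\<lambda>\<theta>. {q\<in>Q. th q = \<theta>})"
  define qe where "qe = (\<lambda>\<theta> q x. \<Sum>k=1..fst \<theta>. round_up (real (V \<theta>) / (real n * real (fst \<theta>))) (W q k) * Fn q k x)"
  define t where "t = (\<lambda>\<theta> q x. if x \<in> N0 then 1 else rho (q0 x) (qe \<theta> q x))"
  define E where "E = (\<lambda>\<theta> q. \<Sum>i\<in>{1..n}. \<integral>y. t \<theta> q y + 1/25 * (t \<theta> q y)\<^sup>2 \<partial>P i)"
  define c where "c = (\<lambda>\<theta>. V \<theta> * (3 * (ln (real (fst \<theta>)) + ln (n / V \<theta>)) + 4))"
  define S where "S = (\<lambda>\<theta> x. SUP q\<in>A \<theta>. ennreal (exp (1/250 * ((\<Sum>i\<in>{1..n}. t \<theta> q (x i)) - E \<theta> q))))"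
  define pn where "pn = (\<lambda>\<theta>. c \<theta> + 6/250 * V \<theta> + \<Delta> \<theta> + \<xi>)"
  define \<Theta>' where "\<Theta>' = {\<theta>\<in>\<Theta>. V \<theta> \<le> n}"
  define bad where "bad = (\<lambda>\<theta>. if \<theta> \<in> \<Theta>' then {x\<in>space ?PM. 1 \<le> ennreal (exp (- pn \<theta>)) * S \<theta> x} else {})"
  have cA: "countable (A \<theta>)" for \<theta> using Q(1) by (auto simp: A_def intro: countable_subset)
  have prem: "\<And>q. q \<in> A \<theta> \<Longrightarrow> W q \<in> weights (fst \<theta>)" "V \<theta> = VC_total \<mu> Fbar (fst \<theta>, snd \<theta>)"
    "\<And>q k. q \<in> A \<theta> \<Longrightarrow> k \<in> {1..fst \<theta>} \<Longrightarrow> Fn q k \<in> Fbar k (snd \<theta> k)" for \<theta>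
    using W Fn by (auto simp: A_def V_def)
  have mom: "\<forall>q\<in>A \<theta>. integrable \<mu> (qe \<theta> q) \<and> (\<integral>x. qe \<theta> q x \<partial>\<mu>) \<le> 1 + V \<theta> / n \<and> t \<theta> q \<in> borel_measurable \<mu> \<and>
      (\<forall>x\<in>space \<mu>. 0 \<le> qe \<theta> q x \<and> (\<Sum>k=1..fst \<theta>. W q k * Fn q k x) \<le> qe \<theta> q x \<and> \<bar>t \<theta> q x\<bar> \<le> 1)"
    and momS: "(\<integral>\<^sup>+x. S \<theta> x \<partial>?PM) \<le> ennreal (exp (c \<theta>) * exp (6/250 * V \<theta>))"
    if \<theta>: "\<theta> \<in> \<Theta>'" for \<theta>
  proof -
    have t1: "\<theta> \<in> \<Theta>" and t2: "V \<theta> \<le> n" using \<theta> by (auto simp: \<Theta>'_def)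
    note facts = mu P Kl(1)[OF t1] Fd'[OF t1] VC'[OF t1] prem t2 q0 cA N0s
    show "\<forall>q\<in>A \<theta>. integrable \<mu> (qe \<theta> q) \<and> (\<integral>x. qe \<theta> q x \<partial>\<mu>) \<le> 1 + V \<theta> / n \<and> t \<theta> q \<in> borel_measurable \<mu> \<and>
      (\<forall>x\<in>space \<mu>. 0 \<le> qe \<theta> q x \<and> (\<Sum>k=1..fst \<theta>. W q k * Fn q k x) \<le> qe \<theta> q x \<and> \<bar>t \<theta> q x\<bar> \<le> 1)"
      unfolding qe_def t_def
      by (rule exp_moment_of_model(1)[where l="snd \<theta>" and Fbar=Fbar and P=P]; fact facts)
    show "(\<integral>\<^sup>+x. S \<theta> x \<partial>?PM) \<le> ennreal (exp (c \<theta>) * exp (6/250 * V \<theta>))"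
      unfolding S_def E_def c_def t_def qe_def
      by (rule exp_moment_of_model(2)[where l="snd \<theta>" and Fbar=Fbar]; fact facts)
  qed
  have Sm: "S \<theta> \<in> borel_measurable ?PM" if \<theta>: "\<theta> \<in> \<Theta>'" for \<theta>
  proof -
    have comp: "(\<lambda>x. t \<theta> q (x i)) \<in> borel_measurable ?PM" if "q \<in> A \<theta>" "i \<in> {1..n}" for q i
    proof -
      have "t \<theta> q \<in> borel_measurable \<mu>" using mom[OF \<theta>] that(1) by blast
      then have "t \<theta> q \<in> borel_measurable (P i)"
        unfolding measurable_cong_sets[OF P(2)[OF that(2)] refl] .
      then show ?thesis using measurable_component_singleton[OF that(2)]
        by (rule measurable_compose[rotated])
    qed
    show ?thesis unfolding S_def using cA
      by (intro borel_measurable_SUP measurable_compose[OF _ measurable_ennreal] measurable_compose[OF _ borel_measurable_exp]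
        borel_measurable_times borel_measurable_sum borel_measurable_diff borel_measurable_const comp) auto
  qed
  have badm: "bad \<theta> \<in> sets ?PM" for \<theta>
  proof (cases "\<theta> \<in> \<Theta>'")
    case True
    have [measurable]: "S \<theta> \<in> borel_measurable ?PM" by (rule Sm[OF True])
    show ?thesis unfolding bad_def if_P[OF True] by measurable
  qed (simp add: bad_def)
  have badP: "emeasure ?PM (bad \<theta>) \<le> ennreal (exp (- \<xi>) * exp (- \<Delta> \<theta>))" for \<theta>
  proof (cases "\<theta> \<in> \<Theta>'")
    case \<theta>: True
    have "emeasure ?PM (bad \<theta>) \<le> ennreal (exp (- pn \<theta>)) * (\<integral>\<^sup>+x. S \<theta> x * indicator (space ?PM) x \<partial>?PM)"
      unfolding bad_def if_P[OF \<theta>] using Sm[OF \<theta>] by (intro nn_integral_Markov_inequality) auto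
    also have "(\<integral>\<^sup>+x. S \<theta> x * indicator (space ?PM) x \<partial>?PM) = (\<integral>\<^sup>+x. S \<theta> x \<partial>?PM)"
      by (intro nn_integral_cong) simp
    also have "ennreal (exp (- pn \<theta>)) * (\<integral>\<^sup>+x. S \<theta> x \<partial>?PM) \<le> ennreal (exp (- pn \<theta>)) * ennreal (exp (c \<theta>) * exp (6/250 * V \<theta>))"
      using momS[OF \<theta>] by (intro mult_left_mono) auto
    also have "\<dots> = ennreal (exp (- \<xi>) * exp (- \<Delta> \<theta>))"
      by (simp add: ennreal_mult[symmetric] exp_add[symmetric] pn_def)
    finally show ?thesis .
  qed (simp add: bad_def)
  define B where "B = (\<Union>\<theta>\<in>\<Theta>. bad \<theta>)"
  have Bm: "B \<in> sets ?PM" unfolding B_def using \<Theta>(2) badm by (rule sets.countable_UN'')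
  have BP: "emeasure ?PM B \<le> ennreal (exp (- \<xi>))"
  proof -
    have "emeasure ?PM B \<le> (\<integral>\<^sup>+\<theta>. emeasure ?PM (bad \<theta>) \<partial>count_space \<Theta>)"
      unfolding B_def using \<Theta>(2) badm by (rule emeasure_UN_le_nn_integral)
    also have "\<dots> \<le> (\<integral>\<^sup>+\<theta>. ennreal (exp (- \<xi>)) * ennreal (exp (- \<Delta> \<theta>)) \<partial>count_space \<Theta>)"
      using badP by (intro nn_integral_mono) (simp add: ennreal_mult)
    also have "\<dots> = ennreal (exp (- \<xi>)) * (\<integral>\<^sup>+\<theta>. ennreal (exp (- \<Delta> \<theta>)) \<partial>count_space \<Theta>)"
      by (rule nn_integral_cmult) simp
    also have "(\<integral>\<^sup>+\<theta>. ennreal (exp (- \<Delta> \<theta>)) \<partial>count_space \<Theta>) \<le> 1"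
    proof -
      have "(\<lambda>\<theta>. norm (exp (- \<Delta> \<theta>))) summable_on \<Theta>" using \<Delta>(2) by simp
      then have s: "Infinite_Set_Sum.abs_summable_on (\<lambda>\<theta>. exp (- \<Delta> \<theta>)) \<Theta>"
        by (simp only: abs_summable_equivalent)
      have "(\<integral>\<^sup>+\<theta>. ennreal (exp (- \<Delta> \<theta>)) \<partial>count_space \<Theta>) = ennreal (infsetsum (\<lambda>\<theta>. exp (- \<Delta> \<theta>)) \<Theta>)"
        by (rule nn_integral_conv_infsetsum[OF s]) simp
      also have "\<dots> \<le> 1" using \<Delta>(3) infsetsum_infsum[OF s] by simp
      finally show ?thesis .
    qed
    finally show ?thesis by (simp add: mult_left_mono)
  qed
  have main: "T_stat n x q0 q
       \<le> 4.16 * hellinger_sq_prod n P (\<lambda>_. dens_measure \<mu> q0) - 0.195 * hellinger_sq_prod n P (\<lambda>_. dens_measure \<mu> q)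
         + 752 * complexity n \<mu> Fbar \<delta> (th q) + 250 * \<Delta> (th q) + 250 * \<xi>"
    if x: "x \<in> space ?PM" "x \<notin> B" and q: "q \<in> Q" for x q
  proof -
    define \<theta> where "\<theta> = th q"
    have \<theta>: "\<theta> \<in> \<Theta>" using th(1)[OF q] by (simp add: \<theta>_def)
    have xs: "x i \<in> space \<mu>" if "i \<in> {1..n}" for i
      using x(1) that sets_eq_imp_space_eq[OF P(2)[OF that]] by (auto simp: space_PiM PiE_def Pi_def)
    note H = hellinger_sq_prod_bounds[where P=P and n=n, OF P(1) prob_densityD(6)]
    have H0: "0 \<le> hellinger_sq_prod n P (\<lambda>_. dens_measure \<mu> q0)" by (rule H(1)[OF _ q0]) (simp_all add: P)
    have Hq: "hellinger_sq_prod n P (\<lambda>_. dens_measure \<mu> q) \<le> n" by (rule H(2)[OF _ Q(2)[OF q]]) (simp_all add: P)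
    have KV: "fst \<theta> \<le> V \<theta>"
    proof -
      have "(\<Sum>k=1..fst \<theta>. 1) \<le> (\<Sum>k=1..fst \<theta>. VC_index \<mu> (Fbar k (snd \<theta> k)))"
        using VC_index(2)[OF VC'[OF \<theta>]] by (intro sum_mono) auto
      then show ?thesis by (simp add: V_def VC_total_def case_prod_beta)
    qed
    have d01: "0 < \<delta> \<theta>" "\<delta> \<theta> \<le> 1"
    proof -
      show "0 < \<delta> \<theta>" using \<delta>[OF \<theta>] by simp
      have "\<delta> \<theta> \<le> 1 / real (fst \<theta>)" using \<delta>[OF \<theta>] by simp
      also have "\<dots> \<le> 1" using Kl(1)[OF \<theta>] by simp
      finally show "\<delta> \<theta> \<le> 1" .
    qed
    have cb: "5.82 * V \<theta> \<le> complexity n \<mu> Fbar \<delta> \<theta>" "c \<theta> \<le> 3 * complexity n \<mu> Fbar \<delta> \<theta>"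
      using complexity_bounds[of "fst \<theta>" \<mu> Fbar "snd \<theta>" \<delta> n] KV d01 Kl(1)[OF \<theta>]
      unfolding prod.collapse V_def c_def by blast+
    show ?thesis
    proof (cases "V \<theta> \<le> n")
      case False
      \<comment> \<open>Both \<open>T\<close> and \<open>H\<close> are at most \<open>n\<close>, which is below the complexity.\<close>
      have "\<bar>T_stat n x q0 q\<bar> \<le> n"
        using prob_densityD(2)[OF q0 xs] prob_densityD(2)[OF Q(2)[OF q] xs] by (intro abs_T_stat_le) auto
      then have "T_stat n x q0 q \<le> n" by simp
      moreover have "real n \<le> V \<theta>" using False by simp
      ultimately show ?thesis using H0 Hq cb(1) \<Delta>(1)[OF \<theta>] \<xi> by (simp add: \<theta>_def[symmetric])
    next
      case True
      then have T': "\<theta> \<in> \<Theta>'" using \<theta> by (simp add: \<Theta>'_def)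
      have qA: "q \<in> A \<theta>" using q by (simp add: A_def \<theta>_def)
      have "\<not> 1 \<le> ennreal (exp (- pn \<theta>)) * S \<theta> x" using x T' \<theta> by (auto simp: B_def bad_def)
      moreover have "ennreal (exp (- pn \<theta>)) * ennreal (exp (1/250 * ((\<Sum>i\<in>{1..n}. t \<theta> q (x i)) - E \<theta> q)))
         \<le> ennreal (exp (- pn \<theta>)) * S \<theta> x"
        unfolding S_def using qA by (intro mult_left_mono SUP_upper) auto
      ultimately have "\<not> 1 \<le> ennreal (exp (- pn \<theta>)) * ennreal (exp (1/250 * ((\<Sum>i\<in>{1..n}. t \<theta> q (x i)) - E \<theta> q)))"
        by (meson order_trans)
      then have "\<not> 1 \<le> exp (- pn \<theta> + 1/250 * ((\<Sum>i\<in>{1..n}. t \<theta> q (x i)) - E \<theta> q))"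
        unfolding exp_add by (subst (asm) ennreal_mult[symmetric]) auto
      then have "1/250 * ((\<Sum>i\<in>{1..n}. t \<theta> q (x i)) - E \<theta> q) < pn \<theta>" by simp
      then have dev: "(\<Sum>i\<in>{1..n}. t \<theta> q (x i)) \<le> E \<theta> q + 250 * pn \<theta>" by simp
      have "T_stat n x q0 q \<le> (\<Sum>i\<in>{1..n}. t \<theta> q (x i))"
        unfolding T_stat_def
      proof (intro sum_mono)
        fix i assume i: "i \<in> {1..n}"
        have nn: "0 \<le> q0 (x i)" "0 \<le> q (x i)"
          using prob_densityD(2)[OF q0 xs[OF i]] prob_densityD(2)[OF Q(2)[OF q] xs[OF i]] .
        have "rho (q0 (x i)) (q (x i)) \<le> t \<theta> q (x i)"
        proof (cases "x i \<in> N0")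
          case True
          then show ?thesis using rho_bounds[OF nn] by (simp add: t_def)
        next
          case False
          have "q (x i) \<le> qe \<theta> q (x i)"
            using mom[OF T'] qA xs[OF i] off[OF q xs[OF i] False] by (simp add: \<theta>_def)
          then show ?thesis using False rho_mono[OF nn] by (simp add: t_def)
        qed
        then show "psi (sqrt_ratio (q (x i)) (q0 (x i))) \<le> t \<theta> q (x i)"
          by (simp add: psi_sqrt_ratio nn)
      qed
      also note dev
      also have "E \<theta> q \<le> (\<Sum>i\<in>{1..n}. 4.16 * hellinger_sq (P i) (dens_measure \<mu> q0)
          - 0.195 * hellinger_sq (P i) (dens_measure \<mu> q) + 1.4 * (V \<theta> / n))"
        unfolding E_def
      proof (intro sum_mono expected_test_le mu P q0 Q(2) q)
        show "integrable \<mu> (qe \<theta> q)" "(\<integral>x. qe \<theta> q x \<partial>\<mu>) \<le> 1 + V \<theta> / n" "t \<theta> q \<in> borel_measurable \<mu>"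
          using mom[OF T'] qA by auto
        show "0 \<le> qe \<theta> q y" "\<bar>t \<theta> q y\<bar> \<le> 1" if "y \<in> space \<mu>" for y using mom[OF T'] qA that by auto
        have notN: "AE y in \<mu>. y \<notin> N0" by (rule AE_not_in[OF N0])
        then show "AE y in \<mu>. t \<theta> q y = rho (q0 y) (qe \<theta> q y)" by eventually_elim (simp add: t_def)
        show "AE y in \<mu>. q y \<le> qe \<theta> q y" using notN AE_space
        proof eventually_elim
          case (elim y)
          then show ?case using mom[OF T'] qA elim(2) off[OF q elim(2,1)] by (simp add: \<theta>_def)
        qed
      qed
      also have "\<dots> = 4.16 * hellinger_sq_prod n P (\<lambda>_. dens_measure \<mu> q0) - 0.195 * hellinger_sq_prod n P (\<lambda>_. dens_measure \<mu> q)
          + n * (1.4 * (V \<theta> / n))"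
        by (simp add: hellinger_sq_prod_def sum.distrib sum_subtractf sum_distrib_left)
      also have "n * (1.4 * (V \<theta> / n)) \<le> 1.4 * V \<theta>" by (cases "n = 0") auto
      finally have "T_stat n x q0 q \<le> 4.16 * hellinger_sq_prod n P (\<lambda>_. dens_measure \<mu> q0)
          - 0.195 * hellinger_sq_prod n P (\<lambda>_. dens_measure \<mu> q) + 1.4 * V \<theta> + 250 * pn \<theta>" by simp
      also have "\<dots> \<le> 4.16 * hellinger_sq_prod n P (\<lambda>_. dens_measure \<mu> q0) - 0.195 * hellinger_sq_prod n P (\<lambda>_. dens_measure \<mu> q)
         + 752 * complexity n \<mu> Fbar \<delta> \<theta> + 250 * \<Delta> \<theta> + 250 * \<xi>"
        using cb by (simp add: pn_def)
      finally show ?thesis by (simp add: \<theta>_def)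
    qed
  qed
  show ?thesis using Bm BP main by blast
qed

section \<open>Approximation by the countable models\<close>

text \<open>Contracting a weight vector towards the uniform one by the factor \<open>1 - K d\<close> raises every
  weight to at least \<open>d\<close> and moves it by at most \<open>d (K - 1)\<close> in total variation. Rationality is
  obtained by first rounding the weights and replacing \<open>d\<close> by a rational number in
  \<open>[d, 2 d] \<inter> [0, 1 / K]\<close>.\<close>

lemma rational_weights_approx:
  fixes w :: "nat \<Rightarrow> real"
  assumes K: "1 \<le> K" and w: "w \<in> weights K" and d: "0 < d" "d \<le> 1 / real K" and e: "0 < e"
  shows "\<exists>v\<in>weights K. (\<forall>k\<in>{1..K}. v k \<in> {d..1} \<inter> \<rat>) \<and> (1/2) * (\<Sum>k=1..K. \<bar>w k - v k\<bar>) \<le> 2 * d * (real K - 1) + e"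
proof -
  have K0: "0 < real K" using K by simp
  have w01: "0 \<le> w k" "w k \<le> 1" if "k \<in> {1..K}" for k using w that by (auto simp: weights_def)
  have wsum: "(\<Sum>k=1..K. w k) = 1" using w by (simp add: weights_def)
  obtain d' where d': "d' \<in> \<rat>" "d \<le> d'" "d' \<le> 1 / real K" "d' \<le> 2 * d"
  proof (cases "1 / real K \<le> 2 * d")
    case True
    then show ?thesis using that[of "1 / real K"] d by simp
  next
    case False
    obtain r where "r \<in> \<rat>" "d < r" "r < 2 * d" using Rats_dense_in_real[of d "2 * d"] d by auto
    then show ?thesis using that[of r] False by simp
  qed
  define N where "N = nat \<lceil>K / e\<rceil> + 1"
  have N: "0 < real N" "K / N \<le> e"
  proof -
    show N0: "0 < real N" by (simp add: N_def)
    have "K / e \<le> N" unfolding N_def by linarith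
    then show "K / N \<le> e" using e N0 by (simp add: field_simps)
  qed
  \<comment> \<open>All weights but the first are rounded down, so that the first, which restores the sum \<open>1\<close>, can only grow.\<close>
  define u where "u = (\<lambda>k. if k = 1 then 1 - (\<Sum>j=2..K. of_int \<lfloor>w j * N\<rfloor> / N) else of_int \<lfloor>w k * N\<rfloor> / N)"
  have split: "(\<Sum>k=1..K. g k) = g 1 + (\<Sum>k=2..K. g k)" for g :: "nat \<Rightarrow> real"
    using K by (simp add: sum.atLeast_Suc_atMost numeral_2_eq_2)
  have u2: "u k = of_int \<lfloor>w k * N\<rfloor> / N" if "k \<in> {2..K}" for k using that by (simp add: u_def)
  have near: "0 \<le> w k - u k" "w k - u k \<le> 1 / N" "0 \<le> u k" if k: "k \<in> {2..K}" for k
  proof -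
    have "0 \<le> w k" using w01 k by auto
    then have "0 \<le> \<lfloor>w k * N\<rfloor>" using N by simp
    then show "0 \<le> u k" using u2[OF k] by simp
    have "w k = w k * N / N" using N by simp
    moreover have "of_int \<lfloor>w k * N\<rfloor> / N \<le> w k * N / N" "w k * N / N \<le> (of_int \<lfloor>w k * N\<rfloor> + 1) / N"
      using N by (intro divide_right_mono; linarith)+
    ultimately show "0 \<le> w k - u k" "w k - u k \<le> 1 / N" using u2[OF k] by (simp_all add: add_divide_distrib)
  qed
  have usum: "(\<Sum>k=1..K. u k) = 1" unfolding split using u2 by (simp add: u_def)
  have u1: "u 1 - w 1 = (\<Sum>k=2..K. w k - u k)"
    using usum wsum unfolding split by (simp add: sum_subtractf)
  have u1': "0 \<le> u 1 - w 1" "u 1 - w 1 \<le> K / N"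
  proof -
    show "0 \<le> u 1 - w 1" unfolding u1 using near by (intro sum_nonneg)
    have "u 1 - w 1 \<le> (\<Sum>k=2..K. 1 / N)" unfolding u1 using near by (intro sum_mono)
    also have "\<dots> \<le> K / N" using N by (simp add: divide_right_mono)
    finally show "u 1 - w 1 \<le> K / N" .
  qed
  have u0: "0 \<le> u k" if "k \<in> {1..K}" for k
    using near(3)[of k] u1'(1) w01(1)[of 1] that K by (cases "k = 1") auto
  have u1le: "u k \<le> 1" if "k \<in> {1..K}" for k
    using member_le_sum[of k "{1..K}" u] u0 usum that by auto
  have uQ: "u k \<in> \<rat>" if "k \<in> {1..K}" for k
    unfolding u_def by (auto intro!: Rats_diff Rats_sum Rats_divide)
  have wu: "(\<Sum>k=1..K. \<bar>w k - u k\<bar>) \<le> 2 * (K / N)"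
  proof -
    have "(\<Sum>k=2..K. \<bar>w k - u k\<bar>) = u 1 - w 1" unfolding u1 using near(1) by (intro sum.cong) auto
    then show ?thesis unfolding split using u1' by linarith
  qed
  define v where "v = (\<lambda>k. (1 - K * d') * u k + d')"
  have Kd: "0 \<le> 1 - K * d'" "1 - K * d' \<le> 1" using d' d K0 by (auto simp: field_simps)
  have vsum: "(\<Sum>k=1..K. v k) = 1"
    using usum by (simp add: v_def sum.distrib sum_distrib_left[symmetric])
  have vd: "d \<le> v k" if "k \<in> {1..K}" for k using u0[OF that] Kd d' by (simp add: v_def add_increasing)
  have v1: "v k \<le> 1" if "k \<in> {1..K}" for k
  proof -
    have "v k \<le> (\<Sum>k=1..K. v k)" using vd d that by (intro member_le_sum) (auto intro: order_trans less_imp_le)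
    then show ?thesis unfolding vsum .
  qed
  \<comment> \<open>\<open>\<bar>K u - 1\<bar> = \<bar>(K - 1) u - (1 - u)\<bar>\<close> is at most \<open>(K - 1) u + (1 - u)\<close>, which sums to \<open>2 (K - 1)\<close>.\<close>
  have uv: "(\<Sum>k=1..K. \<bar>u k - v k\<bar>) \<le> 2 * (d' * (real K - 1))"
  proof -
    have "\<bar>u k - v k\<bar> \<le> d' * ((real K - 1) * u k + (1 - u k))" if k: "k \<in> {1..K}" for k
    proof -
      have "u k - v k = d' * ((real K - 1) * u k - (1 - u k))" by (simp add: v_def algebra_simps)
      moreover have "\<bar>(real K - 1) * u k - (1 - u k)\<bar> \<le> (real K - 1) * u k + (1 - u k)"
      proof -
        have "\<bar>a - b\<bar> \<le> a + b" if "0 \<le> a" "0 \<le> b" for a b :: real using that by simp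
        then show ?thesis using u0[OF k] u1le[OF k] K by simp
      qed
      ultimately show ?thesis using d d' by (simp add: abs_mult mult_left_mono)
    qed
    then have "(\<Sum>k=1..K. \<bar>u k - v k\<bar>) \<le> (\<Sum>k=1..K. d' * ((real K - 1) * u k + (1 - u k)))" by (intro sum_mono)
    also have "\<dots> = d' * ((real K - 1) * (\<Sum>k=1..K. u k) + (K - (\<Sum>k=1..K. u k)))"
      by (simp add: sum.distrib sum_subtractf sum_distrib_left[symmetric])
    finally show ?thesis unfolding usum by (simp add: algebra_simps)
  qed
  have "(\<Sum>k=1..K. \<bar>w k - v k\<bar>) \<le> (\<Sum>k=1..K. \<bar>w k - u k\<bar> + \<bar>u k - v k\<bar>)" by (intro sum_mono) linarith
  also have "\<dots> \<le> 2 * (K / N) + 2 * (d' * (real K - 1))"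
    unfolding sum.distrib by (intro add_mono wu uv)
  finally have "(1/2) * (\<Sum>k=1..K. \<bar>w k - v k\<bar>) \<le> K / N + d' * (real K - 1)" by argo
  moreover have "d' * (real K - 1) \<le> 2 * d * (real K - 1)" using d' K by (intro mult_right_mono) auto
  ultimately have "(1/2) * (\<Sum>k=1..K. \<bar>w k - v k\<bar>) \<le> 2 * d * (real K - 1) + e" using N(2) by linarith
  moreover have "v \<in> weights K" unfolding weights_def using vd v1 vsum d by (auto intro: order_trans[OF less_imp_le[OF d(1)]])
  moreover have "v k \<in> {d..1} \<inter> \<rat>" if "k \<in> {1..K}" for k
    using vd[OF that] v1[OF that] uQ[OF that] d'(1) unfolding v_def by (auto intro!: Rats_add Rats_mult Rats_diff)
  ultimately show ?thesis by blast
qed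

lemma mix_densities_sound:
  assumes "q \<in> mix_densities F \<delta> (K, l)"
    and Fb: "\<And>k f. k \<in> {1..K} \<Longrightarrow> f \<in> Fbar k (l k) \<Longrightarrow> prob_density \<mu> f"
    and F: "\<And>k. k \<in> {1..K} \<Longrightarrow> F k (l k) \<subseteq> Fbar k (l k)"
  shows "prob_density \<mu> q" "dens_measure \<mu> q \<in> mix_model \<mu> Fbar (K, l)"
proof -
  obtain w f where q: "q = (\<lambda>x. \<Sum>k=1..K. w k * f k x)" and w: "w \<in> weights K"
    and f: "\<And>k. k \<in> {1..K} \<Longrightarrow> f k \<in> F k (l k)"
    using assms(1) by (auto simp: mix_densities_def)
  have fb: "f k \<in> Fbar k (l k)" if "k \<in> {1..K}" for k using f F that by blast
  have fd: "prob_density \<mu> (f k)" if "k \<in> {1..K}" for k using Fb fb that by blast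
  have w0: "0 \<le> w k" if "k \<in> {1..K}" for k using w that by (auto simp: weights_def)
  show "prob_density \<mu> q" unfolding q using w by (intro prob_density_mixture fd w0) (auto simp: weights_def)
  have "dens_measure \<mu> q = mixture \<mu> K w (\<lambda>k. dens_measure \<mu> (f k))"
    unfolding q by (intro mixture_dens_measure[symmetric] w0 prob_densityD(1)[OF fd] prob_densityD(2)[OF fd])
  then show "dens_measure \<mu> q \<in> mix_model \<mu> Fbar (K, l)"
    using w fb unfolding mix_model_def by (simp, intro exI[of _ w] exI[of _ "\<lambda>k. dens_measure \<mu> (f k)"]) auto
qed

lemma countable_mix_densities:
  assumes "\<And>k. k \<in> {1..K} \<Longrightarrow> countable (F k (l k))"
  shows "countable (mix_densities F \<delta> (K, l))"
proof (rule countable_subset)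
  show "mix_densities F \<delta> (K, l) \<subseteq> (\<lambda>(w, f) x. \<Sum>k=1..K. w k * f k x) `
     ((\<Pi>\<^sub>E k\<in>{1..K}. \<rat>) \<times> (\<Pi>\<^sub>E k\<in>{1..K}. F k (l k)))"
  proof
    fix q assume "q \<in> mix_densities F \<delta> (K, l)"
    then obtain w f where q: "q = (\<lambda>x. \<Sum>k=1..K. w k * f k x)"
      and wf: "\<forall>k\<in>{1..K}. w k \<in> {\<delta> (K, l)..1} \<inter> \<rat> \<and> f k \<in> F k (l k)"
      by (auto simp: mix_densities_def)
    have "q = (\<lambda>(w, f) x. \<Sum>k=1..K. w k * f k x) (restrict w {1..K}, restrict f {1..K})"
      unfolding q by (simp add: fun_eq_iff)
    moreover have "(restrict w {1..K}, restrict f {1..K}) \<in> (\<Pi>\<^sub>E k\<in>{1..K}. \<rat>) \<times> (\<Pi>\<^sub>E k\<in>{1..K}. F k (l k))"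
      using wf by auto
    ultimately show "q \<in> (\<lambda>(w, f) x. \<Sum>k=1..K. w k * f k x) `
     ((\<Pi>\<^sub>E k\<in>{1..K}. \<rat>) \<times> (\<Pi>\<^sub>E k\<in>{1..K}. F k (l k)))" by (rule image_eqI)
  qed
  show "countable ((\<lambda>(w, f) x. \<Sum>k=1..K. w k * f k x) `
     ((\<Pi>\<^sub>E k\<in>{1..K}. \<rat>) \<times> (\<Pi>\<^sub>E k\<in>{1..K}. F k (l k))))"
    using assms countable_rat by (intro countable_image countable_SIGMA countable_PiE) auto
qed

text \<open>The distance to the reference in the discretized family splits into a change of the weights,
  bounded by their total variation distance, and a change of the components, which are dense; the
  latter and the rounding of the weights are as small as desired.\<close>

lemma mix_densities_approx:
  assumes mu: "sigma_finite_measure \<mu>" and K: "1 \<le> K"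
    and Fb: "\<And>k f. k \<in> {1..K} \<Longrightarrow> f \<in> Fbar k (l k) \<Longrightarrow> prob_density \<mu> f"
    and F: "\<And>k. k \<in> {1..K} \<Longrightarrow> F k (l k) \<subseteq> Fbar k (l k)"
    and dense: "\<And>k. k \<in> {1..K} \<Longrightarrow> dens_measure \<mu> ` Fbar k (l k) \<subseteq> hellinger_closure \<mu> (dens_measure \<mu> ` F k (l k))"
    and \<delta>: "0 < \<delta> (K, l)" "\<delta> (K, l) \<le> 1 / real K"
    and Q: "Q \<in> mix_model \<mu> Fbar (K, l)" and e: "0 < e"
  shows "\<exists>q\<in>mix_densities F \<delta> (K, l). hellinger_sq Q (dens_measure \<mu> q) \<le> 3 * \<delta> (K, l) * (real K - 1) + e"
proof -
  obtain w f where w: "w \<in> weights K" and f: "\<And>k. k \<in> {1..K} \<Longrightarrow> f k \<in> Fbar k (l k)"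
    and eq: "Q = mixture \<mu> K w (\<lambda>k. dens_measure \<mu> (f k))"
    using mix_model_mixture[OF Q] by blast
  have fd: "prob_density \<mu> (f k)" if "k \<in> {1..K}" for k using Fb f that by blast
  have w0: "0 \<le> w k" if "k \<in> {1..K}" for k using w that by (auto simp: weights_def)
  have w1: "(\<Sum>k=1..K. w k) = 1" using w by (simp add: weights_def)
  note eq
  also have "mixture \<mu> K w (\<lambda>k. dens_measure \<mu> (f k)) = dens_measure \<mu> (\<lambda>x. \<Sum>k=1..K. w k * f k x)"
    by (intro mixture_dens_measure w0 prob_densityD(1)[OF fd] prob_densityD(2)[OF fd])
  finally have Qd: "Q = dens_measure \<mu> (\<lambda>x. \<Sum>k=1..K. w k * f k x)" .
  obtain v where v: "v \<in> weights K" "\<And>k. k \<in> {1..K} \<Longrightarrow> v k \<in> {\<delta> (K, l)..1} \<inter> \<rat>"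
    and wv: "(1/2) * (\<Sum>k=1..K. \<bar>w k - v k\<bar>) \<le> 2 * \<delta> (K, l) * (real K - 1) + e / 6"
    using rational_weights_approx[OF K w \<delta>, of "e / 6"] e by auto
  have v0: "0 \<le> v k" if "k \<in> {1..K}" for k using v that by (auto simp: weights_def)
  have v1: "(\<Sum>k=1..K. v k) = 1" using v by (simp add: weights_def)
  have "\<forall>k\<in>{1..K}. \<exists>g. g \<in> F k (l k) \<and> hellinger_sq (dens_measure \<mu> (f k)) (dens_measure \<mu> g) \<le> e / 6"
  proof
    fix k assume k: "k \<in> {1..K}"
    have "dens_measure \<mu> (f k) \<in> hellinger_closure \<mu> (dens_measure \<mu> ` F k (l k))"
      using dense[OF k] f(1)[OF k] by blast
    moreover have "0 < sqrt (e / 6)" using e by simp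
    ultimately obtain g where "g \<in> F k (l k)" "sqrt (hellinger_sq (dens_measure \<mu> (f k)) (dens_measure \<mu> g)) < sqrt (e / 6)"
      unfolding hellinger_closure_def by blast
    then show "\<exists>g. g \<in> F k (l k) \<and> hellinger_sq (dens_measure \<mu> (f k)) (dens_measure \<mu> g) \<le> e / 6" by force
  qed
  then obtain g where g: "\<And>k. k \<in> {1..K} \<Longrightarrow> g k \<in> F k (l k)"
    "\<And>k. k \<in> {1..K} \<Longrightarrow> hellinger_sq (dens_measure \<mu> (f k)) (dens_measure \<mu> (g k)) \<le> e / 6" by metis
  have gd: "prob_density \<mu> (g k)" if "k \<in> {1..K}" for k using Fb F g(1) that by blast
  let ?q = "\<lambda>x. \<Sum>k=1..K. v k * g k x" and ?m = "\<lambda>x. \<Sum>k=1..K. v k * f k x" and ?p = "\<lambda>x. \<Sum>k=1..K. w k * f k x"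
  have qm: "?q \<in> mix_densities F \<delta> (K, l)"
    unfolding mix_densities_def using v g(1) by (simp, intro exI[of _ v] exI[of _ g]) auto
  have d: "prob_density \<mu> ?q" "prob_density \<mu> ?m" "prob_density \<mu> ?p"
    using prob_density_mixture[of "{1..K}" \<mu> g v] prob_density_mixture[of "{1..K}" \<mu> f v]
      prob_density_mixture[of "{1..K}" \<mu> f w] fd gd v0 v1 w0 w1 by blast+
  have 1: "hellinger_sq (dens_measure \<mu> ?p) (dens_measure \<mu> ?m) \<le> 2 * \<delta> (K, l) * (real K - 1) + e / 6"
    using hellinger_sq_mixture_weights[of \<mu> "{1..K}" f w v] mu fd w0 w1 v0 v1 wv by fastforce
  have 2: "hellinger_sq (dens_measure \<mu> ?m) (dens_measure \<mu> ?q) \<le> e / 6"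
  proof -
    have "hellinger_sq (dens_measure \<mu> ?m) (dens_measure \<mu> ?q)
        \<le> (\<Sum>k=1..K. v k * hellinger_sq (dens_measure \<mu> (f k)) (dens_measure \<mu> (g k)))"
      using hellinger_sq_mixture_components[of \<mu> "{1..K}" f g v] mu fd gd v0 v1 by blast
    also have "\<dots> \<le> (\<Sum>k=1..K. v k * (e / 6))" using g(2) v0 by (intro sum_mono mult_left_mono)
    also have "\<dots> = e / 6" unfolding sum_distrib_right[symmetric] v1 by simp
    finally show ?thesis .
  qed
  have "hellinger_sq (dens_measure \<mu> ?p) (dens_measure \<mu> ?q)
     \<le> (1 + 1/2) * hellinger_sq (dens_measure \<mu> ?p) (dens_measure \<mu> ?m) + (1 + 1 / (1/2)) * hellinger_sq (dens_measure \<mu> ?m) (dens_measure \<mu> ?q)"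
    by (rule hellinger_sq_triangle[OF prob_densityD(6)[OF d(3)] prob_densityD(6)[OF d(1)] prob_densityD(6)[OF d(2)]]) auto
  also have "\<dots> \<le> 3 * \<delta> (K, l) * (real K - 1) + e" using 1 2 e by simp
  finally show ?thesis using qm Qd by blast
qed

section \<open>Measurability of the loss\<close>

lemma hellinger_sq_prod_triangle:
  assumes P: "\<And>i. i \<in> {1..n} \<Longrightarrow> prob_space (P i)" "\<And>i. i \<in> {1..n} \<Longrightarrow> sets (P i) = sets M"
    and Q: "prob_space Q" "sets Q = sets M" and S: "prob_space S" "sets S = sets M" and e: "0 < e"
  shows "hellinger_sq_prod n P (\<lambda>_. Q) \<le> (1 + e) * hellinger_sq_prod n P (\<lambda>_. S) + (1 + 1 / e) * (n * hellinger_sq S Q)"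
proof -
  have "hellinger_sq_prod n P (\<lambda>_. Q) \<le> (\<Sum>i=1..n. (1 + e) * hellinger_sq (P i) S + (1 + 1 / e) * hellinger_sq S Q)"
    unfolding hellinger_sq_prod_def using assms by (intro sum_mono hellinger_sq_triangle) auto
  also have "\<dots> = (1 + e) * hellinger_sq_prod n P (\<lambda>_. S) + n * ((1 + 1 / e) * hellinger_sq S Q)"
    by (simp add: hellinger_sq_prod_def sum.distrib sum_distrib_left)
  finally show ?thesis by (simp only: mult.left_commute)
qed

text \<open>The loss is continuous for the Hellinger metric. The relaxed triangle inequality, with a factor
  \<open>1 + e\<close> as close to \<open>1\<close> as needed, gives the openness of its superlevel sets.\<close>

lemma hellinger_open_superlevel:
  assumes P: "\<And>i. i \<in> {1..n} \<Longrightarrow> prob_space (P i)" "\<And>i. i \<in> {1..n} \<Longrightarrow> sets (P i) = sets M"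
  shows "hellinger_open M {Q \<in> space (prob_algebra M). c < hellinger_sq_prod n P (\<lambda>_. Q)}"
  unfolding hellinger_open_def
proof (intro conjI ballI)
  fix Q assume "Q \<in> {Q \<in> space (prob_algebra M). c < hellinger_sq_prod n P (\<lambda>_. Q)}"
  then have Q: "prob_space Q" "sets Q = sets M" and cQ: "c < hellinger_sq_prod n P (\<lambda>_. Q)"
    by (auto simp: space_prob_algebra)
  define g where "g = hellinger_sq_prod n P (\<lambda>_. Q) - c"
  have g: "0 < g" using cQ by (simp add: g_def)
  define b where "b = \<bar>c\<bar> + 1"
  have b: "0 < b" "c \<le> b" by (auto simp: b_def)
  define e where "e = g / (2 * b)"
  have e: "0 < e" "e * c \<le> g / 2"
  proof -
    show "0 < e" using g b by (simp add: e_def)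
    have "e * c \<le> e * b" using \<open>0 < e\<close> b by (intro mult_left_mono) auto
    also have "\<dots> = g / 2" using b by (simp add: e_def)
    finally show "e * c \<le> g / 2" .
  qed
  define p where "p = 1 + 1 / e"
  have p: "0 < p" using e by (auto simp: p_def intro: add_pos_pos)
  define h where "h = g / (4 * p * (real n + 1))"
  have h: "0 < h" unfolding h_def using g p by (intro divide_pos_pos mult_pos_pos) auto
  have hn: "(1 + 1 / e) * (n * h) \<le> g / 4"
  proof -
    have "p * (n * h) \<le> p * ((real n + 1) * h)"
      using p h by (intro mult_left_mono mult_right_mono) auto
    also have "\<dots> = g / 4"
    proof -
      have "real n + 1 \<noteq> 0" by linarith
      then show ?thesis using p by (simp add: h_def)
    qed
    finally show ?thesis by (simp only: p_def)
  qed
  have "\<forall>Q'\<in>space (prob_algebra M). sqrt (hellinger_sq Q Q') < sqrt h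
      \<longrightarrow> Q' \<in> {Q \<in> space (prob_algebra M). c < hellinger_sq_prod n P (\<lambda>_. Q)}"
  proof (intro ballI impI)
    fix Q' assume Q'm: "Q' \<in> space (prob_algebra M)" and close: "sqrt (hellinger_sq Q Q') < sqrt h"
    then have Q': "prob_space Q'" "sets Q' = sets M" by (auto simp: space_prob_algebra)
    have cl: "hellinger_sq Q' Q \<le> h" using close hellinger_sq_commute[of Q Q'] Q Q' by simp
    have "c < hellinger_sq_prod n P (\<lambda>_. Q')"
    proof (rule ccontr)
      assume "\<not> ?thesis"
      then have le: "hellinger_sq_prod n P (\<lambda>_. Q') \<le> c" by simp
      have "hellinger_sq_prod n P (\<lambda>_. Q) \<le> (1 + e) * hellinger_sq_prod n P (\<lambda>_. Q') + (1 + 1 / e) * (n * hellinger_sq Q' Q)"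
        by (rule hellinger_sq_prod_triangle[OF P Q Q' e(1)])
      also have "\<dots> \<le> (1 + e) * c + (1 + 1 / e) * (n * h)"
        using le cl e by (intro add_mono mult_left_mono) auto
      also have "\<dots> \<le> c + g / 2 + g / 4" using e hn by (simp add: distrib_right)
      finally show False using g unfolding g_def by argo
    qed
    then show "Q' \<in> {Q \<in> space (prob_algebra M). c < hellinger_sq_prod n P (\<lambda>_. Q)}" using Q'm by simp
  qed
  then show "\<exists>\<epsilon>>0. \<forall>Q'\<in>space (prob_algebra M). sqrt (hellinger_sq Q Q') < \<epsilon>
      \<longrightarrow> Q' \<in> {Q \<in> space (prob_algebra M). c < hellinger_sq_prod n P (\<lambda>_. Q)}"
    using h by (intro exI[of _ "sqrt h"]) auto
qed auto

lemma hellinger_sq_prod_measurable: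
  assumes P: "\<And>i. i \<in> {1..n} \<Longrightarrow> prob_space (P i)" "\<And>i. i \<in> {1..n} \<Longrightarrow> sets (P i) = sets M"
  shows "(\<lambda>Q. hellinger_sq_prod n P (\<lambda>_. Q)) \<in> borel_measurable (hellinger_borel M)"
proof (rule borel_measurableI_greater)
  fix c
  have sub: "{U. hellinger_open M U} \<subseteq> Pow (space (prob_algebra M))" by (auto simp: hellinger_open_def)
  have sp: "space (hellinger_borel M) = space (prob_algebra M)"
    unfolding hellinger_borel_def using sub by (rule space_measure_of)
  have "{Q \<in> space (prob_algebra M). c < hellinger_sq_prod n P (\<lambda>_. Q)} \<in> sets (hellinger_borel M)"
    unfolding hellinger_borel_def using hellinger_open_superlevel[of n P M c] P sub by (auto simp: sets_measure_of)
  then show "{Q \<in> space (hellinger_borel M). c < hellinger_sq_prod n P (\<lambda>_. Q)} \<in> sets (hellinger_borel M)"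
    by (simp only: sp)
qed

section \<open>From the deviation inequality to the oracle inequality\<close>

lemma T_stat_swap:
  assumes "\<And>i. i \<in> {1..n} \<Longrightarrow> 0 \<le> q (x i)" "\<And>i. i \<in> {1..n} \<Longrightarrow> 0 \<le> q' (x i)"
  shows "T_stat n x q' q = - T_stat n x q q'"
  unfolding T_stat_def sum_negf[symmetric]
  using assms by (intro sum.cong) (auto simp: psi_sqrt_ratio rho_swap[of "q (x _)"] intro: rho_swap)

text \<open>The only probabilistic input is an upper bound on \<open>T q0 q\<close>, uniform in \<open>q\<close>. It is used twice:
  it bounds the supremum defining \<open>Upsilon q0\<close>, and, since \<open>T\<close> is antisymmetric, it bounds from
  below the term of index \<open>q0\<close> in \<open>Upsilon qh\<close>.\<close>

lemma near_minimizer_bound: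
  assumes nn: "\<And>q i. q \<in> Q \<Longrightarrow> i \<in> {1..n} \<Longrightarrow> 0 \<le> q (x i)"
    and pen: "\<And>q. q \<in> Q \<Longrightarrow> 0 \<le> pen q" and q0: "q0 \<in> Q"
    and dev: "\<And>q. q \<in> Q \<Longrightarrow> T_stat n x q0 q \<le> C - L q + pen q" and L: "\<And>q. q \<in> Q \<Longrightarrow> 0 \<le> L q"
    and qh: "qh \<in> Q" "Upsilon n Q pen x qh < (INF q\<in>Q. Upsilon n Q pen x q) + 8.24"
  shows "L qh \<le> 2 * C + 2 * pen q0 + 8.24"
proof -
  have bdd: "bdd_above ((\<lambda>q'. T_stat n x q q' - pen q') ` Q)" if q: "q \<in> Q" for q
  proof (rule bdd_aboveI2)
    fix q' assume q': "q' \<in> Q"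
    have "\<bar>T_stat n x q q'\<bar> \<le> n" using nn q q' by (intro abs_T_stat_le) auto
    then show "T_stat n x q q' - pen q' \<le> n" using pen[OF q'] by linarith
  qed
  have low: "T_stat n x q q' - pen q' + pen q \<le> Upsilon n Q pen x q" if "q \<in> Q" "q' \<in> Q" for q q'
    unfolding Upsilon_def using cSUP_upper[OF that(2) bdd[OF that(1)]] by simp
  have "0 \<le> Upsilon n Q pen x q" if q: "q \<in> Q" for q
    using low[OF q q] T_stat_swap[of n q x q] nn[OF q] by simp
  then have "bdd_below (Upsilon n Q pen x ` Q)" by (intro bdd_belowI2)
  then have "(INF q\<in>Q. Upsilon n Q pen x q) \<le> Upsilon n Q pen x q0" using q0 by (rule cINF_lower)
  moreover have "Upsilon n Q pen x q0 \<le> C + pen q0"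
  proof -
    have "(SUP q\<in>Q. T_stat n x q0 q - pen q) \<le> C"
    proof (rule cSUP_least)
      show "Q \<noteq> {}" using q0 by blast
      show "T_stat n x q0 q - pen q \<le> C" if "q \<in> Q" for q using dev[OF that] L[OF that] by linarith
    qed
    then show ?thesis by (simp add: Upsilon_def)
  qed
  moreover have "T_stat n x qh q0 - pen q0 + pen qh \<le> Upsilon n Q pen x qh" by (rule low[OF qh(1) q0])
  moreover have "T_stat n x qh q0 = - T_stat n x q0 qh"
    using nn q0 qh(1) by (intro T_stat_swap) auto
  ultimately show ?thesis using dev[OF qh(1)] qh(2) by linarith
qed

lemma kappa_bounds: "466 \<le> kappa" "kappa \<le> 471"
proof -
  have a: "1.4 \<le> sqrt (2::real)" by (rule real_le_rsqrt) (simp add: power2_eq_square)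
  have b: "sqrt (2::real) \<le> 1.415" by (rule real_le_lsqrt) (simp_all add: power2_eq_square)
  show "466 \<le> kappa" "kappa \<le> 471" using a b by (simp_all add: kappa_def)
qed

text \<open>The right-hand side is deterministic. It thus suffices to treat one index and one member \<open>S\<close> of
  its model for which the bound is within \<open>1\<close> of the infimum, with a reference \<open>q0\<close> close to \<open>S\<close>; the
  exceptional event may depend on \<open>q0\<close>. All errors made on the way are bounded by absolute
  constants, whose sum is below \<open>5014 * 1.49\<close>.\<close>

theorem theorem12:
  fixes \<Omega> :: "'w measure" and \<mu> :: "'a measure" and n :: nat
    and X :: "nat \<Rightarrow> 'w \<Rightarrow> 'a" and Pstar :: "nat \<Rightarrow> 'a measure"
    and \<Lambda> :: "nat \<Rightarrow> 'l set" and Fbar F :: "nat \<Rightarrow> 'l \<Rightarrow> ('a \<Rightarrow> real) set"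
    and \<Theta> :: "'l mix_index set" and \<delta> \<Delta> :: "'l mix_index \<Rightarrow> real"
    and Phat :: "(nat \<Rightarrow> 'a) \<Rightarrow> 'a measure" and \<xi> :: real
  assumes "n \<ge> 1"
    and "prob_space \<Omega>"
    and "prob_space.indep_vars \<Omega> (\<lambda>_. \<mu>) X {1..n}"
    and "\<And>i. i \<in> {1..n} \<Longrightarrow> distr \<Omega> \<mu> (X i) = Pstar i"
    and "sigma_finite_measure \<mu>"
    and "\<And>k. k \<ge> 1 \<Longrightarrow> countable (\<Lambda> k)"
    and "\<And>k j f. k \<ge> 1 \<Longrightarrow> j \<in> \<Lambda> k \<Longrightarrow> f \<in> Fbar k j \<Longrightarrow> prob_density \<mu> f"
    and "\<And>k j. k \<ge> 1 \<Longrightarrow> j \<in> \<Lambda> k \<Longrightarrow> VC_subgraph \<mu> (Fbar k j)"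
    and "\<And>k j. k \<ge> 1 \<Longrightarrow> j \<in> \<Lambda> k \<Longrightarrow> F k j \<subseteq> Fbar k j \<and> countable (F k j)"
    and "\<And>k j. k \<ge> 1 \<Longrightarrow> j \<in> \<Lambda> k \<Longrightarrow>
           dens_measure \<mu> ` Fbar k j \<subseteq> hellinger_closure \<mu> (dens_measure \<mu> ` F k j)"
    and "\<Theta> \<subseteq> mix_indices \<Lambda>"
    and "\<And>\<theta>. \<theta> \<in> \<Theta> \<Longrightarrow> \<delta> \<theta> \<in> {0<..1 / real (fst \<theta>)}"
    and "\<And>\<theta>. \<theta> \<in> \<Theta> \<Longrightarrow> 0 \<le> \<Delta> \<theta>"
    and "(\<lambda>\<theta>. exp (- \<Delta> \<theta>)) summable_on \<Theta>" and "(\<Sum>\<^sub>\<infinity>\<theta>\<in>\<Theta>. exp (- \<Delta> \<theta>)) \<le> 1"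
    and "\<xi> > 0"
    and "rho_estimator n \<mu> (\<Union>\<theta>\<in>\<Theta>. mix_densities F \<delta> \<theta>) (mix_pen n \<mu> Fbar \<Theta> \<delta> \<Delta>) Phat"
  shows "measure \<Omega> {\<omega> \<in> space \<Omega>.
           ereal (hellinger_sq_prod n Pstar (\<lambda>_. Phat (\<lambda>i\<in>{1..n}. X i \<omega>)))
           \<le> (INF \<theta>\<in>\<Theta>.
                300 * (hellinger_sq_model n Pstar (mix_model \<mu> Fbar \<theta>)
                       + ereal (real n * (real (fst \<theta>) - 1) * \<delta> \<theta>))
                + 5014 * ereal (174.1 * complexity n \<mu> Fbar \<delta> \<theta> + \<Delta> \<theta>))
             + ereal (5014 * (1.49 + \<xi>))}
         \<ge> 1 - exp (- \<xi>)"
proof -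
  note n = assms(1) and iv = assms(3) and law = assms(4) and mu = assms(5) and cL = assms(6) and Fd = assms(7)
    and VC = assms(8) and FF = assms(9) and dense = assms(10) and \<Theta> = assms(11) and \<delta> = assms(12)
    and \<Delta> = assms(13,14,15) and \<xi> = assms(16) and est = assms(17)
  interpret \<Omega>: prob_space \<Omega> by (rule assms(2))
  have Xm: "X i \<in> measurable \<Omega> \<mu>" if "i \<in> {1..n}" for i
    using iv that unfolding \<Omega>.indep_vars_def by auto
  have P: "prob_space (Pstar i)" "sets (Pstar i) = sets \<mu>" if "i \<in> {1..n}" for i
  proof -
    show "prob_space (Pstar i)" unfolding law[OF that, symmetric] by (rule \<Omega>.prob_space_distr[OF Xm[OF that]])
    show "sets (Pstar i) = sets \<mu>" unfolding law[OF that, symmetric] by simp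
  qed
  let ?PM = "\<Pi>\<^sub>M i\<in>{1..n}. Pstar i"
  define XX where "XX = (\<lambda>\<omega>. \<lambda>i\<in>{1..n}. X i \<omega>)"
  have sPM: "sets ?PM = sets (\<Pi>\<^sub>M i\<in>{1..n}. \<mu>)" using P by (intro sets_PiM_cong) auto
  have XXm: "XX \<in> measurable \<Omega> (\<Pi>\<^sub>M i\<in>{1..n}. \<mu>)" unfolding XX_def by (intro measurable_restrict Xm)
  have XXP: "XX \<in> measurable \<Omega> ?PM" using XXm measurable_cong_sets[OF refl sPM] by blast
  have "distr \<Omega> (\<Pi>\<^sub>M i\<in>{1..n}. \<mu>) XX = (\<Pi>\<^sub>M i\<in>{1..n}. distr \<Omega> \<mu> (X i))"
    unfolding XX_def by (rule \<Omega>.indep_vars_iff_distr_eq_PiM'[THEN iffD1, OF _ Xm iv]) (use n in auto)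
  also have "\<dots> = ?PM" by (intro PiM_cong law) auto
  finally have lawX: "distr \<Omega> ?PM XX = ?PM" using distr_cong[OF refl sPM, of \<Omega> XX XX] by simp
  define Q where "Q = (\<Union>\<theta>\<in>\<Theta>. mix_densities F \<delta> \<theta>)"
  define pen where "pen = mix_pen n \<mu> Fbar \<Theta> \<delta> \<Delta>"
  define H where "H = (\<lambda>S. hellinger_sq_prod n Pstar (\<lambda>_. S))"
  have Kl: "1 \<le> fst \<theta>" "\<And>k. k \<in> {1..fst \<theta>} \<Longrightarrow> snd \<theta> k \<in> \<Lambda> k" if "\<theta> \<in> \<Theta>" for \<theta>
    using \<Theta> that by (auto simp: mix_indices_def PiE_def Pi_def)
  have Fd': "prob_density \<mu> f" if "\<theta> \<in> \<Theta>" "k \<in> {1..fst \<theta>}" "f \<in> Fbar k (snd \<theta> k)" for \<theta> k f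
    using Fd[OF _ Kl(2)[OF that(1,2)] that(3)] that(2) by simp
  have FF': "F k (snd \<theta> k) \<subseteq> Fbar k (snd \<theta> k)" "countable (F k (snd \<theta> k))"
    "dens_measure \<mu> ` Fbar k (snd \<theta> k) \<subseteq> hellinger_closure \<mu> (dens_measure \<mu> ` F k (snd \<theta> k))"
    if "\<theta> \<in> \<Theta>" "k \<in> {1..fst \<theta>}" for \<theta> k
    using FF[OF _ Kl(2)[OF that]] dense[OF _ Kl(2)[OF that]] that(2) by auto
  have cT: "countable \<Theta>"
  proof (rule countable_subset[OF \<Theta>])
    show "countable (mix_indices \<Lambda>)" unfolding mix_indices_def using cL
      by (intro countable_SIGMA countable_PiE) auto
  qed
  have sound: "prob_density \<mu> q" "dens_measure \<mu> q \<in> mix_model \<mu> Fbar \<theta>"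
    if "\<theta> \<in> \<Theta>" "q \<in> mix_densities F \<delta> \<theta>" for \<theta> q
    using mix_densities_sound[of q F \<delta> "fst \<theta>" "snd \<theta>" Fbar \<mu>] that Fd'[OF that(1)] FF'(1)[OF that(1)] by auto
  have cQ: "countable Q" unfolding Q_def
  proof (rule countable_UN[OF cT])
    fix \<theta> assume "\<theta> \<in> \<Theta>"
    then show "countable (mix_densities F \<delta> \<theta>)"
      using countable_mix_densities[of "fst \<theta>" F "snd \<theta>" \<delta>] FF'(2) by simp
  qed
  have Qd: "prob_density \<mu> q" if "q \<in> Q" for q using that sound(1) by (auto simp: Q_def)
  define val where "val = (\<lambda>\<theta>. 818.1 * complexity n \<mu> Fbar \<delta> \<theta> / 4.7 + \<Delta> \<theta>)"
  define Th where "Th = (\<lambda>q. {\<theta>\<in>\<Theta>. dens_measure \<mu> q \<in> mix_model \<mu> Fbar \<theta>})"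
  have pen_eq: "pen q = kappa * (INF \<theta>\<in>Th q. val \<theta>)" for q
    by (simp add: pen_def mix_pen_def Th_def val_def)
  have cplx: "5.82 \<le> complexity n \<mu> Fbar \<delta> \<theta>" if t: "\<theta> \<in> \<Theta>" for \<theta>
  proof -
    have "(\<Sum>k=1..fst \<theta>. 1) \<le> (\<Sum>k=1..fst \<theta>. VC_index \<mu> (Fbar k (snd \<theta> k)))"
      using VC_index(2) VC[OF _ Kl(2)[OF t]] by (intro sum_mono) auto
    then have KV: "fst \<theta> \<le> VC_total \<mu> Fbar (fst \<theta>, snd \<theta>)" by (simp add: VC_total_def case_prod_beta)
    have d: "0 < \<delta> \<theta>" "\<delta> \<theta> \<le> 1 / real (fst \<theta>)" using \<delta>[OF t] by auto
    have "1 / real (fst \<theta>) \<le> 1" using Kl(1)[OF t] by simp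
    then have d1: "\<delta> \<theta> \<le> 1" using d by linarith
    have "1 \<le> real (VC_total \<mu> Fbar \<theta>)" using KV Kl(1)[OF t] unfolding prod.collapse by linarith
    then have "5.82 * 1 \<le> 5.82 * real (VC_total \<mu> Fbar \<theta>)" by (intro mult_left_mono) auto
    also have "\<dots> \<le> complexity n \<mu> Fbar \<delta> \<theta>"
      using complexity_bounds(1)[of "fst \<theta>" \<mu> Fbar "snd \<theta>" \<delta> n] KV d d1 Kl(1)[OF t] unfolding prod.collapse by blast
    finally show ?thesis by simp
  qed
  have val0: "0 \<le> val \<theta>" if "\<theta> \<in> \<Theta>" for \<theta> using cplx[OF that] \<Delta>(1)[OF that] by (simp add: val_def)
  have bddv: "bdd_below (val ` Th q)" for q using val0 by (auto simp: Th_def intro: bdd_belowI2[where m=0])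
  have Thne: "Th q \<noteq> {}" if "q \<in> Q" for q using that sound(2) unfolding Th_def Q_def by blast
  have kap: "466 \<le> kappa" "kappa \<le> 471" by (rule kappa_bounds)+
  have pen0: "0 \<le> pen q" if "q \<in> Q" for q
    unfolding pen_eq using kap Thne[OF that] val0 by (intro mult_nonneg_nonneg cINF_greatest) (auto simp: Th_def)
  have "\<forall>q\<in>Q. \<exists>\<theta>. \<theta> \<in> Th q \<and> val \<theta> < (INF \<theta>\<in>Th q. val \<theta>) + 1"
  proof
    fix q assume "q \<in> Q"
    then have "\<exists>y\<in>val ` Th q. y < (INF \<theta>\<in>Th q. val \<theta>) + 1"
      using Thne by (intro cInf_lessD) auto
    then show "\<exists>\<theta>. \<theta> \<in> Th q \<and> val \<theta> < (INF \<theta>\<in>Th q. val \<theta>) + 1" by blast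
  qed
  then obtain th where "\<forall>q\<in>Q. th q \<in> Th q \<and> val (th q) < (INF \<theta>\<in>Th q. val \<theta>) + 1"
    by (rule bchoice[THEN exE])
  then have th: "th q \<in> \<Theta>" "dens_measure \<mu> q \<in> mix_model \<mu> Fbar (th q)" "val (th q) < (INF \<theta>\<in>Th q. val \<theta>) + 1"
    if "q \<in> Q" for q using that by (auto simp: Th_def)
  \<comment> \<open>The infimum in the penalty need not be attained; the large constants absorb the slack.\<close>
  have pen_ge: "752 * complexity n \<mu> Fbar \<delta> (th q) + 250 * \<Delta> (th q) \<le> pen q" if q: "q \<in> Q" for q
  proof -
    have "kappa * (val (th q) - 1) \<le> pen q"
      unfolding pen_eq using th(3)[OF q] kap by (intro mult_left_mono) auto
    moreover have c: "5.82 \<le> complexity n \<mu> Fbar \<delta> (th q)" "0 \<le> \<Delta> (th q)"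
      using cplx[OF th(1)[OF q]] \<Delta>(1)[OF th(1)[OF q]] by auto
    have "466 * (val (th q) - 1) \<le> kappa * (val (th q) - 1)"
      using kap c by (intro mult_right_mono) (auto simp: val_def)
    moreover have "752 * complexity n \<mu> Fbar \<delta> (th q) + 250 * \<Delta> (th q) \<le> 466 * (val (th q) - 1)"
      using c by (simp add: val_def)
    ultimately show ?thesis by linarith
  qed
  define cost where "cost = (\<lambda>\<theta>. 5014 * (174.1 * complexity n \<mu> Fbar \<delta> \<theta> + \<Delta> \<theta>))"
  define ex where "ex = (\<lambda>\<theta>. real n * (real (fst \<theta>) - 1) * \<delta> \<theta>)"
  define I where "I = (INF \<theta>\<in>\<Theta>. 300 * (hellinger_sq_model n Pstar (mix_model \<mu> Fbar \<theta>) + ereal (ex \<theta>))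
                + 5014 * ereal (174.1 * complexity n \<mu> Fbar \<delta> \<theta> + \<Delta> \<theta>))"
  define target where "target = {\<omega> \<in> space \<Omega>. ereal (H (Phat (XX \<omega>))) \<le> I + ereal (5014 * (1.49 + \<xi>))}"
  have ex0: "0 \<le> ex \<theta>" if "\<theta> \<in> \<Theta>" for \<theta> using \<delta>[OF that] Kl(1)[OF that] by (simp add: ex_def)
  have cost0: "0 \<le> cost \<theta>" if "\<theta> \<in> \<Theta>" for \<theta> using cplx[OF that] \<Delta>(1)[OF that] by (simp add: cost_def)
  have I0: "0 \<le> I"
    unfolding I_def
  proof (rule INF_greatest)
    fix \<theta> assume t: "\<theta> \<in> \<Theta>"
    have "0 \<le> hellinger_sq_model n Pstar (mix_model \<mu> Fbar \<theta>)"
      unfolding hellinger_sq_model_def hellinger_sq_prod_def by (intro INF_greatest) (auto intro!: sum_nonneg hellinger_sq_nonneg)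
    then show "0 \<le> 300 * (hellinger_sq_model n Pstar (mix_model \<mu> Fbar \<theta>) + ereal (ex \<theta>))
                + 5014 * ereal (174.1 * complexity n \<mu> Fbar \<delta> \<theta> + \<Delta> \<theta>)"
      using ex0[OF t] cost0[OF t] by (intro add_nonneg_nonneg mult_nonneg_nonneg) (auto simp: cost_def)
  qed
  have estm: "Phat \<in> measurable (\<Pi>\<^sub>M i\<in>{1..n}. \<mu>) (hellinger_borel \<mu>)"
    and estc: "\<And>x. x \<in> space (\<Pi>\<^sub>M i\<in>{1..n}. \<mu>) \<Longrightarrow> Phat x \<in> hellinger_closure \<mu>
        (dens_measure \<mu> ` {q\<in>Q. Upsilon n Q pen x q < (INF q'\<in>Q. Upsilon n Q pen x q') + 8.24})"
    using est unfolding rho_estimator_def Q_def pen_def by blast+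
  have HX: "(\<lambda>\<omega>. H (Phat (XX \<omega>))) \<in> borel_measurable \<Omega>"
    unfolding H_def using measurable_compose[OF measurable_compose[OF XXm estm] hellinger_sq_prod_measurable[OF P]] .
  have target_m: "target \<in> sets \<Omega>" unfolding target_def using HX by measurable
  \<comment> \<open>An infinite infimum makes the event certain.\<close>
  have "1 - exp (- \<xi>) \<le> measure \<Omega> target"
  proof (cases "I = \<infinity>")
    case True
    then have "target = space \<Omega>" by (auto simp: target_def)
    then show ?thesis by (simp add: \<Omega>.prob_space)
  next
    case False
    then obtain r where r: "I = ereal r" using I0 by (cases I) auto
    have "\<exists>\<theta>\<in>\<Theta>. \<exists>S\<in>mix_model \<mu> Fbar \<theta>. 300 * (H S + ex \<theta>) + cost \<theta> \<le> r + 1"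
    proof (rule ccontr)
      assume no: "\<not> ?thesis"
      have "ereal (r + 1) \<le> I"
        unfolding I_def
      proof (rule INF_greatest)
        fix \<theta> assume t: "\<theta> \<in> \<Theta>"
        have "ereal ((r + 1 - cost \<theta>) / 300 - ex \<theta>) \<le> hellinger_sq_model n Pstar (mix_model \<mu> Fbar \<theta>)"
          unfolding hellinger_sq_model_def
        proof (rule INF_greatest)
          fix S assume "S \<in> mix_model \<mu> Fbar \<theta>"
          then have "r + 1 < 300 * (H S + ex \<theta>) + cost \<theta>" using no t by (meson not_le)
          then have "(r + 1 - cost \<theta>) / 300 - ex \<theta> \<le> H S" by argo
          then show "ereal ((r + 1 - cost \<theta>) / 300 - ex \<theta>) \<le> ereal (hellinger_sq_prod n Pstar (\<lambda>_. S))"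
            by (simp add: H_def)
        qed
        then have "300 * (ereal ((r + 1 - cost \<theta>) / 300 - ex \<theta>) + ereal (ex \<theta>)) + ereal (cost \<theta>)
          \<le> 300 * (hellinger_sq_model n Pstar (mix_model \<mu> Fbar \<theta>) + ereal (ex \<theta>)) + ereal (cost \<theta>)"
          by (intro add_right_mono ereal_mult_left_mono) auto
        moreover have "300 * (ereal ((r + 1 - cost \<theta>) / 300 - ex \<theta>) + ereal (ex \<theta>)) + ereal (cost \<theta>) = ereal (r + 1)"
        proof -
          have "300 * (ereal a + ereal b) + ereal c = ereal (300 * (a + b) + c)" for a b c
            by (metis numeral_eq_ereal plus_ereal.simps(1) times_ereal.simps(1))
          then show ?thesis by (simp add: add_divide_distrib diff_divide_distrib)
        qed
        ultimately show "ereal (r + 1) \<le> 300 * (hellinger_sq_model n Pstar (mix_model \<mu> Fbar \<theta>) + ereal (ex \<theta>))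
                + 5014 * ereal (174.1 * complexity n \<mu> Fbar \<delta> \<theta> + \<Delta> \<theta>)"
          by (simp add: cost_def)
      qed
      then show False using r by simp
    qed
    then obtain \<theta> S where t: "\<theta> \<in> \<Theta>" and S: "S \<in> mix_model \<mu> Fbar \<theta>"
      and near: "300 * (H S + ex \<theta>) + cost \<theta> \<le> r + 1" by blast
    have d: "0 < \<delta> \<theta>" "\<delta> \<theta> \<le> 1 / real (fst \<theta>)" using \<delta>[OF t] by auto
    have n0: "0 < real n" using n by simp
    have "\<exists>q\<in>mix_densities F \<delta> (fst \<theta>, snd \<theta>). hellinger_sq S (dens_measure \<mu> q)
        \<le> 3 * \<delta> (fst \<theta>, snd \<theta>) * (real (fst \<theta>) - 1) + 1 / n"
      by (rule mix_densities_approx[where Fbar=Fbar])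
        (use mu Kl(1)[OF t] Fd'[OF t] FF'(1)[OF t] FF'(3)[OF t] d S n0 in simp_all)
    then obtain q0 where q0: "q0 \<in> mix_densities F \<delta> \<theta>"
      and hq0: "hellinger_sq S (dens_measure \<mu> q0) \<le> 3 * \<delta> \<theta> * (real (fst \<theta>) - 1) + 1 / n"
      unfolding prod.collapse by blast
    have q0Q: "q0 \<in> Q" using q0 t by (auto simp: Q_def)
    have q0d: "prob_density \<mu> q0" by (rule Qd[OF q0Q])
    have Sp: "prob_space S" "sets S = sets \<mu>"
    proof -
      have "S \<in> mix_model \<mu> Fbar (fst \<theta>, snd \<theta>)" using S by simp
      then obtain w f where w: "w \<in> weights (fst \<theta>)" and f: "\<And>k. k \<in> {1..fst \<theta>} \<Longrightarrow> f k \<in> Fbar k (snd \<theta> k)"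
        and Sm: "S = mixture \<mu> (fst \<theta>) w (\<lambda>k. dens_measure \<mu> (f k))"
        using mix_model_mixture by blast
      have fd: "prob_density \<mu> (f k)" if "k \<in> {1..fst \<theta>}" for k using Fd'[OF t that f[OF that]] .
      have w0: "0 \<le> w k" if "k \<in> {1..fst \<theta>}" for k using w that by (auto simp: weights_def)
      have "prob_density \<mu> (\<lambda>x. \<Sum>k=1..fst \<theta>. w k * f k x)"
        using w by (intro prob_density_mixture fd w0) (auto simp: weights_def)
      moreover have "S = dens_measure \<mu> (\<lambda>x. \<Sum>k=1..fst \<theta>. w k * f k x)"
        unfolding Sm by (intro mixture_dens_measure w0 prob_densityD(1)[OF fd] prob_densityD(2)[OF fd])
      ultimately show "prob_space S" "sets S = sets \<mu>" using prob_densityD(6) by auto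
    qed
    have Hq0: "H (dens_measure \<mu> q0) \<le> 2 * H S + 6 * ex \<theta> + 2"
    proof -
      have "H (dens_measure \<mu> q0) \<le> (1 + 1) * H S + (1 + 1 / 1) * (n * hellinger_sq S (dens_measure \<mu> q0))"
        unfolding H_def by (rule hellinger_sq_prod_triangle[OF P]) (use prob_densityD(6)[OF q0d] Sp in auto)
      also have "n * hellinger_sq S (dens_measure \<mu> q0) \<le> n * (3 * \<delta> \<theta> * (real (fst \<theta>) - 1) + 1 / n)"
        using hq0 n0 by (intro mult_left_mono) auto
      also have "\<dots> = 3 * ex \<theta> + 1" using n0 by (simp add: ex_def algebra_simps)
      finally show ?thesis by simp
    qed
    have pq0: "pen q0 \<le> 471 * (174.1 * complexity n \<mu> Fbar \<delta> \<theta> + \<Delta> \<theta>)"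
    proof -
      have "\<theta> \<in> Th q0" using sound(2)[OF t q0] t by (simp add: Th_def)
      then have "(INF \<theta>\<in>Th q0. val \<theta>) \<le> val \<theta>" by (rule cINF_lower[OF bddv])
      also have "val \<theta> \<le> 174.1 * complexity n \<mu> Fbar \<delta> \<theta> + \<Delta> \<theta>" using cplx[OF t] by (simp add: val_def)
      finally have "pen q0 \<le> kappa * (174.1 * complexity n \<mu> Fbar \<delta> \<theta> + \<Delta> \<theta>)"
        unfolding pen_eq using kap by (intro mult_left_mono) auto
      also have "\<dots> \<le> 471 * (174.1 * complexity n \<mu> Fbar \<delta> \<theta> + \<Delta> \<theta>)"
        using kap cplx[OF t] \<Delta>(1)[OF t] by (intro mult_right_mono) auto
      finally show ?thesis .
    qed
    have "\<exists>B\<in>sets ?PM. emeasure ?PM B \<le> ennreal (exp (- \<xi>)) \<and>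
      (\<forall>x\<in>space ?PM - B. \<forall>q\<in>Q. T_stat n x q0 q
         \<le> 4.16 * H (dens_measure \<mu> q0) - 0.195 * H (dens_measure \<mu> q)
         + 752 * complexity n \<mu> Fbar \<delta> (th q) + 250 * \<Delta> (th q) + 250 * \<xi>)"
      unfolding H_def
      by (rule uniform_deviation; fact mu P Fd VC \<Theta> cT \<delta> \<Delta> q0d cQ Qd th less_imp_le[OF \<xi>])
    then obtain B where B: "B \<in> sets ?PM" "emeasure ?PM B \<le> ennreal (exp (- \<xi>))"
      and dev: "\<And>x q. x \<in> space ?PM \<Longrightarrow> x \<notin> B \<Longrightarrow> q \<in> Q \<Longrightarrow> T_stat n x q0 q
         \<le> 4.16 * H (dens_measure \<mu> q0) - 0.195 * H (dens_measure \<mu> q)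
         + 752 * complexity n \<mu> Fbar \<delta> (th q) + 250 * \<Delta> (th q) + 250 * \<xi>" by blast
    have good: "H (Phat x) \<le> r + 5014 * (1.49 + \<xi>)" if x: "x \<in> space ?PM" "x \<notin> B" for x
    proof -
      have xm: "x \<in> space (\<Pi>\<^sub>M i\<in>{1..n}. \<mu>)" using x(1) sets_eq_imp_space_eq[OF sPM] by simp
      then have xs: "x i \<in> space \<mu>" if "i \<in> {1..n}" for i using that by (auto simp: space_PiM PiE_def Pi_def)
      have cl: "Phat x \<in> space (prob_algebra \<mu>)"
        "\<And>\<epsilon>. 0 < \<epsilon> \<Longrightarrow> \<exists>S\<in>dens_measure \<mu> ` {q\<in>Q. Upsilon n Q pen x q < (INF q'\<in>Q. Upsilon n Q pen x q') + 8.24}. sqrt (hellinger_sq (Phat x) S) < \<epsilon>"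
        using estc[OF xm] unfolding hellinger_closure_def by blast+
      \<comment> \<open>Passing from a near minimizer \<open>qh\<close> to a point of the closure at squared distance \<open>h\<close> changes the loss by at most \<open>2\<close>.\<close>
      define h where "h = 1 / (real n * (real n + 1))"
      have h: "0 < h" using n0 unfolding h_def by (intro divide_pos_pos mult_pos_pos) auto
      then have "0 < sqrt h" by simp
      from cl(2)[OF this] obtain qh where qh: "qh \<in> Q" "Upsilon n Q pen x qh < (INF q'\<in>Q. Upsilon n Q pen x q') + 8.24"
        and close: "sqrt (hellinger_sq (Phat x) (dens_measure \<mu> qh)) < sqrt h" by blast
      have Ph: "prob_space (Phat x)" "sets (Phat x) = sets \<mu>" using cl(1) by (auto simp: space_prob_algebra)
      have cl2: "hellinger_sq (dens_measure \<mu> qh) (Phat x) \<le> h"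
        using close hellinger_sq_commute[of "Phat x" "dens_measure \<mu> qh"] Ph by simp
      have qhp: "prob_space (dens_measure \<mu> qh)" by (rule prob_densityD(6)[OF Qd[OF qh(1)]])
      have Hb: "H (dens_measure \<mu> qh) \<le> n" unfolding H_def
        using hellinger_sq_prod_bounds(2)[of n Pstar "dens_measure \<mu> qh"] P qhp by simp
      have "0.195 * H (dens_measure \<mu> qh) \<le> 2 * (4.16 * H (dens_measure \<mu> q0) + 250 * \<xi>) + 2 * pen q0 + 8.24"
      proof (rule near_minimizer_bound[OF _ pen0 q0Q _ _ qh, where L="\<lambda>q. 0.195 * H (dens_measure \<mu> q)"])
        show "0 \<le> q (x i)" if "q \<in> Q" "i \<in> {1..n}" for q i by (rule prob_densityD(2)[OF Qd[OF that(1)] xs[OF that(2)]])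
        show "T_stat n x q0 q \<le> 4.16 * H (dens_measure \<mu> q0) + 250 * \<xi> - 0.195 * H (dens_measure \<mu> q) + pen q" if "q \<in> Q" for q
          using dev[OF x that] pen_ge[OF that] by linarith
        show "0 \<le> 0.195 * H (dens_measure \<mu> q)" if "q \<in> Q" for q
          unfolding H_def hellinger_sq_prod_def by (auto intro!: sum_nonneg hellinger_sq_nonneg)
      qed
      moreover have "0.195 * h \<le> 8.32 * s + 500 * y + 942 * c + 8.24"
        if "0.195 * h \<le> 2 * (4.16 * a + 250 * y) + 2 * p + 8.24" "a \<le> s" "p \<le> 471 * c" for a c h p s y :: real
        using that by simp
      ultimately have main: "0.195 * H (dens_measure \<mu> qh) \<le> 8.32 * (2 * H S + 6 * ex \<theta> + 2) + 500 * \<xi>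
          + 942 * (174.1 * complexity n \<mu> Fbar \<delta> \<theta> + \<Delta> \<theta>) + 8.24"
        using Hq0 pq0 by blast
      have HS: "0 \<le> H S" unfolding H_def hellinger_sq_prod_def by (intro sum_nonneg hellinger_sq_nonneg)
      have "H (Phat x) \<le> (1 + 1 / n) * H (dens_measure \<mu> qh) + (1 + 1 / (1 / n)) * (n * hellinger_sq (dens_measure \<mu> qh) (Phat x))"
        unfolding H_def by (rule hellinger_sq_prod_triangle[OF P Ph qhp]) (use n0 in auto)
      also have "(1 + 1 / (1 / n)) * (n * hellinger_sq (dens_measure \<mu> qh) (Phat x)) \<le> (1 + real n) * (n * h)"
        using cl2 n0 by (simp add: mult_left_mono)
      also have "(1 + real n) * (n * h) = 1"
      proof -
        have "1 + real n \<noteq> 0" by linarith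
        then show ?thesis using n0 by (simp add: h_def add.commute)
      qed
      also have "(1 + 1 / n) * H (dens_measure \<mu> qh) \<le> H (dens_measure \<mu> qh) + 1"
        using Hb n0 by (simp add: distrib_right divide_le_eq)
      finally have "H (Phat x) \<le> H (dens_measure \<mu> qh) + 2" by simp
      moreover have "h' \<le> 300 * (s + e) + 5014 * c + 5014 * y + 1000"
        if "h' \<le> h + 2" "0.195 * h \<le> 8.32 * (2 * s + 6 * e + 2) + 500 * y + 942 * c + 8.24"
          "0 \<le> s" "0 \<le> e" "0 \<le> c" "0 < y" for c e h h' s y :: real
      proof -
        have "39 * h = 200 * (0.195 * h)" by simp
        also have "\<dots> \<le> 200 * (8.32 * (2 * s + 6 * e + 2) + 500 * y + 942 * c + 8.24)"
          by (rule mult_left_mono[OF that(2)]) simp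
        also have "\<dots> = 3328 * s + 9984 * e + 100000 * y + 188400 * c + 4976" by (simp add: field_simps)
        finally show ?thesis using that(1,3-6) by simp
      qed
      moreover have "0 \<le> 174.1 * complexity n \<mu> Fbar \<delta> \<theta> + \<Delta> \<theta>" using cost0[OF t] by (simp add: cost_def)
      ultimately have "H (Phat x) \<le> 300 * (H S + ex \<theta>) + cost \<theta> + 5014 * \<xi> + 1000"
        using main HS ex0[OF t] \<xi> unfolding cost_def by blast
      then show ?thesis using near by simp
    qed
    have "1 - exp (- \<xi>) \<le> measure \<Omega> (space \<Omega> - XX -` B \<inter> space \<Omega>)"
    proof -
      have Bm: "XX -` B \<inter> space \<Omega> \<in> sets \<Omega>" using XXP B(1) by (rule measurable_sets)
      have "emeasure \<Omega> (XX -` B \<inter> space \<Omega>) = emeasure ?PM B"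
        using emeasure_distr[OF XXP B(1)] lawX by simp
      then have "measure \<Omega> (XX -` B \<inter> space \<Omega>) \<le> exp (- \<xi>)"
        using B(2) unfolding \<Omega>.emeasure_eq_measure by (metis ennreal_le_iff exp_ge_zero)
      then show ?thesis using \<Omega>.prob_compl[OF Bm] by simp
    qed
    also have "\<dots> \<le> measure \<Omega> target"
    proof (rule \<Omega>.finite_measure_mono[OF _ target_m])
      show "space \<Omega> - XX -` B \<inter> space \<Omega> \<subseteq> target"
      proof
        fix \<omega> assume w: "\<omega> \<in> space \<Omega> - XX -` B \<inter> space \<Omega>"
        then have "XX \<omega> \<in> space ?PM" "XX \<omega> \<notin> B" using measurable_space[OF XXP] by auto
        then have "H (Phat (XX \<omega>)) \<le> r + 5014 * (1.49 + \<xi>)" by (rule good)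
        then show "\<omega> \<in> target" using w by (simp add: target_def r)
      qed
    qed
    finally show ?thesis .
  qed
  then show ?thesis unfolding target_def H_def XX_def I_def ex_def .
qed

end
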